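(* Let $K$ be a field of prime characteristic $p>2$. Let $f\in K[x,y,z]$ be a homogeneous polynomial of degree three defining an elliptic curve $E$ in $\mathbb{P}^2_K$. Then $$FT(f)=\begin{cases}1 & \text{if } E \text{ is ordinary},\\ 1-\frac{1}{p} & \text{if } E \text{ is supersingular}.\end{cases}$$
   Context: For a field $K$ of prime characteristic $p$ and a polynomial $f\in R=K[x_1,\dots,x_t]$, the $F$-pure threshold of $f$ (at the origin) is $$FT(f):=\sup\left\{\frac{N}{p^e} \;\middle|\; N,e\in\mathbb{Z}_{>0},\ f^N\notin (x_1^{p^e},\dots,x_t^{p^e})R\right\}.$$ Here $R=K[x,y,z]$. An elliptic curve in $\mathbb{P}^2_K$ defined by a homogeneous cubic $f$ is a smooth plane cubic (so $f$ has an isolated singularity at the origin). For an elliptic curve $E$ in characteristic $p>2$, the Frobenius morphism $F:E\to E$ induces a map $F^*:H^1(E,\mathcal{O}_E)\to H^1(E,\mathcal{O}_E)$; $E$ is called supersingular if $F^*$ is the zero map, and ordinary otherwise. *)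

theory Defs
  imports
    Complex_Main
    "HOL-Library.Poly_Mapping"
    "HOL-Library.Numeral_Type"
    "HOL-Algebra.QuotRing"
    "HOL-Algebra.Product_Groups"
    "HOL-Algebra.Algebraic_Closure_Type"
begin

section \<open>Polynomials in finitely many variables\<close>

text \<open>
  The variables are the elements of a finite type \<open>'v\<close>; a monomial is its exponent vector.
  Multiplication on \<^typ>\<open>('v \<Rightarrow>\<^sub>0 nat) \<Rightarrow>\<^sub>0 'k\<close> is the usual convolution product.
\<close>

type_synonym ('v, 'k) mpoly = "('v \<Rightarrow>\<^sub>0 nat) \<Rightarrow>\<^sub>0 'k"

definition variable :: "'v \<Rightarrow> ('v, 'k::field) mpoly" where
  "variable v = Poly_Mapping.single (Poly_Mapping.single v 1) 1"

definition homogeneous :: "nat \<Rightarrow> ('v::finite, 'k::field) mpoly \<Rightarrow> bool" where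
  "homogeneous d f \<longleftrightarrow> (\<forall>m \<in> Poly_Mapping.keys f. (\<Sum>v\<in>UNIV. Poly_Mapping.lookup m v) = d)"

text \<open>Truncated subtraction of exponents is harmless below: where it occurs the coefficient is 0.\<close>

definition partial_deriv :: "'v \<Rightarrow> ('v, 'k::field) mpoly \<Rightarrow> ('v, 'k) mpoly" where
  "partial_deriv v f =
     (\<Sum>m \<in> Poly_Mapping.keys f.
        Poly_Mapping.single (m - Poly_Mapping.single v 1)
          (of_nat (Poly_Mapping.lookup m v) * Poly_Mapping.lookup f m))"

definition eval_ac :: "('v::finite, 'k::field) mpoly \<Rightarrow> ('v \<Rightarrow> 'k alg_closure) \<Rightarrow> 'k alg_closure" where
  "eval_ac f a =
     (\<Sum>m \<in> Poly_Mapping.keys f.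
        to_ac (Poly_Mapping.lookup f m) * (\<Prod>v\<in>UNIV. a v ^ Poly_Mapping.lookup m v))"


section \<open>The F-pure threshold at the origin\<close>

text \<open>The ideal generated by the \<open>q\<close>-th powers of the variables.\<close>

definition power_ideal :: "nat \<Rightarrow> ('v::finite, 'k::field) mpoly set" where
  "power_ideal q = range (\<lambda>g. \<Sum>v\<in>UNIV. g v * variable v ^ q)"

text \<open>
  The supremum is taken in the reals, so it has no meaning when the set is empty (\<open>f = 0\<close>) or
  unbounded (\<open>f\<close> not vanishing at the origin).
\<close>

definition F_pure_threshold :: "('v::finite, 'k::field) mpoly \<Rightarrow> real" where
  "F_pure_threshold f =
     Sup {real N / real (CHAR('k) ^ e) | N e. N > 0 \<and> e > 0 \<and> f ^ N \<notin> power_ideal (CHAR('k) ^ e)}"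


section \<open>Smooth plane cubics\<close>

text \<open>
  Smoothness over \<open>K\<close>, by the Jacobian criterion at all points over an algebraic closure. The
  form itself is listed along with its partial derivatives since Euler's relation does not help
  when the characteristic divides the degree.
\<close>

definition smooth_hypersurface :: "('v::finite, 'k::field) mpoly \<Rightarrow> bool" where
  "smooth_hypersurface f \<longleftrightarrow>
     (\<forall>a. eval_ac f a = 0 \<and> (\<forall>v. eval_ac (partial_deriv v f) a = 0) \<longrightarrow> (\<forall>v. a v = 0))"

definition elliptic_cubic :: "(3, 'k::field) mpoly \<Rightarrow> bool" where
  "elliptic_cubic f \<longleftrightarrow> homogeneous 3 f \<and> smooth_hypersurface f"


section \<open>The structure sheaf on the standard affine opens\<close>

text \<open>
  Let \<open>E = Proj (R/f)\<close> for a form \<open>f\<close>, and for a nonempty set \<open>I\<close> of variables let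
  \<open>U\<^sub>I = E \<inter> D\<^sub>+(\<Prod>v\<in>I. v)\<close>. Then \<open>\<Gamma>(U\<^sub>I, \<O>\<^sub>E)\<close> is the degree-zero part of \<open>(R/f)\<^sub>I = R\<^sub>I / f R\<^sub>I\<close>,
  where the subscript denotes inverting the variables in \<open>I\<close>. The localisation \<open>R\<^sub>I\<close> is realised
  inside the Laurent polynomials: exponents are integers, nonnegative outside \<open>I\<close>.
\<close>

type_synonym ('v, 'k) laurent = "('v \<Rightarrow>\<^sub>0 int) \<Rightarrow>\<^sub>0 'k"

definition to_laurent :: "('v, 'k::field) mpoly \<Rightarrow> ('v, 'k) laurent" where
  "to_laurent f =
     (\<Sum>m \<in> Poly_Mapping.keys f.
        Poly_Mapping.single (Poly_Mapping.map int m) (Poly_Mapping.lookup f m))"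

definition localisation :: "'v set \<Rightarrow> ('v, 'k::field) laurent set" where
  "localisation I = {g. \<forall>m \<in> Poly_Mapping.keys g. \<forall>v. v \<notin> I \<longrightarrow> Poly_Mapping.lookup m v \<ge> 0}"

definition degree_zero :: "('v::finite, 'k::field) laurent set" where
  "degree_zero = {g. \<forall>m \<in> Poly_Mapping.keys g. (\<Sum>v\<in>UNIV. Poly_Mapping.lookup m v) = 0}"

definition affine_ring :: "'v::finite set \<Rightarrow> ('v, 'k::field) laurent ring" where
  "affine_ring I =
     \<lparr>carrier = localisation I \<inter> degree_zero, monoid.mult = (*), one = 1, zero = 0, add = (+)\<rparr>"

definition affine_ideal :: "('v::finite, 'k::field) mpoly \<Rightarrow> 'v set \<Rightarrow> ('v, 'k) laurent set" where
  "affine_ideal f I = {to_laurent f * g | g. g \<in> localisation I} \<inter> degree_zero"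

definition sections :: "('v::finite, 'k::field) mpoly \<Rightarrow> 'v set \<Rightarrow> ('v, 'k) laurent set ring" where
  "sections f I = affine_ring I Quot affine_ideal f I"

text \<open>
  Restriction \<open>\<Gamma>(U\<^sub>I, \<O>\<^sub>E) \<rightarrow> \<Gamma>(U\<^sub>J, \<O>\<^sub>E)\<close> for \<open>I \<subseteq> J\<close>: a coset \<open>A\<close> of the ideal for \<open>I\<close> goes to the coset
  of the ideal for \<open>J\<close> that contains it.
\<close>

definition restr :: "('v::finite, 'k::field) mpoly \<Rightarrow> 'v set \<Rightarrow> ('v, 'k) laurent set \<Rightarrow> ('v, 'k) laurent set"
  where "restr f J A = (\<Union>a\<in>A. affine_ideal f J +>\<^bsub>affine_ring J\<^esub> a)"


section \<open>Cohomology of the structure sheaf, and Frobenius\<close>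

text \<open>
  \<open>H\<^sup>1(E, \<O>\<^sub>E)\<close> is the first Cech cohomology group of \<open>\<O>\<^sub>E\<close> for the affine cover \<open>U\<^sub>v\<close>, \<open>v\<close> ranging over
  the variables, computed with all (not only alternating or strictly increasing) cochains; note
  that \<open>U\<^sub>i \<inter> U\<^sub>j = U\<^bsub>{i,j}\<^esub>\<close>. The cochain groups are products of the additive groups of sections,
  written multiplicatively as required by \<open>HOL-Algebra\<close>.
\<close>

definition cech0 :: "('v::finite, 'k::field) mpoly \<Rightarrow> ('v \<Rightarrow> ('v, 'k) laurent set) monoid" where
  "cech0 f = product_group UNIV (\<lambda>i. add_monoid (sections f {i}))"

definition cech1 :: "('v::finite, 'k::field) mpoly \<Rightarrow> ('v \<times> 'v \<Rightarrow> ('v, 'k) laurent set) monoid" where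
  "cech1 f = product_group UNIV (\<lambda>(i, j). add_monoid (sections f {i, j}))"

definition cech2 :: "('v::finite, 'k::field) mpoly \<Rightarrow> ('v \<times> 'v \<times> 'v \<Rightarrow> ('v, 'k) laurent set) monoid" where
  "cech2 f = product_group UNIV (\<lambda>(i, j, k). add_monoid (sections f {i, j, k}))"

definition cech_d0 :: "('v::finite, 'k::field) mpoly
    \<Rightarrow> ('v \<Rightarrow> ('v, 'k) laurent set) \<Rightarrow> ('v \<times> 'v \<Rightarrow> ('v, 'k) laurent set)" where
  "cech_d0 f b = (\<lambda>(i, j).
     restr f {i, j} (b j) \<ominus>\<^bsub>sections f {i, j}\<^esub> restr f {i, j} (b i))"

definition cech_d1 :: "('v::finite, 'k::field) mpoly
    \<Rightarrow> ('v \<times> 'v \<Rightarrow> ('v, 'k) laurent set) \<Rightarrow> ('v \<times> 'v \<times> 'v \<Rightarrow> ('v, 'k) laurent set)" where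
  "cech_d1 f c = (\<lambda>(i, j, k).
     restr f {i, j, k} (c (j, k)) \<ominus>\<^bsub>sections f {i, j, k}\<^esub> restr f {i, j, k} (c (i, k))
       \<oplus>\<^bsub>sections f {i, j, k}\<^esub> restr f {i, j, k} (c (i, j)))"

definition cocycles1 :: "('v::finite, 'k::field) mpoly \<Rightarrow> ('v \<times> 'v \<Rightarrow> ('v, 'k) laurent set) monoid" where
  "cocycles1 f = (cech1 f)\<lparr>carrier := kernel (cech1 f) (cech2 f) (cech_d1 f)\<rparr>"

definition coboundaries1 :: "('v::finite, 'k::field) mpoly \<Rightarrow> ('v \<times> 'v \<Rightarrow> ('v, 'k) laurent set) set" where
  "coboundaries1 f = cech_d0 f ` carrier (cech0 f)"

definition H1 :: "('v::finite, 'k::field) mpoly \<Rightarrow> ('v \<times> 'v \<Rightarrow> ('v, 'k) laurent set) set monoid" where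
  "H1 f = cocycles1 f Mod coboundaries1 f"

text \<open>
  The Frobenius morphism of \<open>E\<close> is the identity on the underlying space and the \<open>p\<close>-th power map on
  \<open>\<O>\<^sub>E\<close>, so it acts on cochains by \<open>p\<close>-th powers of their components.
\<close>

definition frob_cochain :: "('v::finite, 'k::field) mpoly
    \<Rightarrow> ('v \<times> 'v \<Rightarrow> ('v, 'k) laurent set) \<Rightarrow> ('v \<times> 'v \<Rightarrow> ('v, 'k) laurent set)" where
  "frob_cochain f c = (\<lambda>(i, j). c (i, j) [^]\<^bsub>sections f {i, j}\<^esub> CHAR('k))"

text \<open>As with \<open>restr\<close>, the union over the representatives of a class is a single class.\<close>

definition frob_H1 :: "('v::finite, 'k::field) mpoly
    \<Rightarrow> ('v \<times> 'v \<Rightarrow> ('v, 'k) laurent set) set \<Rightarrow> ('v \<times> 'v \<Rightarrow> ('v, 'k) laurent set) set" where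
  "frob_H1 f \<xi> = (\<Union>c\<in>\<xi>. coboundaries1 f #>\<^bsub>cocycles1 f\<^esub> frob_cochain f c)"

definition supersingular :: "(3, 'k::field) mpoly \<Rightarrow> bool" where
  "supersingular f \<longleftrightarrow> (\<forall>\<xi> \<in> carrier (H1 f). frob_H1 f \<xi> = \<one>\<^bsub>H1 f\<^esub>)"

definition ordinary :: "(3, 'k::field) mpoly \<Rightarrow> bool" where
  "ordinary f \<longleftrightarrow> \<not> supersingular f"

end

theory Submission
  imports Defs
begin

text \<open>
  Write \<open>q = p ^ e\<close>, let \<open>m[q]\<close> be the ideal of the \<open>q\<close>-th powers of the variables, and let \<open>a\<close> be the
  coefficient of \<open>(xyz) ^ (p - 1)\<close> in \<open>f ^ (p - 1)\<close> (\<open>hasse_coefficient\<close>). As \<open>(xyz) ^ (p - 1)\<close> is the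
  only monomial of degree \<open>3(p - 1)\<close> outside \<open>m[p]\<close>, one has \<open>a = 0\<close> iff \<open>f ^ (p - 1) \<in> m[p]\<close>.

  Supersingular means \<open>a = 0\<close>. The sequence \<open>0 \<rightarrow> \<O>(-3) \<rightarrow> \<O> \<rightarrow> \<O>\<^sub>E \<rightarrow> 0\<close> identifies \<open>H\<^sup>1(E, \<O>\<^sub>E)\<close> with
  \<open>H\<^sup>2(\<O>(-3))\<close>, the line spanned by \<open>1/(xyz)\<close>: lift a cocycle to Laurent polynomials \<open>g\<^sub>i\<^sub>j\<close>, write
  \<open>g\<^sub>1\<^sub>2 - g\<^sub>0\<^sub>2 + g\<^sub>0\<^sub>1 = f h\<close>, and take the coefficient of \<open>1/(xyz)\<close> in \<open>h\<close>. Taking \<open>p\<close>-th powers of the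
  \<open>g\<^sub>i\<^sub>j\<close> replaces \<open>h\<close> by \<open>f ^ (p - 1) h ^ p\<close>, so Frobenius multiplies the \<open>p\<close>-th power of that coefficient
  by \<open>a\<close>. This is carried out in both directions in \<open>hasse_zero_imp_supersingular\<close> and
  \<open>supersingular_imp_hasse_zero\<close>.

  Ordinary case. The coefficient of \<open>(xyz) ^ (q - 1)\<close> in \<open>f ^ (q - 1)\<close> is a power of \<open>a\<close>, hence nonzero, so
  \<open>f ^ (q - 1) \<notin> m[q]\<close>, whereas \<open>f ^ q \<in> m[q]\<close>. Thus the threshold is 1.

  Supersingular case. Raising \<open>f ^ (p - 1) \<in> m[p]\<close> to the power \<open>q/p\<close> gives the upper bound \<open>1 - 1/p\<close>.
  For the lower bound, let \<open>f ^ N \<in> m[q]\<close> with \<open>p\<close> not dividing \<open>N \<le> q - 2\<close>. Since the partial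
  derivatives preserve \<open>m[q]\<close>, the form \<open>f ^ (N - 1)\<close> multiplies the ideal generated by \<open>f\<close> and its
  partial derivatives into \<open>m[q]\<close>. For a smooth cubic that ideal contains all forms of degree 6
  (\<open>jacobian_ideal_contains_sextics\<close>). A monomial of \<open>f ^ (N - 1)\<close> outside \<open>m[q]\<close> has degree at most
  \<open>3q - 9\<close>, so it can be multiplied by some monomial of degree 6 and stay outside; therefore
  \<open>f ^ (N - 1) \<in> m[q]\<close> (\<open>power_ideal_descent\<close>). Lowering exponents in this way until \<open>p\<close> divides them and
  then extracting \<open>p\<close>-th roots, one sees that \<open>f ^ N \<in> m[q]\<close> with \<open>N < (p - 1) q/p\<close> would end in
  \<open>1 \<in> m[p]\<close> (\<open>power_notin_of_descent\<close>).

  Forms of degree 6. Over an algebraic closure choose coordinates with a point of the curve at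
  \<open>(0:0:1)\<close> and its tangent line at \<open>X = 0\<close>; completing a square (here \<open>p \<noteq> 2\<close>) gives
  \<open>f = X Z\<^sup>2 + b Y\<^sup>2 Z + c(X, Y)\<close>. If \<open>b \<noteq> 0\<close>, the polar conic \<open>2 X Z + b Y\<^sup>2\<close> is smooth, hence a rational
  curve, and restricting to it turns the statement into one about binary forms without common zeros.
  If \<open>b = 0\<close>, the point is a flex, and \<open>c\<close> and \<open>c\<^sub>Y\<close> are binary forms without common zeros. Either way
  the Euclidean algorithm for polynomials in one variable finishes the proof.
\<close>

abbreviation lookup where "lookup \<equiv> Poly_Mapping.lookup"
abbreviation keys where "keys \<equiv> Poly_Mapping.keys"
abbreviation single where "single \<equiv> Poly_Mapping.single"

section \<open>Linear extension from monomials\<close>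

text \<open>
  Evaluation, base change, partial derivatives and the embedding into Laurent polynomials all arise
  from a map on terms \<open>c x\<^sup>m\<close> that is additive in \<open>c\<close>. Their additivity, and their multiplicativity where
  it holds, are consequences of the behaviour on terms.
\<close>

definition extend :: "('m \<Rightarrow> 'a::comm_ring_1 \<Rightarrow> 'r::comm_ring_1) \<Rightarrow> ('m \<Rightarrow>\<^sub>0 'a) \<Rightarrow> 'r" where
  "extend T f = (\<Sum>m\<in>keys f. T m (lookup f m))"

lemma poly_mapping_sum_single:
  "f = (\<Sum>m\<in>keys f. single m (lookup f m))"
proof (rule poly_mapping_eqI)
  fix k
  have "(\<Sum>m\<in>keys f. lookup (single m (lookup f m)) k)
      = (\<Sum>m\<in>keys f. if m = k then lookup f k else 0)"
    by (intro sum.cong) (auto simp: lookup_single when_def)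
  then show "lookup f k = lookup (\<Sum>m\<in>keys f. single m (lookup f m)) k"
    by (simp add: lookup_sum in_keys_iff)
qed

lemma extend_superset:
  assumes "finite S" "keys f \<subseteq> S" "\<And>m. T m 0 = 0"
  shows "extend T f = (\<Sum>m\<in>S. T m (lookup f m))"
  unfolding extend_def
  by (rule sum.mono_neutral_left) (use assms in \<open>auto simp: in_keys_iff\<close>)

lemma extend_single: "T m 0 = 0 \<Longrightarrow> extend T (single m c) = T m c"
  by (cases "c = 0") (auto simp: extend_def)

lemma extend_0 [simp]: "extend T 0 = 0"
  by (simp add: extend_def)

lemma extend_add:
  assumes "\<And>m. T m 0 = 0" "\<And>m a b. T m (a + b) = T m a + T m b"
  shows "extend T (f + g) = extend T f + extend T g"
proof -
  let ?S = "keys f \<union> keys g"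
  have "extend T h = (\<Sum>m\<in>?S. T m (lookup h m))"
    if "keys h \<subseteq> ?S" for h
    by (rule extend_superset) (use that assms in auto)
  moreover have "keys (f + g) \<subseteq> ?S" by (rule keys_add)
  ultimately show ?thesis by (simp add: lookup_add assms sum.distrib)
qed

text \<open>
  The coefficient-wise analogue of extensionality for linear maps: it reduces bilinear identities such
  as the Leibniz rule to a pair of terms.
\<close>

lemma additive_eqI:
  fixes F G :: "('m \<Rightarrow>\<^sub>0 'a::comm_monoid_add) \<Rightarrow> 'r::comm_monoid_add"
  assumes "\<And>f g. F (f + g) = F f + F g" "\<And>f g. G (f + g) = G f + G g" "F 0 = 0" "G 0 = 0"
    and "\<And>m c. F (single m c) = G (single m c)"
  shows "F f = G f"
proof -
  have *: "H (\<Sum>i\<in>I. h i) = (\<Sum>i\<in>I. H (h i))"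
    if "\<And>f g. H (f + g) = H f + H g" "H 0 = 0"
    for H :: "('m \<Rightarrow>\<^sub>0 'a) \<Rightarrow> 'r" and I :: "'m set" and h
    by (induction I rule: infinite_finite_induct) (auto simp: that)
  show ?thesis
    by (subst (1 2) poly_mapping_sum_single) (simp add: * assms)
qed

lemma extend_mult:
  fixes f g :: "'m::comm_monoid_add \<Rightarrow>\<^sub>0 'a::comm_ring_1"
  assumes "\<And>m. T m 0 = 0" "\<And>m a b. T m (a + b) = T m a + T m b"
    "\<And>m n a b. T (m + n) (a * b) = T m a * T n b"
  shows "extend T (f * g) = extend T f * extend T g"
proof (rule additive_eqI[of "\<lambda>f. extend T (f * g)" "\<lambda>f. extend T f * extend T g"])
  fix m c
  show "extend T (single m c * g) = extend T (single m c) * extend T g"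
    by (rule additive_eqI[of "\<lambda>g. extend T (single m c * g)"])
      (simp_all add: extend_add extend_single assms(1,2) mult_single assms(3) algebra_simps)
qed (auto simp: extend_add assms(1,2) algebra_simps)

lemma extend_power:
  fixes f :: "'m::comm_monoid_add \<Rightarrow>\<^sub>0 'a::comm_ring_1"
  assumes "\<And>m. T m 0 = 0" "\<And>m a b. T m (a + b) = T m a + T m b"
    "\<And>m n a b. T (m + n) (a * b) = T m a * T n b" "T 0 1 = 1"
  shows "extend T (f ^ n) = extend T f ^ n"
proof (induction n)
  case 0
  have "extend T (single 0 1) = 1"
    by (subst extend_single) (auto simp: assms(1,4))
  then show ?case by simp
qed (simp add: extend_mult assms)

section \<open>Monomial shifts and Frobenius\<close>

lemma lookup_single_mult:
  fixes g :: "'m::cancel_comm_monoid_add \<Rightarrow>\<^sub>0 'a::comm_ring_1"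
  shows "lookup (single m c * g) (m + k) = c * lookup g k"
proof (rule additive_eqI[of "\<lambda>g. lookup (single m c * g) (m + k)" "\<lambda>g. c * lookup g k"])
  fix n d
  show "lookup (single m c * single n d) (m + k) =
    c * lookup (single n d) k"
    by (simp add: mult_single lookup_single when_def)
qed (auto simp: lookup_add algebra_simps)

text \<open>
  The \<open>n\<close>-fold multiple of an exponent is written as an iterated sum, since exponents form only a
  commutative monoid here; this covers natural and integer exponents alike.
\<close>

lemma single_power:
  "single m c ^ n = single (\<Sum>i<n. m) (c ^ n :: 'a::comm_ring_1)"
  for m :: "'m::comm_monoid_add"
  by (induction n) (auto simp: mult_single add.commute)

lemma CHAR_poly_mapping:
  "CHAR('m::comm_monoid_add \<Rightarrow>\<^sub>0 'a::comm_ring_1) = CHAR('a)"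
proof (rule CHAR_eqI)
  have eq: "(of_nat n :: 'm \<Rightarrow>\<^sub>0 'a) = 0 \<longleftrightarrow> (of_nat n :: 'a) = 0" for n
    by (simp flip: single_of_nat del: single_of_nat) (metis lookup_single_eq lookup_zero single_zero)
  show "(of_nat CHAR('a) :: 'm \<Rightarrow>\<^sub>0 'a) = 0" by (simp only: eq of_nat_CHAR)
  show "CHAR('a) dvd n" if "(of_nat n :: 'm \<Rightarrow>\<^sub>0 'a) = 0" for n
    using that by (simp only: eq of_nat_eq_0_iff_char_dvd)
qed

lemma frobenius_power:
  fixes f :: "'m::comm_monoid_add \<Rightarrow>\<^sub>0 'a::comm_ring_1"
  assumes "Factorial_Ring.prime CHAR('a)"
  shows "f ^ CHAR('a) = (\<Sum>m\<in>keys f.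
    single (\<Sum>i<CHAR('a). m) (lookup f m ^ CHAR('a)))"
proof -
  have "f ^ CHAR('a) = (\<Sum>m\<in>keys f. single m (lookup f m)) ^ CHAR('a)"
    by (subst (1) poly_mapping_sum_single) (rule refl)
  also have "\<dots> = (\<Sum>m\<in>keys f. single m (lookup f m) ^ CHAR('a))"
    by (rule freshmans_dream_sum) (auto simp: CHAR_poly_mapping assms)
  finally show ?thesis by (simp add: single_power)
qed

section \<open>The Frobenius power of the maximal ideal\<close>

lemma variable_power:
  "variable v ^ n = single (single v n) (1 :: 'k::field)"
proof -
  have "(\<Sum>i<n. single v (1::nat)) = single v n"
    by (rule poly_mapping_eqI) (simp add: lookup_sum lookup_single when_def)
  then show ?thesis by (simp add: variable_def single_power)
qed

text \<open>
  A polynomial lies in this monomial ideal iff each of its monomials does. For the converse direction,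
  every monomial of \<open>g\<close> is assigned one variable whose \<open>q\<close>-th power divides it.
\<close>

lemma power_ideal_iff:
  fixes g :: "('v::finite, 'k::field) mpoly"
  shows "g \<in> power_ideal q \<longleftrightarrow> (\<forall>m\<in>keys g. \<exists>v. q \<le> lookup m v)"
proof
  assume "g \<in> power_ideal q"
  then obtain h where h: "g = (\<Sum>v\<in>UNIV. h v * variable v ^ q)"
    by (auto simp: power_ideal_def)
  show "\<forall>m\<in>keys g. \<exists>v. q \<le> lookup m v"
  proof
    fix m assume "m \<in> keys g"
    then obtain v where "m \<in> keys (h v * variable v ^ q)"
      using keys_sum[of "\<lambda>v. h v * variable v ^ q" UNIV] unfolding h by auto
    then obtain a where "m = a + single v q"
      using keys_mult[of "h v" "variable v ^ q"] by (auto simp: variable_power)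
    then have "q \<le> lookup m v" by (simp add: lookup_add)
    then show "\<exists>v. q \<le> lookup m v" ..
  qed
next
  assume *: "\<forall>m\<in>keys g. \<exists>v. q \<le> lookup m v"
  define w where "w m = (SOME v. q \<le> lookup m v)" for m :: "'v \<Rightarrow>\<^sub>0 nat"
  have w: "q \<le> lookup m (w m)" if "m \<in> keys g" for m
    unfolding w_def by (rule someI_ex) (use that * in blast)
  define h where "h v = (\<Sum>m | m \<in> keys g \<and> w m = v. single (m - single v q) (lookup g m))" for v
  have "(\<Sum>v\<in>UNIV. h v * variable v ^ q)
      = (\<Sum>v\<in>UNIV. \<Sum>m | m \<in> keys g \<and> w m = v. single m (lookup g m))"
  proof (intro sum.cong refl)
    fix v
    have "single (m - single v q) (lookup g m) * variable v ^ q = single m (lookup g m)"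
      if "m \<in> keys g" "w m = v" for m
    proof -
      have "m - single v q + single v q = m"
        using w[OF that(1)] that(2)
        by (intro poly_mapping_eqI) (auto simp: lookup_add lookup_minus lookup_single when_def)
      then show ?thesis by (simp add: variable_power mult_single)
    qed
    then show "h v * variable v ^ q = (\<Sum>m | m \<in> keys g \<and> w m = v. single m (lookup g m))"
      unfolding h_def sum_distrib_right by (intro sum.cong) auto
  qed
  also have "\<dots> = (\<Sum>m\<in>keys g. single m (lookup g m))"
    by (rule sum.group) auto
  finally have "g = (\<Sum>v\<in>UNIV. h v * variable v ^ q)"
    by (simp flip: poly_mapping_sum_single)
  then show "g \<in> power_ideal q" by (auto simp: power_ideal_def)
qed

lemma power_ideal_add: "g \<in> power_ideal q \<Longrightarrow> h \<in> power_ideal q \<Longrightarrow> g + h \<in> power_ideal q"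
  using keys_add[of g h] by (auto simp: power_ideal_iff)

lemma power_ideal_mult: "g \<in> power_ideal q \<Longrightarrow> g * h \<in> power_ideal q"
proof -
  assume g: "g \<in> power_ideal q"
  show ?thesis unfolding power_ideal_iff
  proof
    fix m assume "m \<in> keys (g * h)"
    then obtain a b where ab: "a \<in> keys g" "m = a + b" using keys_mult[of g h] by blast
    then obtain v where "q \<le> lookup a v" using g by (auto simp: power_ideal_iff)
    then have "q \<le> lookup m v" by (simp add: ab lookup_add)
    then show "\<exists>v. q \<le> lookup m v" ..
  qed
qed

lemma power_ideal_mult_left: "g \<in> power_ideal q \<Longrightarrow> h * g \<in> power_ideal q"
  using power_ideal_mult[of g q h] by (simp add: mult.commute)

lemma power_ideal_sum: "(\<And>i. i \<in> I \<Longrightarrow> g i \<in> power_ideal q) \<Longrightarrow> (\<Sum>i\<in>I. g i) \<in> power_ideal q"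
  by (induction I rule: infinite_finite_induct)
    (simp_all add: power_ideal_add, simp_all add: power_ideal_iff)

lemma power_ideal_power_mono:
  "f ^ M \<in> power_ideal q \<Longrightarrow> M \<le> N \<Longrightarrow> f ^ N \<in> power_ideal q"
  using power_ideal_mult[of "f ^ M" q "f ^ (N - M)"] by (simp flip: power_add)

lemma one_notin_power_ideal: "q > 0 \<Longrightarrow> 1 \<notin> power_ideal q"
  by (auto simp: power_ideal_iff)

lemma lookup_sum_const: "lookup (\<Sum>i<n. m) v = of_nat n * lookup m v"
  for m :: "'v \<Rightarrow>\<^sub>0 'a::comm_semiring_1"
  by (simp add: lookup_sum)

lemma lookup_frobenius_power:
  fixes f :: "'m::comm_monoid_add \<Rightarrow>\<^sub>0 'a::comm_ring_1"
  assumes "Factorial_Ring.prime CHAR('a)"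
    and inj: "inj (\<lambda>m::'m. \<Sum>i<CHAR('a). m)"
  shows "lookup (f ^ CHAR('a)) (\<Sum>i<CHAR('a). m) = lookup f m ^ CHAR('a)"
proof -
  let ?p = "CHAR('a)"
  have p: "?p > 0" using assms(1) by (simp add: prime_gt_0_nat)
  have "lookup (f ^ ?p) (\<Sum>i<?p. m)
      = (\<Sum>n\<in>keys f. if n = m then lookup f m ^ ?p else 0)"
    unfolding frobenius_power[OF assms(1)] lookup_sum
    by (intro sum.cong) (auto simp: lookup_single when_def dest: injD[OF inj])
  also have "\<dots> = lookup f m ^ ?p"
    by (auto simp: in_keys_iff zero_power[OF p])
  finally show ?thesis .
qed

lemma keys_frobenius_power:
  fixes f :: "'m::comm_monoid_add \<Rightarrow>\<^sub>0 'a::idom"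
  assumes "Factorial_Ring.prime CHAR('a)"
    and inj: "inj (\<lambda>m::'m. \<Sum>i<CHAR('a). m)"
  shows "keys (f ^ CHAR('a)) = (\<lambda>m. \<Sum>i<CHAR('a). m) ` keys f"
proof
  show "keys (f ^ CHAR('a)) \<subseteq> (\<lambda>m. \<Sum>i<CHAR('a). m) ` keys f"
    unfolding frobenius_power[OF assms(1)]
    by (rule order_trans[OF keys_sum]) auto
  show "(\<lambda>m. \<Sum>i<CHAR('a). m) ` keys f \<subseteq> keys (f ^ CHAR('a))"
    by (auto simp: in_keys_iff lookup_frobenius_power[OF assms])
qed

lemma inj_sum_const:
  fixes p :: nat
  assumes "p > 0"
  shows "inj (\<lambda>m :: 'v \<Rightarrow>\<^sub>0 'a::{idom,ring_char_0}. \<Sum>i<p. m)"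
    and "inj (\<lambda>m :: 'v \<Rightarrow>\<^sub>0 nat. \<Sum>i<p. m)"
proof -
  show "inj (\<lambda>m :: 'v \<Rightarrow>\<^sub>0 'a. \<Sum>i<p. m)"
  proof (intro injI poly_mapping_eqI)
    fix x y :: "'v \<Rightarrow>\<^sub>0 'a" and k
    assume eq: "(\<Sum>i<p. x) = (\<Sum>i<p. y)"
    have "lookup (\<Sum>i<p. x) k = lookup (\<Sum>i<p. y) k" by (simp only: eq)
    then show "lookup x k = lookup y k" using assms by (simp add: lookup_sum)
  qed
  show "inj (\<lambda>m :: 'v \<Rightarrow>\<^sub>0 nat. \<Sum>i<p. m)"
  proof (intro injI poly_mapping_eqI)
    fix x y :: "'v \<Rightarrow>\<^sub>0 nat" and k
    assume eq: "(\<Sum>i<p. x) = (\<Sum>i<p. y)"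
    have "lookup (\<Sum>i<p. x) k = lookup (\<Sum>i<p. y) k" by (simp only: eq)
    then show "lookup x k = lookup y k" using assms by (simp add: lookup_sum)
  qed
qed

text \<open>
  In characteristic \<open>p\<close> the monomials of \<open>f ^ p\<close> are exactly the \<open>p\<close>-th powers of those of \<open>f\<close>. This is
  the flatness of Frobenius in the form in which it is used.
\<close>

lemma power_ideal_frobenius:
  fixes f :: "('v::finite, 'k::field) mpoly"
  assumes p: "Factorial_Ring.prime CHAR('k)"
  shows "f ^ CHAR('k) \<in> power_ideal (CHAR('k) * q) \<longleftrightarrow> f \<in> power_ideal q"
  using prime_gt_0_nat[OF p]
  by (simp add: power_ideal_iff keys_frobenius_power[OF p inj_sum_const(2)] lookup_sum)

lemma power_ideal_frobenius_iter:
  fixes f :: "('v::finite, 'k::field) mpoly"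
  assumes p: "Factorial_Ring.prime CHAR('k)"
  shows "f ^ (CHAR('k) ^ e) \<in> power_ideal (CHAR('k) ^ e * q) \<longleftrightarrow> f \<in> power_ideal q"
proof (induction e)
  case (Suc e)
  have "f ^ (CHAR('k) ^ Suc e) = (f ^ (CHAR('k) ^ e)) ^ CHAR('k)"
    by (simp flip: power_mult add: mult.commute)
  then show ?case using power_ideal_frobenius[OF p, of "f ^ (CHAR('k) ^ e)" "CHAR('k) ^ e * q"] Suc
    by (simp add: mult.assoc)
qed simp

section \<open>Homogeneous polynomials and the top monomial\<close>

definition total_degree :: "('v::finite \<Rightarrow>\<^sub>0 'a::comm_monoid_add) \<Rightarrow> 'a" where
  "total_degree m = (\<Sum>v\<in>UNIV. lookup m v)"

lemma total_degree_add [simp]: "total_degree (m + n) = total_degree m + total_degree n"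
  by (simp add: total_degree_def lookup_add sum.distrib)

lemma total_degree_single [simp]: "total_degree (single v c) = c"
  by (simp add: total_degree_def lookup_single when_def)

lemma homogeneous_iff: "homogeneous d f \<longleftrightarrow> (\<forall>m\<in>keys f. total_degree m = d)"
  by (simp add: homogeneous_def total_degree_def)

lemma homogeneous_mult:
  assumes "homogeneous a f" "homogeneous b g"
  shows "homogeneous (a + b) (f * g)"
  using keys_mult[of f g] assms by (fastforce simp: homogeneous_iff)

lemma homogeneous_power: "homogeneous a f \<Longrightarrow> homogeneous (n * a) (f ^ n)"
proof (induction n)
  case 0
  then show ?case by (simp add: homogeneous_iff total_degree_def)
next
  case (Suc n)
  then show ?case using homogeneous_mult[of a f "n * a" "f ^ n"] by simp
qed

text \<open>
  The exponent of the \<open>n\<close>-th power of the product of all variables. For \<open>n = q - 1\<close> this monomial spans the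
  socle modulo the \<open>q\<close>-th powers of the variables, and for \<open>n = -1\<close> and three variables it generates
  \<open>H\<^sup>2(\<O>(-3))\<close> on the plane.
\<close>

definition uniform_exponent :: "'a \<Rightarrow> 'v::finite \<Rightarrow>\<^sub>0 'a::zero" where
  "uniform_exponent n = Abs_poly_mapping (\<lambda>_. n)"

lemma lookup_uniform_exponent [simp]: "lookup (uniform_exponent n) v = n"
  by (simp add: uniform_exponent_def)

text \<open>
  In degree \<open>CARD('v) * (q - 1)\<close> only one monomial has all exponents below \<open>q\<close>, because the exponents
  must then all equal their upper bound.
\<close>

lemma notin_power_ideal_homogeneous:
  fixes g :: "('v::finite, 'k::field) mpoly"
  assumes "homogeneous (CARD('v) * (q - 1)) g" "q > 0"
  shows "g \<notin> power_ideal q \<longleftrightarrow> lookup g (uniform_exponent (q - 1)) \<noteq> 0"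
proof
  assume "g \<notin> power_ideal q"
  then obtain m where m: "m \<in> keys g" "\<And>v. lookup m v < q"
    by (auto simp: power_ideal_iff not_le)
  have "m = uniform_exponent (q - 1)"
  proof (rule ccontr)
    assume "m \<noteq> uniform_exponent (q - 1)"
    then obtain v where "lookup m v \<noteq> q - 1"
      by (metis lookup_uniform_exponent poly_mapping_eqI)
    with m(2)[of v] have "lookup m v < q - 1" by linarith
    moreover have "lookup m w \<le> q - 1" for w using m(2)[of w] by linarith
    ultimately have "(\<Sum>v\<in>UNIV. lookup m v) < (\<Sum>v\<in>(UNIV::'v set). q - 1)"
      by (intro sum_strict_mono_ex1) auto
    then show False using assms(1) m(1) by (auto simp: homogeneous_def)
  qed
  with m(1) show "lookup g (uniform_exponent (q - 1)) \<noteq> 0" by (simp add: in_keys_iff)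
next
  assume "lookup g (uniform_exponent (q - 1)) \<noteq> 0"
  then have "uniform_exponent (q - 1) \<in> keys g" by (simp add: in_keys_iff)
  then show "g \<notin> power_ideal q" using \<open>q > 0\<close> unfolding power_ideal_iff by force
qed

text \<open>
  Apart from its top term, \<open>g\<close> lies in the ideal of \<open>q\<close>-th powers, so \<open>g ^ p\<close> is the \<open>p\<close>-th power of that
  term up to the ideal of \<open>pq\<close>-th powers, which has no share in the coefficient on the left.
\<close>

lemma top_coefficient_frobenius:
  fixes g h :: "('v::finite, 'k::field) mpoly"
  assumes p: "Factorial_Ring.prime CHAR('k)"
    and g: "homogeneous (CARD('v) * (q - 1)) g" and q: "q > 0"
  shows "lookup (g ^ CHAR('k) * h) (uniform_exponent (CHAR('k) * q - 1))
    = lookup g (uniform_exponent (q - 1)) ^ CHAR('k) * lookup h (uniform_exponent (CHAR('k) - 1))"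
proof -
  let ?p = "CHAR('k)" and ?t = "uniform_exponent (q - 1) :: 'v \<Rightarrow>\<^sub>0 nat"
  let ?u = "uniform_exponent (?p * (q - 1)) :: 'v \<Rightarrow>\<^sub>0 nat"
  define b where "b = lookup g ?t"
  have p0: "?p > 0" using p by (simp add: prime_gt_0_nat)
  define g' where "g' = g - single ?t b"
  have t: "(\<Sum>i<?p. ?t) = ?u" by (rule poly_mapping_eqI) (simp add: lookup_sum)
  have hom: "homogeneous (CARD('v) * (q - 1)) g'" unfolding homogeneous_iff
  proof
    fix m assume "m \<in> keys g'"
    then have "lookup g m - lookup (single ?t b) m \<noteq> 0" by (simp add: g'_def in_keys_iff lookup_minus)
    then have "m \<in> keys g" by (auto simp: b_def in_keys_iff lookup_single when_def split: if_splits)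
    then show "total_degree m = CARD('v) * (q - 1)" using g by (simp add: homogeneous_iff)
  qed
  have "lookup g' ?t = 0" by (simp add: g'_def b_def lookup_minus)
  then have "g' \<in> power_ideal q" using notin_power_ideal_homogeneous[OF hom q] by blast
  then have "g' ^ ?p * h \<in> power_ideal (?p * q)"
    by (intro power_ideal_mult) (simp add: power_ideal_frobenius[OF p])
  then have pq: "\<forall>m\<in>keys (g' ^ ?p * h). \<exists>v. ?p * q \<le> lookup m v"
    by (simp only: power_ideal_iff)
  have 0: "lookup (g' ^ ?p * h) (uniform_exponent (?p * q - 1)) = 0"
  proof (rule ccontr)
    assume "\<not> ?thesis"
    then have "uniform_exponent (?p * q - 1) \<in> keys (g' ^ ?p * h)" by (simp add: in_keys_iff)
    with pq have "?p * q \<le> ?p * q - 1" by (metis lookup_uniform_exponent)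
    moreover have "?p * q > 0" using p0 q by simp
    ultimately show False by linarith
  qed
  have "g ^ ?p = (single ?t b + g') ^ ?p" by (simp add: g'_def)
  also have "\<dots> = single ?u (b ^ ?p) + g' ^ ?p"
    by (subst freshmans_dream) (simp_all add: CHAR_poly_mapping p single_power t[simplified])
  finally have "g ^ ?p * h = single ?u (b ^ ?p) * h + g' ^ ?p * h" by (simp add: distrib_right)
  moreover have "?u + uniform_exponent (?p - 1) = uniform_exponent (?p * q - 1)"
  proof (rule poly_mapping_eqI)
    fix v :: 'v
    obtain r where "q = Suc r" using q gr0_implies_Suc by blast
    then show "lookup (?u + uniform_exponent (?p - 1)) v = lookup (uniform_exponent (?p * q - 1)) v"
      using p0 by (simp add: lookup_add mult.commute)
  qed
  ultimately show ?thesis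
    using lookup_single_mult[of ?u "b ^ ?p" h "uniform_exponent (?p - 1)"] 0
    by (simp add: lookup_add b_def)
qed

text \<open>
  Induction on \<open>e\<close> through \<open>f ^ (p ^ (e + 1) - 1) = (f ^ (p ^ e - 1)) ^ p * f ^ (p - 1)\<close>: top
  coefficients stay nonzero.
\<close>

lemma ordinary_power_notin:
  fixes f :: "('v::finite, 'k::field) mpoly"
  assumes p: "Factorial_Ring.prime CHAR('k)" and f: "homogeneous CARD('v) f"
    and ord: "f ^ (CHAR('k) - 1) \<notin> power_ideal CHAR('k)"
  shows "f ^ (CHAR('k) ^ e - 1) \<notin> power_ideal (CHAR('k) ^ e)"
proof -
  let ?p = "CHAR('k)"
  have p0: "?p > 0" using p by (simp add: prime_gt_0_nat)
  have hom: "homogeneous (CARD('v) * (q - 1)) (f ^ (q - 1))" for q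
    using homogeneous_power[OF f, of "q - 1"] by (simp add: mult.commute)
  have "lookup (f ^ (?p ^ e - 1)) (uniform_exponent (?p ^ e - 1)) \<noteq> 0"
  proof (induction e)
    case 0
    have "0 = (uniform_exponent 0 :: 'v \<Rightarrow>\<^sub>0 nat)" by (rule poly_mapping_eqI) simp
    then show ?case by (simp flip: \<open>0 = uniform_exponent 0\<close>)
  next
    case (Suc e)
    obtain r where r: "?p ^ e = Suc r" using p0 by (metis gr0_implies_Suc zero_less_power)
    have "?p ^ Suc e - 1 = (?p ^ e - 1) * ?p + (?p - 1)" using p0 by (simp add: r mult.commute)
    then have *: "f ^ (?p ^ Suc e - 1) = (f ^ (?p ^ e - 1)) ^ ?p * f ^ (?p - 1)"
      by (simp only: power_add power_mult)
    show ?case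
      unfolding * using top_coefficient_frobenius[OF p hom[of "?p ^ e"], of "f ^ (?p - 1)"]
        Suc ord notin_power_ideal_homogeneous[OF hom[of ?p]] p0
      by simp
  qed
  then show ?thesis
    using notin_power_ideal_homogeneous[OF hom[of "?p ^ e"]] p0 by simp
qed

section \<open>The threshold as a supremum\<close>

text \<open>
  The defining set contains \<open>c - 1 / p ^ e\<close> for every \<open>e > 0\<close>, so \<open>c\<close> is its supremum once it is an upper
  bound.
\<close>

lemma F_pure_threshold_eqI:
  fixes f :: "('v::finite, 'k::field) mpoly"
  assumes p: "Factorial_Ring.prime CHAR('k)"
    and upper: "\<And>N e. e > 0 \<Longrightarrow> f ^ N \<notin> power_ideal (CHAR('k) ^ e) \<Longrightarrow> real N \<le> c * real (CHAR('k) ^ e)"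
    and lower: "\<And>e. e > 0 \<Longrightarrow> \<exists>N>0. f ^ N \<notin> power_ideal (CHAR('k) ^ e) \<and>
      real N = c * real (CHAR('k) ^ e) - 1"
  shows "F_pure_threshold f = c"
  unfolding F_pure_threshold_def
proof (rule cSup_eq)
  let ?p = "CHAR('k)"
  have p1: "real ?p > 1" using prime_gt_1_nat[OF p] by simp
  fix x assume "x \<in> {real N / real (?p ^ e) |N e. 0 < N \<and> 0 < e \<and> f ^ N \<notin> power_ideal (?p ^ e)}"
  then obtain N e where x: "x = real N / real (?p ^ e)" and "0 < e" "f ^ N \<notin> power_ideal (?p ^ e)"
    by auto
  then show "x \<le> c" using upper[of e N] p1 by (simp add: divide_le_eq)
next
  let ?p = "CHAR('k)"
  have p1: "real ?p > 1" using prime_gt_1_nat[OF p] by simp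
  fix y assume y: "\<And>x. x \<in> {real N / real (?p ^ e) |N e. 0 < N \<and> 0 < e \<and> f ^ N \<notin> power_ideal (?p ^ e)} \<Longrightarrow> x \<le> y"
  have *: "c - (1 / real ?p) ^ e \<le> y" if "e > 0" for e
  proof -
    obtain N where N: "N > 0" "f ^ N \<notin> power_ideal (?p ^ e)" "real N = c * real (?p ^ e) - 1"
      using lower[OF \<open>e > 0\<close>] by blast
    have "real N / real (?p ^ e) \<le> y" using N that by (intro y) blast
    also have "real N / real (?p ^ e) = c - (1 / real ?p) ^ e"
      using p1 unfolding N(3) by (simp add: field_simps power_one_over)
    finally show ?thesis .
  qed
  have "(\<lambda>e. c - (1 / real ?p) ^ e) \<longlonglongrightarrow> c - 0"
    by (intro tendsto_intros LIMSEQ_power_zero) (use p1 in auto)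
  then show "c \<le> y"
    by (intro LIMSEQ_le_const2[where a = y and x = c and X = "\<lambda>e. c - (1 / real ?p) ^ e"])
      (use * in \<open>auto intro!: exI[of _ 1]\<close>)
qed

section \<open>Evaluation, base change and derivatives\<close>

definition eval :: "('v::finite, 'k::field) mpoly \<Rightarrow> ('v \<Rightarrow> 'k) \<Rightarrow> 'k" where
  "eval f a = extend (\<lambda>m c. c * (\<Prod>v\<in>UNIV. a v ^ lookup m v)) f"

lemma eval_add: "eval (f + g) a = eval f a + eval g a"
  unfolding eval_def by (rule extend_add) (auto simp: algebra_simps)

lemma eval_0 [simp]: "eval 0 a = 0" by (simp add: eval_def)

lemma eval_single: "eval (single m c) a = c * (\<Prod>v\<in>UNIV. a v ^ lookup m v)"
  unfolding eval_def by (subst extend_single) auto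

lemma eval_mult: "eval (f * g) a = eval f a * eval g a"
  unfolding eval_def
  by (rule extend_mult) (auto simp: algebra_simps lookup_add power_add prod.distrib)

text \<open>
  Smoothness is a condition on points over the algebraic closure, whereas membership in an ideal of
  powers of variables can be read off from the monomials that occur; hence everything about the
  Jacobian ideal may be done after this field extension.
\<close>

definition base_change :: "('v, 'k::field) mpoly \<Rightarrow> ('v, 'k alg_closure) mpoly" where
  "base_change f = extend (\<lambda>m c. single m (to_ac c)) f"

lemma lookup_base_change [simp]: "lookup (base_change f) m = to_ac (lookup f m)"
proof -
  have "lookup (base_change f) m = (\<Sum>n\<in>keys f. if n = m then to_ac (lookup f m) else 0)"
    unfolding base_change_def extend_def lookup_sum
    by (intro sum.cong) (auto simp: lookup_single when_def)
  then show ?thesis by (simp add: in_keys_iff)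
qed

lemma keys_base_change [simp]: "keys (base_change f) = keys f"
  by (auto simp: in_keys_iff)

lemma base_change_power: "base_change (f ^ n) = base_change f ^ n"
  unfolding base_change_def
  by (rule extend_power) (auto simp: single_add mult_single)

lemma homogeneous_base_change [simp]: "homogeneous d (base_change f) \<longleftrightarrow> homogeneous d f"
  by (simp add: homogeneous_def)

lemma power_ideal_base_change [simp]: "base_change f \<in> power_ideal q \<longleftrightarrow> f \<in> power_ideal q"
  by (simp add: power_ideal_iff)

lemma eval_base_change: "eval (base_change f) a = eval_ac f a"
  by (simp add: eval_def extend_def eval_ac_def)

lemma partial_deriv_eq_extend:
  "partial_deriv v f = extend (\<lambda>m c. single (m - single v 1) (of_nat (lookup m v) * c)) f"
  by (simp add: partial_deriv_def extend_def)

lemma partial_deriv_add: "partial_deriv v (f + g) = partial_deriv v f + partial_deriv v g"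
  unfolding partial_deriv_eq_extend by (rule extend_add) (auto simp: single_add algebra_simps)

lemma partial_deriv_0 [simp]: "partial_deriv v 0 = 0"
  by (simp add: partial_deriv_def)

lemma partial_deriv_single:
  "partial_deriv v (single m c) = single (m - single v 1) (of_nat (lookup m v) * c)"
  unfolding partial_deriv_eq_extend by (subst extend_single) auto

lemma partial_deriv_base_change:
  fixes f :: "('v, 'k::field) mpoly"
  shows "partial_deriv v (base_change f) = base_change (partial_deriv v f)"
proof -
  have add: "base_change (f + g) = base_change f + base_change g" for f g :: "('v, 'k) mpoly"
    by (rule poly_mapping_eqI) (simp add: lookup_add)
  have single: "base_change (single m c) = single m (to_ac c)" for m :: "'v \<Rightarrow>\<^sub>0 nat" and c :: 'k
    by (rule poly_mapping_eqI) (simp add: lookup_single when_def)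
  have zero: "base_change 0 = (0 :: ('v, 'k alg_closure) mpoly)"
    by (rule poly_mapping_eqI) simp
  show ?thesis
    by (rule additive_eqI[of "\<lambda>f. partial_deriv v (base_change f)"])
      (simp_all add: add single zero partial_deriv_add partial_deriv_single)
qed

text \<open>
  On terms, the truncated subtraction of exponents is correct whenever the coefficient in front of it
  does not vanish.
\<close>

lemma partial_deriv_mult:
  fixes f g :: "('v, 'k::field) mpoly"
  shows "partial_deriv v (f * g) = partial_deriv v f * g + f * partial_deriv v g"
proof (rule additive_eqI[of "\<lambda>f. partial_deriv v (f * g)" "\<lambda>f. partial_deriv v f * g + f * partial_deriv v g"])
  fix m c
  show "partial_deriv v (single m c * g) = partial_deriv v (single m c) * g + single m c * partial_deriv v g"
  proof (rule additive_eqI[of "\<lambda>g. partial_deriv v (single m c * g)"])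
    fix n d
    have shift: "(a + b) - single v 1 = (a - single v 1) + b" if "lookup a v \<noteq> 0"
      for a b :: "'v \<Rightarrow>\<^sub>0 nat"
      using that by (intro poly_mapping_eqI) (auto simp: lookup_add lookup_minus lookup_single when_def)
    have s0: "single k (of_nat 0 * x) = 0" for k :: "'v \<Rightarrow>\<^sub>0 nat" and x :: 'k by simp
    show "partial_deriv v (single m c * single n d)
      = partial_deriv v (single m c) * single n d + single m c * partial_deriv v (single n d)"
    proof (cases "lookup m v = 0"; cases "lookup n v = 0")
      assume "lookup m v = 0" "lookup n v \<noteq> 0"
      then show ?thesis
        using shift[of n m] by (simp add: mult_single partial_deriv_single lookup_add add.commute mult_ac)
    next
      assume "lookup m v \<noteq> 0" "lookup n v = 0"
      then show ?thesis
        using shift[of m n] by (simp add: mult_single partial_deriv_single lookup_add mult.assoc)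
    next
      assume "lookup m v \<noteq> 0" "lookup n v \<noteq> 0"
      moreover have "m - single v 1 + n = m + (n - single v 1)"
        using shift[of m n] shift[of n m] calculation by (simp add: add.commute)
      ultimately show ?thesis
        using shift[of m n]
        by (simp add: mult_single partial_deriv_single lookup_add algebra_simps flip: single_add)
    qed (simp add: mult_single partial_deriv_single lookup_add)
  qed (simp_all add: partial_deriv_add algebra_simps)
qed (simp_all add: partial_deriv_add algebra_simps)

lemma partial_deriv_power:
  "partial_deriv v (f ^ n) = of_nat n * f ^ (n - 1) * partial_deriv v f"
  for f :: "('v, 'k::field) mpoly"
proof (induction n)
  case 0
  have "partial_deriv v (single 0 1 :: ('v, 'k) mpoly) = 0"
    unfolding partial_deriv_single by simp
  then show ?case by simp
next
  case (Suc n)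
  note IH = Suc
  show ?case
  proof (cases n)
    case (Suc k)
    have "partial_deriv v (f ^ Suc n) = partial_deriv v f * f ^ n + f * partial_deriv v (f ^ n)"
      by (simp add: partial_deriv_mult)
    also have "\<dots> = of_nat (Suc n) * f ^ n * partial_deriv v f"
      unfolding IH by (simp add: Suc algebra_simps)
    finally show ?thesis by simp
  qed simp
qed

text \<open>
  Differentiating \<open>x ^ q\<close> gives zero since \<open>p\<close> divides \<open>q\<close>; every other derivative of a multiple of
  \<open>x ^ q\<close> is still such a multiple.
\<close>

lemma partial_deriv_power_ideal:
  fixes g :: "('v::finite, 'k::field) mpoly"
  assumes "CHAR('k) dvd q" "g \<in> power_ideal q"
  shows "partial_deriv v g \<in> power_ideal q"
  unfolding partial_deriv_def
proof (rule power_ideal_sum)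
  fix m assume "m \<in> keys g"
  then obtain w where w: "q \<le> lookup m w" using assms by (auto simp: power_ideal_iff)
  show "single (m - single v 1) (of_nat (lookup m v) * lookup g m) \<in> power_ideal q"
  proof (cases "w = v \<and> lookup m v = q")
    case True
    then have "(of_nat (lookup m v) :: 'k) = 0" using assms(1) by (simp add: of_nat_eq_0_iff_char_dvd)
    then show ?thesis by (simp add: power_ideal_iff)
  next
    case False
    then have "q \<le> lookup (m - single v 1) w"
      using w by (auto simp: lookup_minus lookup_single when_def)
    then show ?thesis by (auto simp: power_ideal_iff)
  qed
qed

section \<open>Lowering exponents by differentiation\<close>

lemma exponent_between:
  fixes n :: "'v::finite \<Rightarrow>\<^sub>0 nat"
  assumes "d \<le> total_degree n"
  obtains m where "total_degree m = d" "\<And>v. lookup m v \<le> lookup n v"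
proof -
  have "\<exists>m. total_degree m = d \<and> (\<forall>v. lookup m v \<le> lookup n v)"
    using assms
  proof (induction d)
    case 0
    show ?case by (intro exI[of _ 0]) (simp add: total_degree_def)
  next
    case (Suc d)
    then obtain m where m: "total_degree m = d" "\<And>v. lookup m v \<le> lookup n v" by auto
    have "\<exists>v. lookup m v < lookup n v"
    proof (rule ccontr)
      assume "\<not> ?thesis"
      then have "total_degree n \<le> total_degree m" unfolding total_degree_def by (intro sum_mono) (simp add: not_less)
      with m(1) Suc.prems show False by simp
    qed
    then obtain v where "lookup m v < lookup n v" ..
    then show ?case
      using m by (intro exI[of _ "m + single v 1"]) (auto simp: lookup_add lookup_single when_def)
  qed
  then show thesis using that by blast
qed

text \<open>
  With \<open>u = f ^ (N - 1)\<close>, both \<open>u * f = f ^ N\<close> and \<open>u * partial_deriv v f\<close>, which is up to a unit the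
  derivative of \<open>f ^ N\<close>, lie in the ideal of \<open>q\<close>-th powers. A monomial of \<open>u\<close> with exponents below \<open>q\<close> is at
  distance at least \<open>2 * CARD('v)\<close> from the top monomial, by its degree and \<open>N + 2 \<le> q\<close>, so it stays
  outside that ideal after multiplication by a suitable monomial of degree \<open>2 * CARD('v)\<close>. But \<open>jac\<close> puts
  that monomial into the ideal generated by \<open>f\<close> and its derivatives.
\<close>

lemma power_ideal_descent:
  fixes f :: "('v::finite, 'k::field) mpoly"
  assumes jac: "\<And>m. total_degree m = 2 * CARD('v) \<Longrightarrow>
      \<exists>a b. single m 1 = a * f + (\<Sum>v\<in>UNIV. b v * partial_deriv v f)"
    and f: "homogeneous CARD('v) f"
    and N: "f ^ N \<in> power_ideal q" "\<not> CHAR('k) dvd N" "N + 2 \<le> q" and q: "CHAR('k) dvd q"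
  shows "f ^ (N - 1) \<in> power_ideal q"
proof (rule ccontr)
  let ?u = "f ^ (N - 1)"
  assume "?u \<notin> power_ideal q"
  then obtain m where m: "m \<in> keys ?u" "\<And>v. lookup m v < q" by (auto simp: power_ideal_iff not_le)
  have N0: "N > 0" using N(2) by (cases N) auto
  have der: "?u * partial_deriv v f \<in> power_ideal q" for v
  proof -
    have "of_nat N * ?u * partial_deriv v f \<in> power_ideal q"
      using partial_deriv_power_ideal[OF q N(1), of v] by (simp add: partial_deriv_power)
    then have "single 0 (1 / of_nat N) * (of_nat N * ?u * partial_deriv v f) \<in> power_ideal q"
      by (rule power_ideal_mult_left)
    moreover have "single 0 (1 / of_nat N) * of_nat N = (1 :: ('v, 'k) mpoly)"
      using N(2) by (simp add: of_nat_eq_0_iff_char_dvd mult_single flip: single_of_nat)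
    ultimately show ?thesis by (simp flip: mult.assoc)
  qed
  have "?u * f = f ^ N" using N0 by (simp flip: power_Suc2)
  then have uf: "?u * f \<in> power_ideal q" using N(1) by simp
  define n where "n = uniform_exponent (q - 1) - m"
  have nm: "lookup n v + lookup m v = q - 1" for v
    using m(2)[of v] by (simp add: n_def lookup_minus)
  have "total_degree n + total_degree m = CARD('v) * (q - 1)"
    unfolding total_degree_def sum.distrib[symmetric] nm by simp
  moreover have "total_degree m = (N - 1) * CARD('v)"
    using homogeneous_power[OF f, of "N - 1"] m(1) by (simp add: homogeneous_iff)
  moreover have "(N - 1) * CARD('v) + 2 * CARD('v) \<le> CARD('v) * (q - 1)"
  proof -
    have "CARD('v) * ((N - 1) + 2) \<le> CARD('v) * (q - 1)"
      using N(3) N0 by (intro mult_le_mono2) linarith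
    then show ?thesis by (simp add: algebra_simps)
  qed
  ultimately have "2 * CARD('v) \<le> total_degree n" by linarith
  then obtain k where k: "total_degree k = 2 * CARD('v)" "\<And>v. lookup k v \<le> lookup n v"
    by (rule exponent_between) blast
  obtain a b where ab: "single k 1 = a * f + (\<Sum>v\<in>UNIV. b v * partial_deriv v f)"
    using jac[OF k(1)] by blast
  have "single k 1 * ?u = a * (?u * f) + (\<Sum>v\<in>UNIV. b v * (?u * partial_deriv v f))"
    unfolding ab by (simp add: algebra_simps sum_distrib_left)
  also have "\<dots> \<in> power_ideal q"
    by (intro power_ideal_add power_ideal_sum power_ideal_mult_left uf der)
  finally have "single k 1 * ?u \<in> power_ideal q" .
  moreover have "k + m \<in> keys (single k 1 * ?u)"
    using m(1) by (simp add: in_keys_iff lookup_single_mult)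
  ultimately obtain v where "q \<le> lookup (k + m) v" by (auto simp: power_ideal_iff)
  moreover have "lookup (k + m) v \<le> q - 1" using k(2)[of v] nm[of v] by (simp add: lookup_add)
  ultimately show False using N(3) by linarith
qed

section \<open>The two values of the threshold\<close>

lemma power_in_frobenius_power:
  fixes f :: "('v::finite, 'k::field) mpoly"
  assumes p: "Factorial_Ring.prime CHAR('k)" and f: "homogeneous CARD('v) f"
  shows "f ^ (CHAR('k) ^ e) \<in> power_ideal (CHAR('k) ^ e)"
proof -
  have "f \<in> power_ideal 1" unfolding power_ideal_iff
  proof (rule ballI, rule ccontr)
    fix m assume m: "m \<in> keys f" and "\<not> (\<exists>v. 1 \<le> lookup m v)"
    then have "total_degree m = 0" by (simp add: total_degree_def not_le)
    with m f show False by (simp add: homogeneous_iff)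
  qed
  then show ?thesis using power_ideal_frobenius_iter[OF p, of f e 1] by simp
qed

lemma F_pure_threshold_ordinary:
  fixes f :: "('v::finite, 'k::field) mpoly"
  assumes p: "Factorial_Ring.prime CHAR('k)" and f: "homogeneous CARD('v) f"
    and ord: "f ^ (CHAR('k) - 1) \<notin> power_ideal CHAR('k)"
  shows "F_pure_threshold f = 1"
proof (rule F_pure_threshold_eqI[OF p])
  let ?p = "CHAR('k)"
  fix N e assume "f ^ N \<notin> power_ideal (?p ^ e)"
  then have "\<not> ?p ^ e \<le> N"
    using power_in_frobenius_power[OF p f] power_ideal_power_mono by blast
  then show "real N \<le> 1 * real (?p ^ e)" by (simp flip: of_nat_power)
next
  let ?p = "CHAR('k)"
  fix e :: nat assume "e > 0"
  then have "?p ^ e > 1" using one_less_power[OF prime_gt_1_nat[OF p]] by blast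
  then have "?p ^ e - 1 > 0 \<and> real (?p ^ e - 1) = 1 * real (?p ^ e) - 1" by auto
  then show "\<exists>N>0. f ^ N \<notin> power_ideal (?p ^ e) \<and> real N = 1 * real (?p ^ e) - 1"
    using ordinary_power_notin[OF p f ord] by blast
qed

text \<open>
  The number \<open>(p - 1) p ^ e\<close> is the exact point where powers of a supersingular form enter the ideal of
  \<open>p ^ (e + 1)\<close>-th powers. The induction on \<open>e\<close> replaces a multiple \<open>p K\<close> of \<open>p\<close> by \<open>K\<close>, using that
  Frobenius reflects membership; for \<open>e = 0\<close> the only multiple of \<open>p\<close> below \<open>p - 1\<close> is 0.
\<close>

lemma power_notin_of_descent:
  fixes f :: "('v::finite, 'k::field) mpoly"
  assumes p: "Factorial_Ring.prime CHAR('k)"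
    and descent: "\<And>N q. \<lbrakk>f ^ N \<in> power_ideal q; \<not> CHAR('k) dvd N; N + 2 \<le> q; CHAR('k) dvd q\<rbrakk>
      \<Longrightarrow> f ^ (N - 1) \<in> power_ideal q"
  shows "N < (CHAR('k) - 1) * CHAR('k) ^ e \<Longrightarrow> f ^ N \<notin> power_ideal (CHAR('k) ^ Suc e)"
proof (induction e arbitrary: N)
  let ?p = "CHAR('k)"
  have p1: "?p > 1" using prime_gt_1_nat[OF p] .
  \<comment> \<open>An exponent prime to \<open>p\<close> can be lowered, so an exponent violating the claim may be taken divisible by \<open>p\<close>.\<close>
  have reduce: "\<exists>M\<le>N. ?p dvd M \<and> f ^ M \<in> power_ideal (?p ^ Suc e)"
    if "N < (?p - 1) * ?p ^ e" "f ^ N \<in> power_ideal (?p ^ Suc e)" for N e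
    using that
  proof (induction N)
    case (Suc N)
    show ?case
    proof (cases "?p dvd Suc N")
      case False
      obtain r where r: "?p = Suc r" using p1 by (metis less_imp_Suc_add)
      have "Suc r ^ e \<ge> 1" by simp
      moreover have "Suc N < r * Suc r ^ e" using Suc.prems(1) by (simp add: r)
      moreover have "?p ^ Suc e = Suc r ^ e + r * Suc r ^ e" by (simp add: r)
      ultimately have "Suc N + 2 \<le> ?p ^ Suc e" by linarith
      then have "f ^ N \<in> power_ideal (?p ^ Suc e)"
        using descent[OF Suc.prems(2) False] by simp
      then show ?thesis using Suc.IH Suc.prems(1) by (meson Suc_lessD le_SucI)
    qed (use Suc.prems in blast)
  qed (auto intro!: exI[of _ 0])
  {
    case 0
    show ?case
    proof
      assume "f ^ N \<in> power_ideal (?p ^ Suc 0)"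
      then obtain M where M: "M \<le> N" "?p dvd M" "f ^ M \<in> power_ideal (?p ^ Suc 0)"
        using reduce[OF 0] by blast
      have "M < ?p" using M(1) 0 by simp
      then have "M = 0" using M(2) by (auto dest: dvd_imp_le)
      then show False using M(3) p1 by (simp add: one_notin_power_ideal)
    qed
  next
    case (Suc e)
    show ?case
    proof
      assume "f ^ N \<in> power_ideal (?p ^ Suc (Suc e))"
      then obtain M where M: "M \<le> N" "?p dvd M" "f ^ M \<in> power_ideal (?p ^ Suc (Suc e))"
        using reduce[OF Suc.prems] by blast
      obtain K where K: "M = ?p * K" using M(2) by blast
      have "(f ^ K) ^ ?p \<in> power_ideal (?p * ?p ^ Suc e)"
        using M(3) by (simp add: K mult.commute flip: power_mult)
      then have "f ^ K \<in> power_ideal (?p ^ Suc e)" by (simp only: power_ideal_frobenius[OF p])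
      moreover have "(?p - 1) * ?p ^ Suc e = ?p * ((?p - 1) * ?p ^ e)" by simp
      then have "?p * K < ?p * ((?p - 1) * ?p ^ e)" using M(1) Suc.prems K by linarith
      then have "K < (?p - 1) * ?p ^ e" by (simp only: nat_mult_less_cancel_disj)
      ultimately show False using Suc.IH by blast
    qed
  }
qed

lemma F_pure_threshold_supersingular:
  fixes f :: "('v::finite, 'k::field) mpoly"
  assumes p: "Factorial_Ring.prime CHAR('k)" and p2: "CHAR('k) > 2"
    and ss: "f ^ (CHAR('k) - 1) \<in> power_ideal CHAR('k)"
    and descent: "\<And>N q. \<lbrakk>f ^ N \<in> power_ideal q; \<not> CHAR('k) dvd N; N + 2 \<le> q; CHAR('k) dvd q\<rbrakk>
      \<Longrightarrow> f ^ (N - 1) \<in> power_ideal q"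
  shows "F_pure_threshold f = 1 - 1 / real CHAR('k)"
proof (rule F_pure_threshold_eqI[OF p])
  let ?p = "CHAR('k)"
  have bound: "real ((?p - 1) * ?p ^ e) = (1 - 1 / real ?p) * real (?p ^ Suc e)" for e
    using p2 by (simp add: of_nat_diff field_simps)
  fix N e :: nat assume e: "e > 0" and "f ^ N \<notin> power_ideal (?p ^ e)"
  obtain d where d: "e = Suc d" using e gr0_implies_Suc by blast
  have "(f ^ (?p - 1)) ^ (?p ^ d) \<in> power_ideal (?p ^ d * ?p)"
    using ss by (simp only: power_ideal_frobenius_iter[OF p])
  then have "f ^ ((?p - 1) * ?p ^ d) \<in> power_ideal (?p ^ e)"
    by (simp add: d mult.commute flip: power_mult)
  then have "\<not> (?p - 1) * ?p ^ d \<le> N"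
    using power_ideal_power_mono \<open>f ^ N \<notin> _\<close> by blast
  then have "real N \<le> real ((?p - 1) * ?p ^ d)" by (simp only: of_nat_le_iff not_le)
  then show "real N \<le> (1 - 1 / real ?p) * real (?p ^ e)" by (simp only: bound d)
next
  let ?p = "CHAR('k)"
  have bound: "real ((?p - 1) * ?p ^ e) = (1 - 1 / real ?p) * real (?p ^ Suc e)" for e
    using p2 by (simp add: of_nat_diff field_simps)
  fix e :: nat assume e: "e > 0"
  obtain d where d: "e = Suc d" using e gr0_implies_Suc by blast
  have "(?p - 1) * ?p ^ d \<ge> 2 * 1" using p2 by (intro mult_mono) auto
  then have N: "(?p - 1) * ?p ^ d - 1 > 0" "(?p - 1) * ?p ^ d - 1 < (?p - 1) * ?p ^ d"
    "real ((?p - 1) * ?p ^ d - 1) = real ((?p - 1) * ?p ^ d) - 1"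
    by linarith+
  show "\<exists>N>0. f ^ N \<notin> power_ideal (?p ^ e) \<and> real N = (1 - 1 / real ?p) * real (?p ^ e) - 1"
    using power_notin_of_descent[OF p descent N(2)] N(1,3) unfolding d bound by blast
qed

section \<open>Ideals generated by binary forms\<close>

text \<open>
  A nonzero element of least degree in the ideal generated by the three polynomials divides all of them,
  and over an algebraically closed field it is constant unless it provides a common root.
\<close>

lemma poly_bezout_three:
  fixes \<alpha> \<beta> \<gamma> :: "'l::alg_closed_field poly"
  assumes "\<alpha> \<noteq> 0" and no_root: "\<And>t. poly \<alpha> t = 0 \<Longrightarrow> poly \<beta> t = 0 \<Longrightarrow> poly \<gamma> t \<noteq> 0"
  obtains A B C where "A * \<alpha> + B * \<beta> + C * \<gamma> = 1"
proof -
  define I where "I = {A * \<alpha> + B * \<beta> + C * \<gamma> | A B C. True}"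
  have mem: "\<alpha> \<in> I" "\<beta> \<in> I" "\<gamma> \<in> I"
    unfolding I_def by (force intro: exI[of _ 1] exI[of _ 0])+
  have "\<exists>d. (d \<in> I \<and> d \<noteq> 0) \<and> (\<forall>e. e \<in> I \<and> e \<noteq> 0 \<longrightarrow> degree d \<le> degree e)"
    using ex_has_least_nat[of "\<lambda>d. d \<in> I \<and> d \<noteq> 0" \<alpha> degree] mem(1) assms(1) by blast
  then obtain d where d: "d \<in> I" "d \<noteq> 0" "\<And>e. e \<in> I \<Longrightarrow> e \<noteq> 0 \<Longrightarrow> degree d \<le> degree e"
    by blast
  obtain A B C where ABC: "d = A * \<alpha> + B * \<beta> + C * \<gamma>" using d(1) by (auto simp: I_def)
  have dvd: "d dvd e" if e: "e \<in> I" for e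
  proof (rule ccontr)
    assume "\<not> d dvd e"
    then have nz: "e mod d \<noteq> 0" by (simp add: mod_eq_0_iff_dvd)
    obtain A' B' C' where e': "e = A' * \<alpha> + B' * \<beta> + C' * \<gamma>" using e by (auto simp: I_def)
    have "e mod d = e - (e div d) * d" by (simp add: minus_div_mult_eq_mod)
    also have "\<dots> = (A' - e div d * A) * \<alpha> + (B' - e div d * B) * \<beta> + (C' - e div d * C) * \<gamma>"
      by (subst (1) e') (simp add: ABC algebra_simps)
    finally have "e mod d \<in> I" unfolding I_def by blast
    then have "degree d \<le> degree (e mod d)" using d(3) nz by blast
    moreover have "degree (e mod d) < degree d" using degree_mod_less'[OF d(2) nz] .
    ultimately show False by simp
  qed
  have "degree d = 0"
  proof (rule ccontr)
    assume "degree d \<noteq> 0"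
    then obtain t where "poly d t = 0" using alg_closed_imp_poly_has_root by blast
    then show False using no_root[of t] dvd[OF mem(1)] dvd[OF mem(2)] dvd[OF mem(3)]
      by (auto elim!: dvdE)
  qed
  then obtain c where c: "d = [:c:]" by (rule degree_eq_zeroE)
  with d(2) have "c \<noteq> 0" by auto
  then have "smult (inverse c) d = 1" by (simp add: c one_pCons)
  then have "smult (inverse c) A * \<alpha> + smult (inverse c) B * \<beta> + smult (inverse c) C * \<gamma> = 1"
    by (simp add: ABC smult_add_right)
  then show thesis by (rule that)
qed

text \<open>
  Bezout with degree bounds: reducing the coefficients of \<open>\<beta>\<close> and \<open>\<gamma>\<close> modulo \<open>\<alpha>\<close> leaves a multiple of
  \<open>\<alpha>\<close> whose degree is controlled by the other terms.
\<close>

lemma poly_combination_bounded: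
  fixes \<alpha> \<beta> \<gamma> w :: "'l::alg_closed_field poly"
  assumes "\<alpha> \<noteq> 0" and no_root: "\<And>t. poly \<alpha> t = 0 \<Longrightarrow> poly \<beta> t = 0 \<Longrightarrow> poly \<gamma> t \<noteq> 0"
    and D: "degree w \<le> D" "degree \<alpha> + degree \<beta> \<le> Suc D" "degree \<alpha> + degree \<gamma> \<le> Suc D"
  obtains A B C where "w = A * \<alpha> + B * \<beta> + C * \<gamma>"
    "A = 0 \<or> degree A + degree \<alpha> \<le> D" "degree B \<le> degree \<alpha> - 1" "degree C \<le> degree \<alpha> - 1"
proof -
  obtain A B C where 1: "A * \<alpha> + B * \<beta> + C * \<gamma> = 1"
    using poly_bezout_three[OF assms(1) no_root] by blast
  define B' C' where "B' = (w * B) mod \<alpha>" and "C' = (w * C) mod \<alpha>"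
  define A' where "A' = w * A + (w * B div \<alpha>) * \<beta> + (w * C div \<alpha>) * \<gamma>"
  have B: "w * B = (w * B div \<alpha>) * \<alpha> + B'" and C: "w * C = (w * C div \<alpha>) * \<alpha> + C'"
    unfolding B'_def C'_def by simp_all
  have "w = w * (A * \<alpha> + B * \<beta> + C * \<gamma>)" by (simp add: 1)
  also have "\<dots> = w * A * \<alpha> + (w * B) * \<beta> + (w * C) * \<gamma>" by (simp add: algebra_simps)
  also have "\<dots> = A' * \<alpha> + B' * \<beta> + C' * \<gamma>"
    unfolding A'_def by (subst B, subst C) (simp add: algebra_simps)
  finally have w: "w = A' * \<alpha> + B' * \<beta> + C' * \<gamma>" .
  have mod: "degree (v mod \<alpha>) \<le> degree \<alpha> - 1" for v
    using degree_mod_less'[OF assms(1), of v] by (cases "v mod \<alpha> = 0") auto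
  have prod: "degree ((v mod \<alpha>) * \<delta>) \<le> D" if "degree \<alpha> + degree \<delta> \<le> Suc D" for v \<delta>
  proof (cases "v mod \<alpha> = 0")
    case False
    then have "degree (v mod \<alpha>) < degree \<alpha>" by (rule degree_mod_less'[OF assms(1)])
    with degree_mult_le[of "v mod \<alpha>" \<delta>] that show ?thesis by linarith
  qed simp
  have "A' = 0 \<or> degree A' + degree \<alpha> \<le> D"
  proof (cases "A' = 0")
    case False
    have "degree (w - B' * \<beta> - C' * \<gamma>) \<le> D"
      unfolding B'_def C'_def by (intro degree_diff_le D(1) prod D)
    moreover have "w - B' * \<beta> - C' * \<gamma> = A' * \<alpha>" using w by (simp add: algebra_simps)
    ultimately show ?thesis using False assms(1) by (simp add: degree_mult_eq)
  qed simp
  then show thesis using that[OF w] mod by (simp add: B'_def C'_def)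
qed

text \<open>
  An ideal \<open>J\<close> in an algebra over an algebraically closed field, with \<open>\<kappa>\<close> the inclusion of the constants.
  It will be the ideal generated by a cubic form and its partial derivatives.
\<close>

locale algebra_ideal =
  fixes J :: "'r::comm_ring_1 set" and \<kappa> :: "'l::alg_closed_field \<Rightarrow> 'r"
  assumes zero_mem [simp]: "0 \<in> J"
    and add_mem: "a \<in> J \<Longrightarrow> b \<in> J \<Longrightarrow> a + b \<in> J"
    and mult_mem: "a \<in> J \<Longrightarrow> r * a \<in> J"
    and \<kappa>_add: "\<kappa> (x + y) = \<kappa> x + \<kappa> y"
    and \<kappa>_mult: "\<kappa> (x * y) = \<kappa> x * \<kappa> y"
    and \<kappa>_1 [simp]: "\<kappa> 1 = 1"
begin

lemma \<kappa>_0 [simp]: "\<kappa> 0 = 0" using \<kappa>_add[of 0 0] by simp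

lemma \<kappa>_uminus: "\<kappa> (- x) = - \<kappa> x"
  using \<kappa>_add[of x "- x"] by (simp add: eq_neg_iff_add_eq_0 add.commute)

lemma \<kappa>_numeral [simp]: "\<kappa> (numeral n) = numeral n"
proof -
  have "\<kappa> (of_nat m) = of_nat m" for m by (induction m) (simp_all add: \<kappa>_add)
  from this[of "numeral n"] show ?thesis by simp
qed

lemma \<kappa>_power: "\<kappa> (x ^ n) = \<kappa> x ^ n"
  by (induction n) (simp_all add: \<kappa>_mult)

lemma uminus_mem: "a \<in> J \<Longrightarrow> - a \<in> J"
  using mult_mem[of a "-1"] by simp

lemma diff_mem: "a \<in> J \<Longrightarrow> b \<in> J \<Longrightarrow> a - b \<in> J"
  using add_mem[of a "- b"] uminus_mem by simp

lemma sum_mem: "(\<And>i. i \<in> A \<Longrightarrow> a i \<in> J) \<Longrightarrow> (\<Sum>i\<in>A. a i) \<in> J"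
  by (induction A rule: infinite_finite_induct) (auto intro: add_mem)

lemma mem_cong: "a - b \<in> J \<Longrightarrow> a \<in> J \<longleftrightarrow> b \<in> J"
  using add_mem[of "a - b" b] diff_mem[of a "a - b"] by auto

text \<open>
  \<open>T d n\<close> stands for the monomial of degree \<open>d\<close> that restricts to \<open>s ^ (r d - n) t ^ n\<close> on a rational curve of
  degree \<open>r\<close>: a line for \<open>r = 1\<close>, a conic for \<open>r = 2\<close>. Then \<open>form T r d A\<close> lifts the binary form of degree
  \<open>r d\<close> with dehomogenisation \<open>A\<close>.
\<close>

definition form :: "(nat \<Rightarrow> nat \<Rightarrow> 'r) \<Rightarrow> nat \<Rightarrow> nat \<Rightarrow> 'l poly \<Rightarrow> 'r" where
  "form T r d A = (\<Sum>n\<le>r * d. \<kappa> (coeff A n) * T d n)"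

lemma form_add: "form T r d (A + B) = form T r d A + form T r d B"
  by (simp add: form_def \<kappa>_add distrib_right sum.distrib)

lemma form_sum: "form T r d (\<Sum>i\<in>I. A i) = (\<Sum>i\<in>I. form T r d (A i))"
  by (induction I rule: infinite_finite_induct) (simp_all add: form_add form_def[of _ _ _ 0])

lemma form_monom: "n \<le> r * d \<Longrightarrow> form T r d (monom c n) = \<kappa> c * T d n"
proof -
  assume n: "n \<le> r * d"
  have "form T r d (monom c n) = (\<Sum>k\<le>r * d. if k = n then \<kappa> c * T d n else 0)"
    unfolding form_def by (intro sum.cong) auto
  then show ?thesis using n by simp
qed

text \<open>
  Multiplication of binary forms is respected modulo \<open>J\<close>, where \<open>J\<close> contains the equation of the curve.
\<close>

definition multiplicative :: "(nat \<Rightarrow> nat \<Rightarrow> 'r) \<Rightarrow> nat \<Rightarrow> bool" where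
  "multiplicative T r \<longleftrightarrow>
     (\<forall>d e. \<forall>m\<le>r * d. \<forall>n\<le>r * e. T d m * T e n - T (d + e) (m + n) \<in> J)"

lemma form_mult:
  assumes T: "multiplicative T r"
    and "degree A \<le> r * d" "degree B \<le> r * e"
  shows "form T r d A * form T r e B - form T r (d + e) (A * B) \<in> J"
proof -
  have expand: "p = (\<Sum>m\<le>k. monom (coeff p m) m)" if "degree p \<le> k" for p :: "'l poly" and k
    by (rule poly_eqI) (use that in \<open>auto simp: coeff_sum coeff_eq_0\<close>)
  have "A * B = (\<Sum>m\<le>r * d. \<Sum>n\<le>r * e. monom (coeff A m * coeff B n) (m + n))"
    by (subst expand[OF assms(2)], subst expand[OF assms(3)])
      (simp add: sum_product mult_monom)
  then have "form T r (d + e) (A * B) =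
      (\<Sum>m\<le>r * d. \<Sum>n\<le>r * e. \<kappa> (coeff A m) * \<kappa> (coeff B n) * T (d + e) (m + n))"
    by (simp add: form_sum form_monom \<kappa>_mult algebra_simps)
  moreover have "form T r d A * form T r e B =
      (\<Sum>m\<le>r * d. \<Sum>n\<le>r * e. \<kappa> (coeff A m) * \<kappa> (coeff B n) * (T d m * T e n))"
    unfolding form_def sum_product by (simp add: algebra_simps)
  ultimately have "form T r d A * form T r e B - form T r (d + e) (A * B) =
      (\<Sum>m\<le>r * d. \<Sum>n\<le>r * e. \<kappa> (coeff A m) * \<kappa> (coeff B n) * (T d m * T e n - T (d + e) (m + n)))"
    by (simp add: sum_subtractf right_diff_distrib)
  also have "\<dots> \<in> J" using T by (intro sum_mem mult_mem) (auto simp: multiplicative_def)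
  finally show ?thesis .
qed

lemma form_mult_mem:
  assumes T: "multiplicative T r"
    and "degree A \<le> r * d" "degree B \<le> r * e" "form T r e B \<in> J" "D = d + e"
  shows "form T r D (A * B) \<in> J"
  using mem_cong[OF form_mult[OF T assms(2,3)]] assms(4,5) mult_mem by blast

lemma multiplicative_cong:
  assumes T: "multiplicative T r" and "n \<le> r * d" "m \<le> r * e"
    and "x - T d n \<in> J" "y - T e m \<in> J"
  shows "x * y - T (d + e) (n + m) \<in> J"
proof -
  have "T d n * T e m - T (d + e) (n + m) \<in> J" using T assms(2,3) by (simp add: multiplicative_def)
  moreover have "y * (x - T d n) \<in> J" "T d n * (y - T e m) \<in> J"
    using assms(4,5) by (auto intro: mult_mem)
  ultimately have "y * (x - T d n) + T d n * (y - T e m) + (T d n * T e m - T (d + e) (n + m)) \<in> J"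
    by (intro add_mem)
  then show ?thesis by (simp add: algebra_simps)
qed

lemma multiplicative_cong_power:
  assumes T: "multiplicative T r" "T 0 0 = 1" and "n \<le> r" "x - T 1 n \<in> J"
  shows "x ^ i - T i (n * i) \<in> J"
proof (induction i)
  case (Suc i)
  have "x * x ^ i - T (1 + i) (n + n * i) \<in> J"
    by (rule multiplicative_cong[OF T(1)]) (use Suc assms in auto)
  then show ?case by simp
qed (simp add: T)

text \<open>
  If \<open>J\<close> contains lifts of three binary forms without a common zero, then it contains the lifts of all
  forms of the degree \<open>D\<close> in question. There is no common zero at infinity because \<open>\<alpha>\<close> has exact degree
  \<open>r a\<close>; and \<open>a + b \<le> D\<close>, \<open>a + c \<le> D\<close> leave room for remainders modulo \<open>\<alpha>\<close> as cofactors.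
\<close>

lemma all_forms_mem:
  assumes T: "multiplicative T r"
    and \<alpha>: "\<alpha> \<noteq> 0" "degree \<alpha> = r * a" "form T r a \<alpha> \<in> J"
    and \<beta>: "degree \<beta> \<le> r * b" "form T r b \<beta> \<in> J"
    and \<gamma>: "degree \<gamma> \<le> r * c" "form T r c \<gamma> \<in> J"
    and no_root: "\<And>t. poly \<alpha> t = 0 \<Longrightarrow> poly \<beta> t = 0 \<Longrightarrow> poly \<gamma> t \<noteq> 0"
    and D: "a + b \<le> D" "a + c \<le> D" and n: "n \<le> r * D"
  shows "T D n \<in> J"
proof -
  have split: "r * (D - k) + r * k = r * D" if "k \<le> D" for k
    using that by (simp flip: distrib_left)
  have "r * a + r * b \<le> r * D" "r * a + r * c \<le> r * D"
    using D by (simp_all flip: distrib_left)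
  then have deg: "degree \<alpha> + degree \<beta> \<le> Suc (r * D)" "degree \<alpha> + degree \<gamma> \<le> Suc (r * D)"
    using \<alpha>(2) \<beta>(1) \<gamma>(1) by linarith+
  have "degree (monom 1 n :: 'l poly) \<le> r * D" using n by (simp add: degree_monom_eq)
  then obtain A B C where w: "monom 1 n = A * \<alpha> + B * \<beta> + C * \<gamma>"
    and A: "A = 0 \<or> degree A + degree \<alpha> \<le> r * D"
    and BC: "degree B \<le> degree \<alpha> - 1" "degree C \<le> degree \<alpha> - 1"
    using poly_combination_bounded[OF \<alpha>(1) no_root _ deg] by blast
  have le: "r * a \<le> r * (D - b)" "r * a \<le> r * (D - c)" using D by (auto intro: mult_le_mono2)
  have "T D n = form T r D (monom 1 n)" using n by (simp add: form_monom)
  also have "\<dots> = form T r D (A * \<alpha>) + form T r D (B * \<beta>) + form T r D (C * \<gamma>)"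
    by (simp add: w form_add)
  also have "\<dots> \<in> J"
  proof (intro add_mem)
    have "degree A \<le> r * (D - a)" using A \<alpha>(2) split[of a] D by auto
    then show "form T r D (A * \<alpha>) \<in> J" using \<alpha> D by (intro form_mult_mem[OF T]) auto
    show "form T r D (B * \<beta>) \<in> J"
      using \<beta> BC(1) \<alpha>(2) le(1) D by (intro form_mult_mem[OF T, of B "D - b" \<beta> b]) linarith+
    show "form T r D (C * \<gamma>) \<in> J"
      using \<gamma> BC(2) \<alpha>(2) le(2) D by (intro form_mult_mem[OF T, of C "D - c" \<gamma> c]) linarith+
  qed
  finally show ?thesis .
qed

end

section \<open>Cubics in normal form\<close>

lemma sum_atMost_4_6:
  fixes h :: "nat \<Rightarrow> 'a::comm_monoid_add"
  shows "(\<Sum>n\<le>4. h n) = h 0 + h 1 + h 2 + h 3 + h 4"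
    and "(\<Sum>n\<le>6. h n) = h 0 + h 1 + h 2 + h 3 + h 4 + h 5 + h 6"
  by (simp_all add: eval_nat_numeral)

context algebra_ideal begin

text \<open>
  The case where the tangent meets the cubic in a further point. The hypotheses \<open>F\<close>, \<open>FX\<close>, \<open>FY\<close>, \<open>FZ\<close> put
  the cubic and its partial derivatives into \<open>J\<close>, and \<open>nonsing\<close> says that these have no common zero.
  The conic \<open>2 \<xi> \<zeta> + b \<eta>\<^sup>2 = 0\<close> is parametrised by \<open>\<xi> = c s\<^sup>2\<close>, \<open>\<eta> = s t\<close>, \<open>\<zeta> = t\<^sup>2\<close> with \<open>c = -b/2\<close>; on it
  \<open>FX\<close> becomes a quartic that is monic in \<open>t\<close>, \<open>FY\<close> a quartic and \<open>F\<close> a sextic.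
\<close>

lemma monomials_mem_nondegenerate:
  fixes b k0 k1 k2 k3 :: 'l
  assumes two: "(2::'l) \<noteq> 0" and b: "b \<noteq> 0"
    and F: "\<xi> * \<zeta>^2 + \<kappa> b * \<eta>^2 * \<zeta> + \<kappa> k0 * \<xi>^3 + \<kappa> k1 * \<xi>^2 * \<eta> + \<kappa> k2 * \<xi> * \<eta>^2 + \<kappa> k3 * \<eta>^3 \<in> J"
    and FX: "\<zeta>^2 + 3 * \<kappa> k0 * \<xi>^2 + 2 * \<kappa> k1 * \<xi> * \<eta> + \<kappa> k2 * \<eta>^2 \<in> J"
    and FY: "2 * \<kappa> b * \<eta> * \<zeta> + \<kappa> k1 * \<xi>^2 + 2 * \<kappa> k2 * \<xi> * \<eta> + 3 * \<kappa> k3 * \<eta>^2 \<in> J"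
    and FZ: "2 * \<xi> * \<zeta> + \<kappa> b * \<eta>^2 \<in> J"
    and nonsing: "\<And>x y z. \<lbrakk>x * z^2 + b * y^2 * z + k0 * x^3 + k1 * x^2 * y + k2 * x * y^2 + k3 * y^3 = 0;
      z^2 + 3 * k0 * x^2 + 2 * k1 * x * y + k2 * y^2 = 0;
      2 * b * y * z + k1 * x^2 + 2 * k2 * x * y + 3 * k3 * y^2 = 0;
      2 * x * z + b * y^2 = 0\<rbrakk> \<Longrightarrow> x = 0 \<and> y = 0 \<and> z = 0"
    and ijk: "i + j + k = 6"
  shows "\<xi>^i * \<eta>^j * \<zeta>^k \<in> J"
proof -
  define c where "c = - b / 2"
  have c: "c \<noteq> 0" and bc: "b = - 2 * c" using two b by (simp_all add: c_def)
  \<comment> \<open>The rescaling turns the conic into \<open>V \<zeta> = \<eta>\<^sup>2\<close>.\<close>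
  define V where "V = \<kappa> (1 / c) * \<xi>"
  have xi: "\<xi> = \<kappa> c * V" using c by (simp add: V_def \<kappa>_mult[symmetric] flip: mult.assoc)
  have YV: "V * \<zeta> - \<eta>^2 \<in> J"
  proof -
    have unit: "\<kappa> (1 / (2 * c)) * (2 * \<kappa> c) = 1" "\<kappa> (1 / (2 * c)) * \<kappa> b = - 1"
      using c two \<kappa>_mult[of "1 / (2 * c)" "2 * c"] \<kappa>_mult[of 2 c] \<kappa>_mult[of "1 / (2 * c)" b]
      by (simp_all add: bc \<kappa>_uminus)
    have "\<kappa> (1 / (2 * c)) * (2 * \<xi> * \<zeta> + \<kappa> b * \<eta>^2)
       = (\<kappa> (1 / (2 * c)) * (2 * \<kappa> c)) * (V * \<zeta>) + (\<kappa> (1 / (2 * c)) * \<kappa> b) * \<eta>^2"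
      by (simp only: xi) (simp only: algebra_simps)
    also have "\<dots> = V * \<zeta> - \<eta>^2"
      by (simp only: unit) simp
    finally show ?thesis using mult_mem[OF FZ, of "\<kappa> (1 / (2 * c))"] by simp
  qed
  \<comment> \<open>\<open>V ^ i \<eta> ^ j \<zeta> ^ k\<close> restricts to \<open>t ^ (j + 2 k)\<close>; the representatives chosen have \<open>j \<le> 1\<close>.\<close>
  define T where "T d n = (if even n then V^(d - n div 2) * \<zeta>^(n div 2)
      else V^(d - Suc (n div 2)) * \<eta> * \<zeta>^(n div 2))" for d n :: nat
  have T: "multiplicative T 2" unfolding multiplicative_def
  proof (intro allI impI)
    fix d e m n :: nat assume mn: "m \<le> 2 * d" "n \<le> 2 * e"
    define m' n' where "m' = m div 2" and "n' = n div 2"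
    consider "m = 2 * m'" "n = 2 * n'" | "m = 2 * m'" "n = Suc (2 * n')"
      | "m = Suc (2 * m')" "n = 2 * n'" | "m = Suc (2 * m')" "n = Suc (2 * n')"
      unfolding m'_def n'_def by (metis dvd_mult_div_cancel odd_two_times_div_two_succ Suc_eq_plus1)
    then show "T d m * T e n - T (d + e) (m + n) \<in> J"
    proof cases
      case 1
      have "d - m' + (e - n') = d + e - (m' + n')" using mn 1 by linarith
      then have "V^(d + e - (m' + n')) = V^(d - m') * V^(e - n')" by (simp flip: power_add)
      then show ?thesis by (simp add: T_def 1 power_add mult_ac flip: distrib_left)
    next
      case 2
      have "d - m' + (e - Suc n') = d + e - Suc (m' + n')" using mn 2 by linarith
      then have "V^(d + e - Suc (m' + n')) = V^(d - m') * V^(e - Suc n')" by (simp flip: power_add)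
      then show ?thesis by (simp add: T_def 2 power_add mult_ac flip: distrib_left)
    next
      case 3
      have "d - Suc m' + (e - n') = d + e - Suc (m' + n')" using mn 3 by linarith
      then have "V^(d + e - Suc (m' + n')) = V^(d - Suc m') * V^(e - n')" by (simp flip: power_add)
      then show ?thesis by (simp add: T_def 3 power_add mult_ac flip: distrib_left)
    next
      case 4
      have "Suc (d - Suc m' + (e - Suc n')) = d + e - Suc (m' + n')" using mn 4 by linarith
      then have V: "V^(d + e - Suc (m' + n')) = V * (V^(d - Suc m') * V^(e - Suc n'))"
        by (metis power_Suc power_add)
      have "m + n = 2 * Suc (m' + n')" using 4 by simp
      then have "T (d + e) (m + n) = V^(d + e - Suc (m' + n')) * \<zeta>^Suc (m' + n')"
        by (simp add: T_def)
      then have "T d m * T e n - T (d + e) (m + n)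
          = - (V^(d - Suc m') * V^(e - Suc n') * \<zeta>^(m' + n')) * (V * \<zeta> - \<eta>^2)"
        by (simp add: T_def 4 V power_add algebra_simps power2_eq_square)
      then show ?thesis using mult_mem[OF YV] by (simp add: uminus_mem)
    qed
  qed
  have T00: "T 0 0 = 1" by (simp add: T_def)
  have VYZ: "V - T 1 0 \<in> J" "\<eta> - T 1 1 \<in> J" "\<zeta> - T 1 2 \<in> J" by (simp_all add: T_def)
  define \<alpha> where "\<alpha> = [:3 * k0 * c^2, 2 * k1 * c, k2, 0, 1:]"
  define \<beta> where "\<beta> = [:k1 * c^2, 2 * k2 * c, 3 * k3, 2 * b:]"
  define \<gamma> where "\<gamma> = [:k0 * c^3, k1 * c^2, k2 * c, k3, c + b:]"
  have f\<alpha>: "form T 2 2 \<alpha> \<in> J"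
  proof -
    have "form T 2 2 \<alpha> = (\<zeta>^2 + 3 * \<kappa> k0 * \<xi>^2 + 2 * \<kappa> k1 * \<xi> * \<eta> + \<kappa> k2 * \<eta>^2) + \<kappa> k2 * (V * \<zeta> - \<eta>^2)"
      by (simp add: form_def sum_atMost_4_6 \<alpha>_def coeff_pCons' T_def xi \<kappa>_mult algebra_simps power2_eq_square)
    then show ?thesis using add_mem[OF FX mult_mem[OF YV]] by simp
  qed
  have f\<beta>: "form T 2 2 \<beta> \<in> J"
  proof -
    have "form T 2 2 \<beta> = (2 * \<kappa> b * \<eta> * \<zeta> + \<kappa> k1 * \<xi>^2 + 2 * \<kappa> k2 * \<xi> * \<eta> + 3 * \<kappa> k3 * \<eta>^2)
        + 3 * \<kappa> k3 * (V * \<zeta> - \<eta>^2)"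
      by (simp add: form_def sum_atMost_4_6 \<beta>_def coeff_pCons' T_def xi \<kappa>_mult algebra_simps power2_eq_square)
    then show ?thesis using add_mem[OF FY mult_mem[OF YV]] by simp
  qed
  have f\<gamma>: "form T 2 3 \<gamma> \<in> J"
  proof -
    have "form T 2 3 \<gamma> =
        (\<xi> * \<zeta>^2 + \<kappa> b * \<eta>^2 * \<zeta> + \<kappa> k0 * \<xi>^3 + \<kappa> k1 * \<xi>^2 * \<eta> + \<kappa> k2 * \<xi> * \<eta>^2 + \<kappa> k3 * \<eta>^3)
        + (\<kappa> b * \<zeta> + \<kappa> c * \<kappa> k2 * V + \<kappa> k3 * \<eta>) * (V * \<zeta> - \<eta>^2)"
      by (simp add: form_def sum_atMost_4_6 \<gamma>_def coeff_pCons' T_def xi \<kappa>_mult \<kappa>_add algebra_simps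
          power2_eq_square power3_eq_cube)
    then show ?thesis using add_mem[OF F mult_mem[OF YV]] by simp
  qed
  have no_root: "poly \<gamma> t \<noteq> 0" if "poly \<alpha> t = 0" "poly \<beta> t = 0" for t
  proof
    assume "poly \<gamma> t = 0"
    have "c * (t^2)^2 + b * t^2 * t^2 + k0 * c^3 + k1 * c^2 * t + k2 * c * t^2 + k3 * t^3 = 0"
      using \<open>poly \<gamma> t = 0\<close> by (simp add: \<gamma>_def algebra_simps power2_eq_square power3_eq_cube)
    moreover have "(t^2)^2 + 3 * k0 * c^2 + 2 * k1 * c * t + k2 * t^2 = 0"
      using that(1) by (simp add: \<alpha>_def algebra_simps power2_eq_square power3_eq_cube)
    moreover have "2 * b * t * t^2 + k1 * c^2 + 2 * k2 * c * t + 3 * k3 * t^2 = 0"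
      using that(2) by (simp add: \<beta>_def algebra_simps power2_eq_square power3_eq_cube)
    moreover have "2 * c * t^2 + b * t^2 = 0" by (simp add: bc)
    ultimately show False using nonsing[of c "t^2" t] c by blast
  qed
  have "degree \<alpha> = 2 * 2" "\<alpha> \<noteq> 0" "degree \<beta> \<le> 2 * 2" "degree \<gamma> \<le> 2 * 3"
    by (simp_all add: \<alpha>_def \<beta>_def \<gamma>_def)
  note all = all_forms_mem[OF T this(2,1) f\<alpha> this(3) f\<beta> this(4) f\<gamma> no_root, of 6]
  have "V^i - T i (0 * i) \<in> J" "\<eta>^j - T j (1 * j) \<in> J" "\<zeta>^k - T k (2 * k) \<in> J"
    using VYZ by (intro multiplicative_cong_power[OF T T00]; simp)+
  moreover from this have "V^i * \<eta>^j - T (i + j) (0 * i + 1 * j) \<in> J"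
    by (intro multiplicative_cong[OF T]) auto
  ultimately have "V^i * \<eta>^j * \<zeta>^k - T (i + j + k) (0 * i + 1 * j + 2 * k) \<in> J"
    by (intro multiplicative_cong[OF T]) auto
  moreover have "T (i + j + k) (0 * i + 1 * j + 2 * k) \<in> J" unfolding ijk
    by (rule all) (use ijk in auto)
  ultimately have "V^i * \<eta>^j * \<zeta>^k \<in> J" using mem_cong by blast
  then have "\<kappa> c ^ i * (V^i * \<eta>^j * \<zeta>^k) \<in> J" by (rule mult_mem)
  then show ?thesis by (simp add: xi power_mult_distrib mult_ac)
qed

text \<open>
  The case \<open>b = 0\<close> of a flex, where \<open>\<xi> \<zeta>\<close> lies in \<open>J\<close>. Modulo \<open>\<xi> \<zeta>\<close> the cubic and its derivative in \<open>\<eta>\<close>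
  are binary forms in \<open>\<xi>\<close> and \<open>\<eta>\<close>; a common root would give a singular point with \<open>\<zeta> = 0\<close>, so \<open>J\<close>
  contains all sextics in \<open>\<xi>\<close> and \<open>\<eta>\<close>. Powers of \<open>\<zeta>\<close> are removed by \<open>FX\<close>, which expresses \<open>\<zeta>\<^sup>2\<close> through
  the other two variables.
\<close>

lemma monomials_mem_flex:
  fixes k0 k1 k2 k3 :: 'l
  assumes two: "(2::'l) \<noteq> 0"
    and F: "\<xi> * \<zeta>^2 + \<kappa> k0 * \<xi>^3 + \<kappa> k1 * \<xi>^2 * \<eta> + \<kappa> k2 * \<xi> * \<eta>^2 + \<kappa> k3 * \<eta>^3 \<in> J"
    and FX: "\<zeta>^2 + 3 * \<kappa> k0 * \<xi>^2 + 2 * \<kappa> k1 * \<xi> * \<eta> + \<kappa> k2 * \<eta>^2 \<in> J"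
    and FY: "\<kappa> k1 * \<xi>^2 + 2 * \<kappa> k2 * \<xi> * \<eta> + 3 * \<kappa> k3 * \<eta>^2 \<in> J"
    and FZ: "2 * \<xi> * \<zeta> \<in> J"
    and nonsing: "\<And>x y z. \<lbrakk>x * z^2 + k0 * x^3 + k1 * x^2 * y + k2 * x * y^2 + k3 * y^3 = 0;
      z^2 + 3 * k0 * x^2 + 2 * k1 * x * y + k2 * y^2 = 0;
      k1 * x^2 + 2 * k2 * x * y + 3 * k3 * y^2 = 0;
      2 * x * z = 0\<rbrakk> \<Longrightarrow> x = 0 \<and> y = 0 \<and> z = 0"
    and ijk: "i + j + k = 6"
  shows "\<xi>^i * \<eta>^j * \<zeta>^k \<in> J"
proof -
  have XZ: "\<xi> * \<zeta> \<in> J"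
  proof -
    have "\<kappa> (1 / 2) * 2 = 1" using two \<kappa>_mult[of "1 / 2" 2] by simp
    then have "\<kappa> (1 / 2) * (2 * \<xi> * \<zeta>) = \<xi> * \<zeta>" by (metis mult.assoc mult_1)
    then show ?thesis using mult_mem[OF FZ, of "\<kappa> (1 / 2)"] by simp
  qed
  have k3: "k3 \<noteq> 0"
  proof
    assume k3: "k3 = 0"
    \<comment> \<open>If \<open>k3 = 0\<close>, the cubic is divisible by \<open>\<xi>\<close>, and a point where the line meets the residual conic is singular.\<close>
    obtain z where "z^2 = - k2" using nth_root_exists[of 2 "- k2"] by auto
    then show False using nonsing[of 0 z 1] by (simp add: k3)
  qed
  define T where "T d n = \<xi>^(d - n) * \<eta>^n" for d n :: nat
  have T: "multiplicative T 1" unfolding multiplicative_def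
  proof (intro allI impI)
    fix d e m n :: nat assume mn: "m \<le> 1 * d" "n \<le> 1 * e"
    have "d - m + (e - n) = d + e - (m + n)" using mn by linarith
    then have "\<xi>^(d + e - (m + n)) = \<xi>^(d - m) * \<xi>^(e - n)" by (simp flip: power_add)
    then show "T d m * T e n - T (d + e) (m + n) \<in> J"
      by (simp add: T_def power_add mult_ac)
  qed
  define \<alpha> where "\<alpha> = [:k0, k1, k2, k3:]"
  define \<beta> where "\<beta> = [:k1, 2 * k2, 3 * k3:]"
  have cubic: "\<kappa> k0 * \<xi>^3 + \<kappa> k1 * \<xi>^2 * \<eta> + \<kappa> k2 * \<xi> * \<eta>^2 + \<kappa> k3 * \<eta>^3 \<in> J"
    using diff_mem[OF F mult_mem[OF XZ, of \<zeta>]] by (simp add: algebra_simps power2_eq_square)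
  have f\<alpha>: "form T 1 3 \<alpha> \<in> J"
    using cubic by (simp add: form_def \<alpha>_def T_def eval_nat_numeral algebra_simps)
  have f\<beta>: "form T 1 2 \<beta> \<in> J"
    using FY by (simp add: form_def \<beta>_def T_def \<kappa>_mult eval_nat_numeral algebra_simps)
  have no_root: "poly \<beta> t \<noteq> 0" if "poly \<alpha> t = 0" for t
  proof
    assume "poly \<beta> t = 0"
    have a: "k0 + k1 * t + k2 * t^2 + k3 * t^3 = 0"
      using that by (simp add: \<alpha>_def algebra_simps power2_eq_square power3_eq_cube)
    have b: "k1 + 2 * k2 * t + 3 * k3 * t^2 = 0"
      using \<open>poly \<beta> t = 0\<close> by (simp add: \<beta>_def algebra_simps power2_eq_square power3_eq_cube)
    have "3 * k0 + 2 * k1 * t + k2 * t^2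
        = 3 * (k0 + k1 * t + k2 * t^2 + k3 * t^3) - t * (k1 + 2 * k2 * t + 3 * k3 * t^2)"
      by (simp add: algebra_simps power2_eq_square power3_eq_cube)
    then show False using nonsing[of 1 0 t] a b by simp
  qed
  have "degree \<alpha> = 1 * 3" "\<alpha> \<noteq> 0" "degree \<beta> \<le> 1 * 2"
    using k3 by (simp_all add: \<alpha>_def \<beta>_def)
  note all = all_forms_mem[OF T this(2,1) f\<alpha> this(3) f\<beta> this(3) f\<beta> no_root, of 6]
  have XY: "\<xi>^i * \<eta>^j \<in> J" if "i + j = 6" for i j
  proof -
    have "T 6 j \<in> J" by (rule all) (use that in auto)
    moreover have "6 - j = i" using that by simp
    ultimately show ?thesis by (simp add: T_def)
  qed
  have Y3Z: "\<eta>^3 * \<zeta> \<in> J"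
  proof -
    have "\<kappa> k3 * (\<eta>^3 * \<zeta>) = \<zeta> * (\<kappa> k0 * \<xi>^3 + \<kappa> k1 * \<xi>^2 * \<eta> + \<kappa> k2 * \<xi> * \<eta>^2 + \<kappa> k3 * \<eta>^3)
      - (\<kappa> k0 * \<xi>^2 + \<kappa> k1 * \<xi> * \<eta> + \<kappa> k2 * \<eta>^2) * (\<xi> * \<zeta>)"
      by (simp add: algebra_simps power2_eq_square power3_eq_cube)
    also have "\<dots> \<in> J" by (intro diff_mem mult_mem cubic XZ)
    finally have "\<kappa> (1 / k3) * (\<kappa> k3 * (\<eta>^3 * \<zeta>)) \<in> J" by (rule mult_mem)
    then show ?thesis using k3 by (simp flip: mult.assoc \<kappa>_mult)
  qed
  have step: "\<eta>^j * \<zeta>^(k + 3) \<in> J" if "\<eta>^(j + 2) * \<zeta>^(k + 1) \<in> J" for j k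
  proof -
    have "\<eta>^j * \<zeta>^(k + 3) = (\<eta>^j * \<zeta>^(k + 1)) * (\<zeta>^2 + 3 * \<kappa> k0 * \<xi>^2 + 2 * \<kappa> k1 * \<xi> * \<eta> + \<kappa> k2 * \<eta>^2)
      - (\<eta>^j * \<zeta>^k * (3 * \<kappa> k0 * \<xi> + 2 * \<kappa> k1 * \<eta>)) * (\<xi> * \<zeta>) - \<kappa> k2 * (\<eta>^(j + 2) * \<zeta>^(k + 1))"
      by (simp add: algebra_simps power2_eq_square power3_eq_cube power_add)
    also have "\<dots> \<in> J" by (intro diff_mem mult_mem FX XZ that)
    finally show ?thesis .
  qed
  have YZ: "\<eta>^j * \<zeta>^k \<in> J" if "j \<ge> 3" "k \<ge> 1" for j k
  proof -
    obtain j' k' where "j = 3 + j'" "k = Suc k'" using \<open>j \<ge> 3\<close> \<open>k \<ge> 1\<close>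
      by (metis le_Suc_ex plus_1_eq_Suc)
    then have "\<eta>^j * \<zeta>^k = (\<eta>^j' * \<zeta>^k') * (\<eta>^3 * \<zeta>)" by (simp add: power_add mult_ac)
    then show ?thesis using mult_mem[OF Y3Z] by simp
  qed
  show ?thesis
  proof (cases "k = 0 \<or> i > 0")
    case True
    then show ?thesis
    proof
      assume "k = 0" then show ?thesis using XY ijk by simp
    next
      assume i: "i > 0"
      show ?thesis
      proof (cases "k = 0")
        case True then show ?thesis using XY ijk by simp
      next
        case False
        with i obtain i' k' where "i = Suc i'" "k = Suc k'" using gr0_implies_Suc by (metis neq0_conv)
        then have "\<xi>^i * \<eta>^j * \<zeta>^k = (\<xi>^i' * \<eta>^j * \<zeta>^k') * (\<xi> * \<zeta>)" by (simp add: mult_ac)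
        then show ?thesis using mult_mem[OF XZ] by simp
      qed
    qed
  next
    case False
    then have i: "i = 0" and jk: "j + k = 6" "k \<ge> 1" using ijk by auto
    have 24: "\<eta>^2 * \<zeta>^4 \<in> J" using step[of 2 1] YZ[of 4 2] by (simp add: power2_eq_square)
    have "j \<ge> 3 \<or> j = 0 \<or> j = 1 \<or> j = 2" by linarith
    then have "\<eta>^j * \<zeta>^k \<in> J"
    proof (elim disjE)
      assume "j \<ge> 3" then show ?thesis using YZ jk by blast
    next
      assume "j = 0" then show ?thesis using step[of 0 3] 24 jk by (simp add: power2_eq_square)
    next
      assume "j = 1" then show ?thesis using step[of 1 2] YZ[of 3 3] jk by (simp add: numeral_eq_Suc)
    next
      assume "j = 2" then show ?thesis using 24 jk by simp
    qed
    then show ?thesis by (simp add: i)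
  qed
qed

end

section \<open>Coordinates adapted to a point of the cubic\<close>

lemma UNIV_three: "(UNIV :: 3 set) = {0, 1, 2}"
proof -
  have "card {0, 1, 2 :: 3} = 3" by simp
  then show ?thesis by (intro card_subset_eq[symmetric]) simp_all
qed

lemma sum_three: "(\<Sum>v\<in>UNIV. h v) = h 0 + h 1 + h (2::3)"
  for h :: "3 \<Rightarrow> 'a::comm_monoid_add"
  unfolding UNIV_three by (simp add: add.assoc)

lemma prod_three: "(\<Prod>v\<in>UNIV. h v) = h 0 * h 1 * h (2::3)"
  for h :: "3 \<Rightarrow> 'a::comm_monoid_mult"
  unfolding UNIV_three by (simp add: mult.assoc)

lemma all_three: "(\<forall>v::3. P v) \<longleftrightarrow> P 0 \<and> P 1 \<and> P 2"
proof -
  have "(\<forall>v::3. P v) \<longleftrightarrow> (\<forall>v\<in>UNIV. P v)" by simp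
  also have "\<dots> \<longleftrightarrow> P 0 \<and> P 1 \<and> P 2" unfolding UNIV_three by simp
  finally show ?thesis .
qed

text \<open>
  The entries of the identity \<open>(g \<times> z) (P \<times> e)\<^sup>T = e g\<^sup>T + P z\<^sup>T - 1\<close>, which holds for vectors whose pairings
  are as assumed. One row suffices since the hypotheses are invariant under cyclic permutation of the
  coordinates.
\<close>

lemma cross_product_identities:
  fixes g0 :: "'a::field"
  assumes "g0 * p0 + g1 * p1 + g2 * p2 = 0" "z0 * p0 + z1 * p1 + z2 * p2 = 1"
    "g0 * e0 + g1 * e1 + g2 * e2 = 1" "z0 * e0 + z1 * e1 + z2 * e2 = 0"
  shows "(g1 * z2 - g2 * z1) * (p1 * e2 - p2 * e1) = e0 * g0 + p0 * z0 - 1"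
    and "(g1 * z2 - g2 * z1) * (p2 * e0 - p0 * e2) = e0 * g1 + p0 * z1"
    and "(g1 * z2 - g2 * z1) * (p0 * e1 - p1 * e0) = e0 * g2 + p0 * z2"
proof -
  have solve: "b + c = s - a" "b = s - a - c" "c = s - a - b" if "a + b + c = s" for a b c s :: 'a
    using that by (auto simp: algebra_simps)
  have "(g1 * z2 - g2 * z1) * (p1 * e2 - p2 * e1)
      = (g1 * p1 + g2 * p2) * (z1 * e1 + z2 * e2) - (g1 * e1 + g2 * e2) * (z1 * p1 + z2 * p2)"
    by (simp add: algebra_simps)
  also have "\<dots> = e0 * g0 + p0 * z0 - 1"
    unfolding assms[THEN solve(1)] by (simp add: algebra_simps)
  finally show "(g1 * z2 - g2 * z1) * (p1 * e2 - p2 * e1) = e0 * g0 + p0 * z0 - 1" .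
  have "(g1 * z2 - g2 * z1) * (p2 * e0 - p0 * e2)
      = g1 * e0 * (z2 * p2) - g1 * p0 * (z2 * e2) - z1 * e0 * (g2 * p2) + z1 * p0 * (g2 * e2)"
    by (simp add: algebra_simps)
  also have "\<dots> = e0 * g1 + p0 * z1"
    unfolding assms[THEN solve(3)] by (simp add: algebra_simps)
  finally show "(g1 * z2 - g2 * z1) * (p2 * e0 - p0 * e2) = e0 * g1 + p0 * z1" .
  have "(g1 * z2 - g2 * z1) * (p0 * e1 - p1 * e0)
      = z2 * p0 * (g1 * e1) - z2 * e0 * (g1 * p1) - g2 * p0 * (z1 * e1) + g2 * e0 * (z1 * p1)"
    by (simp add: algebra_simps)
  also have "\<dots> = e0 * g2 + p0 * z2"
    unfolding assms[THEN solve(2)] by (simp add: algebra_simps)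
  finally show "(g1 * z2 - g2 * z1) * (p0 * e1 - p1 * e0) = e0 * g2 + p0 * z2" .
qed

definition pairing :: "('v::finite \<Rightarrow> 'a::comm_ring_1) \<Rightarrow> ('v \<Rightarrow> 'a) \<Rightarrow> 'a" where
  "pairing x e = (\<Sum>v\<in>UNIV. x v * e v)"

lemma exists_pairing_1:
  fixes g :: "'v::finite \<Rightarrow> 'a::field"
  assumes "g v \<noteq> 0"
  obtains e where "pairing g e = 1"
proof
  have "(\<Sum>w\<in>UNIV. g w * (if w = v then 1 / g v else 0)) = (\<Sum>w\<in>UNIV. if w = v then 1 else 0)"
    by (intro sum.cong) (use assms in auto)
  then show "pairing g (\<lambda>w. if w = v then 1 / g v else 0) = 1" by (simp add: pairing_def)
qed

lemma pairing_commute: "pairing x e = pairing e x"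
  by (simp add: pairing_def mult.commute)

text \<open>
  Completes \<open>g\<close> and \<open>P\<close> to dual bases in which \<open>P\<close> is the third vector and \<open>g\<close> the first covector: correct
  any \<open>e\<close> with \<open>g e = 1\<close> by a multiple of \<open>P\<close>, and obtain the remaining vector and covector as
  cross products. The last conclusion is the completeness relation of the two bases.
\<close>

lemma dual_bases_exist:
  fixes g P :: "3 \<Rightarrow> 'a::field"
  assumes "g v \<noteq> 0" "P w \<noteq> 0" and gP: "pairing g P = 0"
  obtains e1 e2 x2 x3 where
    "pairing g e1 = 1" "pairing g e2 = 0"
    "pairing x2 e1 = 0" "pairing x2 e2 = 1" "pairing x2 P = 0"
    "pairing x3 e1 = 0" "pairing x3 e2 = 0" "pairing x3 P = 1"
    "\<And>v w. e1 v * g w + e2 v * x2 w + P v * x3 w = (if v = w then 1 else 0)"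
proof -
  obtain z where "pairing P z = 1" using exists_pairing_1[of P w] assms(2) by blast
  then have zP: "pairing z P = 1" by (simp add: pairing_commute)
  obtain e' where e': "pairing g e' = 1" using exists_pairing_1[of g v] assms(1) by blast
  define c where "c = pairing z e'"
  define e where "e v = e' v - c * P v" for v
  have ge: "pairing g e = 1"
  proof -
    have "pairing g e = pairing g e' - c * pairing g P"
      by (simp add: e_def pairing_def sum_three algebra_simps)
    then show ?thesis by (simp add: e' gP)
  qed
  have ze: "pairing z e = 0"
  proof -
    have "pairing z e = pairing z e' - c * pairing z P"
      by (simp add: e_def pairing_def sum_three algebra_simps)
    then show ?thesis by (simp add: zP c_def)
  qed
  define e2 where "e2 v = (if v = 0 then g 1 * z 2 - g 2 * z 1 else if v = 1 then g 2 * z 0 - g 0 * z 2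
    else g 0 * z 1 - g 1 * z 0)" for v :: 3
  define x2 where "x2 v = - (if v = 0 then P 1 * e 2 - P 2 * e 1 else if v = 1 then P 2 * e 0 - P 0 * e 2
    else P 0 * e 1 - P 1 * e 0)" for v :: 3
  note [simp] = pairing_def sum_three
  have h: "g 0 * P 0 + g 1 * P 1 + g 2 * P 2 = 0" "z 0 * P 0 + z 1 * P 1 + z 2 * P 2 = 1"
    "g 0 * e 0 + g 1 * e 1 + g 2 * e 2 = 1" "z 0 * e 0 + z 1 * e 1 + z 2 * e 2 = 0"
    using gP zP ge ze by simp_all
  have h1: "g 1 * P 1 + g 2 * P 2 + g 0 * P 0 = 0" "z 1 * P 1 + z 2 * P 2 + z 0 * P 0 = 1"
    "g 1 * e 1 + g 2 * e 2 + g 0 * e 0 = 1" "z 1 * e 1 + z 2 * e 2 + z 0 * e 0 = 0"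
    and h2: "g 2 * P 2 + g 0 * P 0 + g 1 * P 1 = 0" "z 2 * P 2 + z 0 * P 0 + z 1 * P 1 = 1"
    "g 2 * e 2 + g 0 * e 0 + g 1 * e 1 = 1" "z 2 * e 2 + z 0 * e 0 + z 1 * e 1 = 0"
    using h by (simp_all only: add_ac)
  note ids = cross_product_identities[OF h] cross_product_identities[OF h1] cross_product_identities[OF h2]
  show thesis
  proof (rule that[of e e2 x2 z])
    show "pairing g e = 1" by (rule ge)
    show "pairing z e = 0" by (rule ze)
    show "pairing z P = 1" by (rule zP)
    show "pairing g e2 = 0" "pairing z e2 = 0" "pairing x2 e = 0" "pairing x2 P = 0"
      by (simp_all add: e2_def x2_def algebra_simps)
    have "pairing x2 e2 = - ((g 1 * z 2 - g 2 * z 1) * (P 1 * e 2 - P 2 * e 1)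
        + (g 2 * z 0 - g 0 * z 2) * (P 2 * e 0 - P 0 * e 2) + (g 0 * z 1 - g 1 * z 0) * (P 0 * e 1 - P 1 * e 0))"
      by (simp add: e2_def x2_def algebra_simps)
    also have "\<dots> = 3 - (g 0 * e 0 + g 1 * e 1 + g 2 * e 2) - (z 0 * P 0 + z 1 * P 1 + z 2 * P 2)"
      unfolding ids by (simp add: algebra_simps)
    finally show "pairing x2 e2 = 1" by (simp only: h) simp
    have "\<forall>v w. e v * g w + e2 v * x2 w + P v * z w = (if v = w then 1 else 0)"
      unfolding all_three by (simp add: e2_def x2_def ids del: minus_diff_eq)
    then show "e v * g w + e2 v * x2 w + P v * z w = (if v = w then 1 else 0)" for v w by blast
  qed
qed

text \<open>
  Restrict \<open>f\<close> to the affine line of points \<open>(t, 1, 0)\<close>. If there is no root, the restriction is constant;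
  then its coefficient of \<open>t\<^sup>3\<close> vanishes, so the point at infinity \<open>(1, 0, 0)\<close> of the line is a zero.
\<close>

lemma cubic_has_point:
  fixes f :: "(3, 'l::alg_closed_field) mpoly"
  assumes f: "homogeneous 3 f"
  obtains P v where "P v \<noteq> 0" "eval f P = 0"
proof -
  define q where "q = (\<Sum>m\<in>keys f. monom (lookup f m * 0 ^ lookup m 2) (lookup m 0))"
  have q: "poly q t = eval f (\<lambda>v. if v = 0 then t else if v = 1 then 1 else 0)" for t
    unfolding q_def eval_def extend_def poly_sum
    by (intro sum.cong) (simp_all add: poly_monom prod_three mult_ac)
  show thesis
  proof (cases "degree q = 0")
    case False
    then obtain t where "poly q t = 0" using alg_closed_imp_poly_has_root by blast
    then show thesis
      using that[of "\<lambda>v. if v = 0 then t else if v = 1 then 1 else 0" 1] by (simp add: q)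
  next
    case True
    have "coeff q 3 = eval f (\<lambda>v. if v = 0 then 1 else 0)"
      unfolding q_def eval_def extend_def coeff_sum
    proof (intro sum.cong refl)
      fix m assume "m \<in> keys f"
      then have "lookup m 0 + lookup m 1 + lookup m 2 = 3"
        using f by (simp add: homogeneous_def sum_three)
      then show "coeff (monom (lookup f m * 0 ^ lookup m 2) (lookup m 0)) 3
          = lookup f m * (\<Prod>v\<in>UNIV. (if v = 0 then 1 else 0) ^ lookup m v)"
        by (auto simp: prod_three power_0_left)
    qed
    moreover have "coeff q 3 = 0" using True by (simp add: coeff_eq_0)
    ultimately show thesis using that[of "\<lambda>v. if v = 0 then 1 else 0" 0] by simp
  qed
qed

section \<open>Directional derivatives and linear forms\<close>

abbreviation const :: "'k::field \<Rightarrow> ('v, 'k) mpoly" where "const c \<equiv> single 0 c"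

definition linear_form :: "('v::finite \<Rightarrow> 'k::field) \<Rightarrow> ('v, 'k) mpoly" where
  "linear_form x = (\<Sum>v\<in>UNIV. const (x v) * variable v)"

definition directional :: "('v::finite \<Rightarrow> 'k::field) \<Rightarrow> ('v, 'k) mpoly \<Rightarrow> ('v, 'k) mpoly" where
  "directional e f = (\<Sum>v\<in>UNIV. const (e v) * partial_deriv v f)"

lemma single_sum: "single m (\<Sum>i\<in>A. c i) = (\<Sum>i\<in>A. single m (c i))"
  by (induction A rule: infinite_finite_induct) (simp_all add: single_add)

lemma eval_sum: "eval (\<Sum>i\<in>A. f i) a = (\<Sum>i\<in>A. eval (f i) a)"
  by (induction A rule: infinite_finite_induct) (simp_all add: eval_add)

lemma eval_const [simp]: "eval (const c) a = c"
  by (simp add: eval_single)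

lemma eval_variable [simp]: "eval (variable v) a = a v"
proof -
  have "a w ^ lookup (single v (Suc 0)) w = (if w = v then a v else 1)" for w
    by (simp add: lookup_single when_def)
  then show ?thesis by (simp add: variable_def eval_single)
qed

lemma eval_linear_form: "eval (linear_form x) a = pairing x a"
  by (simp add: linear_form_def eval_sum eval_mult pairing_def)

lemma eval_directional: "eval (directional e f) a = (\<Sum>v\<in>UNIV. e v * eval (partial_deriv v f) a)"
  by (simp add: directional_def eval_sum eval_mult)

lemma directional_add: "directional e (f + g) = directional e f + directional e g"
  by (simp add: directional_def partial_deriv_add distrib_left sum.distrib)

lemma directional_mult: "directional e (f * g) = directional e f * g + f * directional e g"
  by (simp add: directional_def partial_deriv_mult algebra_simps sum.distrib sum_distrib_left)

lemma directional_const [simp]: "directional e (const c) = 0"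
  by (simp add: directional_def partial_deriv_single)

lemma directional_linear_form [simp]: "directional e (linear_form x) = const (pairing x e)"
proof -
  have var: "partial_deriv v (variable w) = const (if v = w then 1 else 0 :: 'b)" for v w :: 'a
    by (auto simp: variable_def partial_deriv_single lookup_single when_def)
  have "partial_deriv v (linear_form x) = const (x v)" for v
  proof -
    have zero: "partial_deriv v (const c) = 0" for c :: 'b by (simp add: partial_deriv_single)
    have psum: "partial_deriv v (\<Sum>w\<in>A. h w) = (\<Sum>w\<in>A. partial_deriv v (h w))"
      for A :: "'a set" and h :: "'a \<Rightarrow> ('a, 'b) mpoly"
      by (induction A rule: infinite_finite_induct) (simp_all add: partial_deriv_add)
    have "partial_deriv v (linear_form x) = (\<Sum>w\<in>UNIV. const (if v = w then x w else 0))"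
      unfolding linear_form_def
      by (simp only: psum) (intro sum.cong refl, simp add: partial_deriv_mult zero var mult_single)
    also have "\<dots> = (\<Sum>w\<in>UNIV. if v = w then const (x v) else 0)"
      by (intro sum.cong) auto
    finally show ?thesis by simp
  qed
  then show ?thesis
    by (simp add: directional_def pairing_def mult_single mult.commute single_sum)
qed

section \<open>The Jacobian ideal of a smooth plane cubic\<close>

context algebra_ideal begin

text \<open>
  The forms of degree \<open>d\<close> in three given elements. Unlike degrees of polynomials in the original variables,
  this can be used for any triple of linear forms, so a change of coordinates needs no substitution.
\<close>

inductive generated :: "'r \<Rightarrow> 'r \<Rightarrow> 'r \<Rightarrow> nat \<Rightarrow> 'r \<Rightarrow> bool" for \<xi> \<eta> \<zeta> where
  zero: "generated \<xi> \<eta> \<zeta> d 0"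
| add: "generated \<xi> \<eta> \<zeta> d a \<Longrightarrow> generated \<xi> \<eta> \<zeta> d b \<Longrightarrow> generated \<xi> \<eta> \<zeta> d (a + b)"
| monomial: "i + j + k = d \<Longrightarrow> generated \<xi> \<eta> \<zeta> d (\<kappa> c * \<xi>^i * \<eta>^j * \<zeta>^k)"

lemma generated_monomial_mult:
  assumes "generated \<xi> \<eta> \<zeta> e b"
  shows "i + j + k = d \<Longrightarrow> generated \<xi> \<eta> \<zeta> (d + e) (\<kappa> c * \<xi>^i * \<eta>^j * \<zeta>^k * b)"
  using assms
proof induction
  case (monomial i' j' k' e c')
  then have "generated \<xi> \<eta> \<zeta> (d + e) (\<kappa> (c * c') * \<xi>^(i + i') * \<eta>^(j + j') * \<zeta>^(k + k'))"
    by (intro generated.monomial) linarith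
  then show ?case by (simp add: \<kappa>_mult power_add mult_ac)
qed (auto intro: generated.intros simp: distrib_left)

lemma generated_mult:
  assumes "generated \<xi> \<eta> \<zeta> d a" "generated \<xi> \<eta> \<zeta> e b"
  shows "generated \<xi> \<eta> \<zeta> (d + e) (a * b)"
  using assms by induction
    (auto intro: generated.intros generated_monomial_mult simp: distrib_right)

lemma generated_const: "generated \<xi> \<eta> \<zeta> 0 (\<kappa> c)"
  using generated.monomial[of 0 0 0 0 \<xi> \<eta> \<zeta> c] by simp

lemma generated_power: "generated \<xi> \<eta> \<zeta> d a \<Longrightarrow> generated \<xi> \<eta> \<zeta> (n * d) (a ^ n)"
proof (induction n)
  case 0
  show ?case using generated_const[of \<xi> \<eta> \<zeta> 1] by simp
qed (simp add: generated_mult)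

lemma generated_linear: "generated \<xi> \<eta> \<zeta> 1 (\<kappa> a * \<xi> + \<kappa> b * \<eta> + \<kappa> c * \<zeta>)"
  using generated.monomial[of 1 0 0 1 \<xi> \<eta> \<zeta> a] generated.monomial[of 0 1 0 1 \<xi> \<eta> \<zeta> b]
    generated.monomial[of 0 0 1 1 \<xi> \<eta> \<zeta> c]
  by (auto intro: generated.add)

lemma generated_sum:
  "(\<And>i. i \<in> I \<Longrightarrow> generated \<xi> \<eta> \<zeta> d (h i)) \<Longrightarrow> generated \<xi> \<eta> \<zeta> d (\<Sum>i\<in>I. h i)"
  by (induction I rule: infinite_finite_induct) (auto intro: generated.intros)

lemma generated_mem:
  assumes "generated \<xi> \<eta> \<zeta> d a" "\<And>i j k. i + j + k = d \<Longrightarrow> \<xi>^i * \<eta>^j * \<zeta>^k \<in> J"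
  shows "a \<in> J"
  using assms by induction (auto intro: add_mem mult_mem simp: mult.assoc)

lemma generated_cubic:
  assumes "generated \<xi> \<eta> \<zeta> 3 r"
  obtains c300 c210 c201 c120 c111 c102 c030 c021 c012 c003 where
    "r = \<kappa> c300 * \<xi>^3 + \<kappa> c210 * \<xi>^2 * \<eta> + \<kappa> c201 * \<xi>^2 * \<zeta> + \<kappa> c120 * \<xi> * \<eta>^2
       + \<kappa> c111 * \<xi> * \<eta> * \<zeta> + \<kappa> c102 * \<xi> * \<zeta>^2 + \<kappa> c030 * \<eta>^3 + \<kappa> c021 * \<eta>^2 * \<zeta>
       + \<kappa> c012 * \<eta> * \<zeta>^2 + \<kappa> c003 * \<zeta>^3"
proof -
  have "\<exists>c. r = (\<Sum>i\<le>3. \<Sum>j\<le>3 - i. \<kappa> (c i j) * \<xi>^i * \<eta>^j * \<zeta>^(3 - i - j))"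
    using assms
  proof (induction "3::nat" r)
    case zero
    show ?case by (intro exI[of _ "\<lambda>_ _. 0"]) simp
  next
    case (add a b)
    then obtain c c' where
      "a = (\<Sum>i\<le>3. \<Sum>j\<le>3 - i. \<kappa> (c i j) * \<xi>^i * \<eta>^j * \<zeta>^(3 - i - j))"
      "b = (\<Sum>i\<le>3. \<Sum>j\<le>3 - i. \<kappa> (c' i j) * \<xi>^i * \<eta>^j * \<zeta>^(3 - i - j))" by blast
    then show ?case
      by (intro exI[of _ "\<lambda>i j. c i j + c' i j"]) (simp add: \<kappa>_add distrib_right sum.distrib)
  next
    case (monomial i j k c)
    have "(\<Sum>i'\<le>3. \<Sum>j'\<le>3 - i'. \<kappa> (if i' = i then if j' = j then c else 0 else 0)
        * \<xi>^i' * \<eta>^j' * \<zeta>^(3 - i' - j'))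
      = (\<Sum>i'\<le>3. if i' = i then \<Sum>j'\<le>3 - i'. if j' = j then \<kappa> c * \<xi>^i * \<eta>^j * \<zeta>^k else 0 else 0)"
    proof (intro sum.cong refl)
      fix i' :: nat
      have k: "k = 3 - i - j" using monomial by simp
      show "(\<Sum>j'\<le>3 - i'. \<kappa> (if i' = i then if j' = j then c else 0 else 0)
        * \<xi>^i' * \<eta>^j' * \<zeta>^(3 - i' - j'))
        = (if i' = i then \<Sum>j'\<le>3 - i'. if j' = j then \<kappa> c * \<xi>^i * \<eta>^j * \<zeta>^k else 0 else 0)"
      proof (cases "i' = i")
        case True
        have "\<kappa> (if j' = j then c else 0) * \<xi>^i * \<eta>^j' * \<zeta>^(3 - i - j')
            = (if j' = j then \<kappa> c * \<xi>^i * \<eta>^j * \<zeta>^k else 0)" for j'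
          by (simp add: k)
        then show ?thesis by (simp only: True simp_thms if_True)
      qed simp
    qed
    also have "\<dots> = \<kappa> c * \<xi>^i * \<eta>^j * \<zeta>^k" using monomial by simp
    finally show ?case by (intro exI) (rule sym)
  qed
  then obtain c where c: "r = (\<Sum>i\<le>3. \<Sum>j\<le>3 - i. \<kappa> (c i j) * \<xi>^i * \<eta>^j * \<zeta>^(3 - i - j))" ..
  have s: "(\<Sum>n\<le>3. h n) = h 0 + h 1 + h 2 + h 3" "(\<Sum>n\<le>2. h n) = h 0 + h 1 + h 2"
    "(\<Sum>n\<le>1. h n) = h 0 + h 1" for h :: "nat \<Rightarrow> 'r"
    by (simp_all add: eval_nat_numeral)
  show thesis
    by (rule that[of "c 3 0" "c 2 1" "c 2 0" "c 1 2" "c 1 1" "c 1 0" "c 0 3" "c 0 2" "c 0 1" "c 0 0"])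
      (simp add: c s[unfolded One_nat_def] add_ac)
qed

end

text \<open>
  At a zero of \<open>f\<close> it says that the gradient is orthogonal to the point, that is, the tangent line passes
  through it.
\<close>

lemma euler_relation:
  fixes f :: "('v::finite, 'k::field) mpoly"
  assumes "homogeneous d f"
  shows "(\<Sum>v\<in>UNIV. variable v * partial_deriv v f) = of_nat d * f"
proof -
  have step: "variable v * single (m - single v 1) (of_nat (lookup m v) * c) = single m (of_nat (lookup m v) * c)"
    for v :: 'v and m and c :: 'k
  proof (cases "lookup m v = 0")
    case False
    then have "single v 1 + (m - single v 1) = m"
      by (intro poly_mapping_eqI) (auto simp: lookup_add lookup_minus lookup_single when_def)
    then show ?thesis by (simp add: variable_def mult_single)
  qed simp
  have "(\<Sum>v\<in>UNIV. variable v * partial_deriv v f)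
      = (\<Sum>v\<in>UNIV. \<Sum>m\<in>keys f. single m (of_nat (lookup m v) * lookup f m))"
    unfolding partial_deriv_def sum_distrib_left step ..
  also have "\<dots> = (\<Sum>m\<in>keys f. \<Sum>v\<in>UNIV. single m (of_nat (lookup m v) * lookup f m))"
    by (rule sum.swap)
  also have "\<dots> = (\<Sum>m\<in>keys f. single m (of_nat d * lookup f m))"
  proof (intro sum.cong refl)
    fix m assume "m \<in> keys f"
    then have "d = (\<Sum>v\<in>UNIV. lookup m v)" using assms by (simp add: homogeneous_def)
    then show "(\<Sum>v\<in>UNIV. single m (of_nat (lookup m v) * lookup f m)) = single m (of_nat d * lookup f m)"
      by (simp add: sum_distrib_right flip: single_sum)
  qed
  also have "\<dots> = (\<Sum>m\<in>keys f. const (of_nat d) * single m (lookup f m))"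
    by (simp add: mult_single del: single_of_nat)
  also have "\<dots> = of_nat d * f"
    by (simp flip: sum_distrib_left poly_mapping_sum_single)
  finally show ?thesis .
qed

lemma single_eq_variables:
  "single m c = const c * variable 0 ^ lookup m 0 * variable 1 ^ lookup m 1 * variable 2 ^ lookup m (2::3)"
proof -
  have m: "m = single 0 (lookup m 0) + single 1 (lookup m 1) + single 2 (lookup m 2)"
  proof (rule poly_mapping_eqI)
    have "\<forall>v. lookup m v = lookup (single 0 (lookup m 0) + single 1 (lookup m 1) + single 2 (lookup m 2)) v"
      unfolding all_three by (simp add: lookup_add lookup_single when_def)
    then show "lookup m v = lookup (single 0 (lookup m 0) + single 1 (lookup m 1) + single 2 (lookup m 2)) v"
      for v by blast
  qed
  have "const c * variable 0 ^ lookup m 0 * variable 1 ^ lookup m 1 * variable 2 ^ lookup m 2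
      = single (single 0 (lookup m 0) + single 1 (lookup m 1) + single 2 (lookup m 2)) c"
    by (simp add: variable_power mult_single)
  also have "\<dots> = single m c" by (simp only: m[symmetric])
  finally show ?thesis ..
qed

lemma variable_in_dual_basis:
  fixes e1 e2 e3 x1 x2 x3 :: "'v::finite \<Rightarrow> 'k::field"
  assumes "\<And>v w. e1 v * x1 w + e2 v * x2 w + e3 v * x3 w = (if v = w then 1 else 0)"
  shows "variable v = const (e1 v) * linear_form x1 + const (e2 v) * linear_form x2
    + const (e3 v) * linear_form x3"
proof -
  have "const (e1 v) * linear_form x1 + const (e2 v) * linear_form x2 + const (e3 v) * linear_form x3
      = (\<Sum>w\<in>UNIV. const (e1 v * x1 w + e2 v * x2 w + e3 v * x3 w) * variable w)"
  proof -
    have "const c * linear_form x = (\<Sum>w\<in>UNIV. const (c * x w) * variable w)" for c and x :: "'v \<Rightarrow> 'k"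
      unfolding linear_form_def sum_distrib_left
      by (intro sum.cong refl) (simp only: mult.assoc[symmetric] mult_single add_0_left)
    then show ?thesis by (simp add: single_add distrib_right sum.distrib)
  qed
  also have "\<dots> = (\<Sum>w\<in>UNIV. if v = w then variable v else 0)"
    unfolding assms by (intro sum.cong) auto
  finally show ?thesis by simp
qed

text \<open>
  Coordinates \<open>\<xi>, \<eta>, \<zeta>\<close> are chosen such that some zero \<open>P\<close> of \<open>f\<close> has coordinates \<open>(0, 0, 1)\<close> and \<open>\<xi>\<close> is the
  linear form given by the gradient at \<open>P\<close>. This fixes three coefficients of \<open>f\<close>, and replacing \<open>\<zeta>\<close> by \<open>Z\<close>
  completes the square. Derivatives along the dual basis are combinations of the partial derivatives, so
  they lie in the ideal \<open>J\<close>, and the two lemmas on normal forms apply.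
\<close>

lemma jacobian_ideal_contains_sextics:
  fixes f :: "(3, 'l::alg_closed_field) mpoly"
  assumes two: "(2::'l) \<noteq> 0" and f: "homogeneous 3 f"
    and smooth: "\<And>a. eval f a = 0 \<Longrightarrow> (\<And>v. eval (partial_deriv v f) a = 0) \<Longrightarrow> (\<And>v. a v = 0)"
    and m: "total_degree m = 6"
  shows "\<exists>a b. single m 1 = a * f + (\<Sum>v\<in>UNIV. b v * partial_deriv v f)"
proof -
  define J where "J = {a * f + (\<Sum>v\<in>UNIV. b v * partial_deriv v f) | a b. True}"
  have fJ: "f \<in> J" unfolding J_def by (force intro!: exI[of _ 1] exI[of _ "\<lambda>_. 0"])
  have addJ: "a + b \<in> J" if "a \<in> J" "b \<in> J" for a b
  proof -
    from that(1) obtain a1 a2 where a: "a = a1 * f + (\<Sum>v\<in>UNIV. a2 v * partial_deriv v f)"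
      by (auto simp: J_def)
    from that(2) obtain b1 b2 where "b = b1 * f + (\<Sum>v\<in>UNIV. b2 v * partial_deriv v f)"
      by (auto simp: J_def)
    with a have "a + b = (a1 + b1) * f + (\<Sum>v\<in>UNIV. (a2 v + b2 v) * partial_deriv v f)"
      by (simp add: algebra_simps sum.distrib)
    then show ?thesis unfolding J_def by (auto intro!: exI[of _ "\<lambda>v. a2 v + b2 v"])
  qed
  have multJ: "r * a \<in> J" if "a \<in> J" for r a
  proof -
    from that obtain a1 a2 where "a = a1 * f + (\<Sum>v\<in>UNIV. a2 v * partial_deriv v f)"
      by (auto simp: J_def)
    then have "r * a = (r * a1) * f + (\<Sum>v\<in>UNIV. (r * a2 v) * partial_deriv v f)"
      by (simp add: algebra_simps sum_distrib_left)
    then show ?thesis unfolding J_def by (auto intro!: exI[of _ "\<lambda>v. r * a2 v"])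
  qed
  interpret algebra_ideal J "const :: 'l \<Rightarrow> (3, 'l) mpoly"
    using multJ[OF fJ, of 0]
    by unfold_locales (auto simp: single_add mult_single intro: addJ multJ)
  have dirJ: "directional e f \<in> J" for e
    unfolding J_def directional_def
    by (auto intro!: exI[of _ 0] exI[of _ "\<lambda>v. const (e v)"])
  obtain P w where P: "P w \<noteq> 0" "eval f P = 0" using cubic_has_point[OF f] by blast
  define g where "g v = eval (partial_deriv v f) P" for v
  have "\<exists>v. g v \<noteq> 0" using smooth[of P w] P unfolding g_def by blast
  then obtain u where u: "g u \<noteq> 0" ..
  have gP: "pairing g P = 0"
  proof -
    have "pairing g P = eval (\<Sum>v\<in>UNIV. variable v * partial_deriv v f) P"
      by (simp add: pairing_def g_def eval_sum eval_mult mult.commute)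
    also have "\<dots> = 0" unfolding euler_relation[OF f] by (simp add: eval_mult P)
    finally show ?thesis .
  qed
  obtain e1 e2 x2 x3 where pair:
    "pairing g e1 = 1" "pairing g e2 = 0"
    "pairing x2 e1 = 0" "pairing x2 e2 = 1" "pairing x2 P = 0"
    "pairing x3 e1 = 0" "pairing x3 e2 = 0" "pairing x3 P = 1"
    and complete: "\<And>v w. e1 v * g w + e2 v * x2 w + P v * x3 w = (if v = w then 1 else 0)"
    using dual_bases_exist[OF u P(1) gP] by blast
  define \<xi> \<eta> \<zeta> where "\<xi> = linear_form g" and "\<eta> = linear_form x2" and "\<zeta> = linear_form x3"
  note basis = \<xi>_def \<eta>_def \<zeta>_def
  have var: "generated \<xi> \<eta> \<zeta> 1 (variable v)" for v
    unfolding variable_in_dual_basis[OF complete, of v] basis by (rule generated_linear)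
  have mono: "generated \<xi> \<eta> \<zeta> (total_degree n) (single n c)" for n c
  proof -
    have "generated \<xi> \<eta> \<zeta> (0 + lookup n 0 * 1 + lookup n 1 * 1 + lookup n 2 * 1) (single n c)"
      by (subst single_eq_variables)
        (intro generated_mult generated_const generated_power var)
    then show ?thesis by (simp add: total_degree_def sum_three)
  qed
  have "generated \<xi> \<eta> \<zeta> 3 (\<Sum>n\<in>keys f. single n (lookup f n))"
  proof (rule generated_sum)
    fix n assume "n \<in> keys f"
    then have "total_degree n = 3" using f by (simp add: homogeneous_iff)
    then show "generated \<xi> \<eta> \<zeta> 3 (single n (lookup f n))" using mono[of n] by simp
  qed
  then have "generated \<xi> \<eta> \<zeta> 3 f" by (simp flip: poly_mapping_sum_single)
  then obtain c300 c210 c201 c120 c111 c102 c030 c021 c012 c003 where expansion: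
    "f = const c300 * \<xi>^3 + const c210 * \<xi>^2 * \<eta> + const c201 * \<xi>^2 * \<zeta> + const c120 * \<xi> * \<eta>^2
       + const c111 * \<xi> * \<eta> * \<zeta> + const c102 * \<xi> * \<zeta>^2 + const c030 * \<eta>^3 + const c021 * \<eta>^2 * \<zeta>
       + const c012 * \<eta> * \<zeta>^2 + const c003 * \<zeta>^3"
    by (rule generated_cubic)
  have D: "directional e1 \<xi> = 1" "directional e1 \<eta> = 0" "directional e1 \<zeta> = 0"
    "directional e2 \<xi> = 0" "directional e2 \<eta> = 1" "directional e2 \<zeta> = 0"
    "directional P \<xi> = 0" "directional P \<eta> = 0" "directional P \<zeta> = 1"
    by (simp_all add: basis pair gP)
  have evP: "eval \<xi> P = 0" "eval \<eta> P = 0" "eval \<zeta> P = 1"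
    by (simp_all add: basis eval_linear_form pair gP)
  have eval_power: "eval (r ^ n) a = eval r a ^ n" for r :: "(3, 'l) mpoly" and n a
    using eval_const[of 1 a] by (induction n) (simp_all add: eval_mult)
  have dir_power: "directional e (r ^ 2) = 2 * r * directional e r"
    "directional e (r ^ 3) = 3 * r^2 * directional e r" for e r
    by (simp_all add: power2_eq_square power3_eq_cube directional_mult algebra_simps)
  have dirP: "eval (directional e f) P = pairing g e" for e
    by (simp add: eval_directional g_def pairing_def mult.commute)
  have eval_num: "eval (numeral n) a = numeral n" for n and a :: "3 \<Rightarrow> 'l"
    using eval_const[of "numeral n" a] by simp
  have eval_1: "eval 1 a = 1" for a :: "3 \<Rightarrow> 'l"
    using eval_const[of 1 a] by simp
  note ev = eval_add eval_mult eval_power eval_num eval_1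
  note dir = directional_add directional_mult dir_power D
  \<comment> \<open>Value and gradient of \<open>f\<close> at \<open>P\<close> determine the coefficients of \<open>\<zeta>\<^sup>3\<close>, \<open>\<xi> \<zeta>\<^sup>2\<close> and \<open>\<eta> \<zeta>\<^sup>2\<close>.\<close>
  have c003: "c003 = 0" using P(2) by (simp add: expansion ev evP)
  have "eval (directional e1 f) P = c102"
    unfolding expansion by (simp add: dir ev evP)
  then have c102: "c102 = 1" by (simp add: dirP pair)
  have "eval (directional e2 f) P = c012"
    unfolding expansion by (simp add: dir ev evP)
  then have c012: "c012 = 0" by (simp add: dirP pair)
  \<comment> \<open>The coefficient of \<open>\<zeta>\<close> in \<open>f\<close> is \<open>2 \<xi> (\<alpha> \<xi> + \<beta> \<eta>) + c021 \<eta>\<^sup>2\<close>, so adding \<open>\<alpha> \<xi> + \<beta> \<eta>\<close> to \<open>\<zeta>\<close> completes the square.\<close>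
  define \<alpha> \<beta> where "\<alpha> = c201 / 2" and "\<beta> = c111 / 2"
  have \<alpha>\<beta>: "c201 = 2 * \<alpha>" "c111 = 2 * \<beta>" using two by (simp_all add: \<alpha>_def \<beta>_def)
  define b k0 k1 k2 k3 where "b = c021" and "k0 = c300 - \<alpha>^2" and "k1 = c210 - 2 * \<alpha> * \<beta>"
    and "k2 = c120 - \<beta>^2 - b * \<alpha>" and "k3 = c030 - b * \<beta>"
  define Z where "Z = \<zeta> + const \<alpha> * \<xi> + const \<beta> * \<eta>"
  have \<zeta>: "\<zeta> = Z - const \<alpha> * \<xi> - const \<beta> * \<eta>" by (simp add: Z_def)
  have const2: "const (x ^ 2) = (const x ^ 2 :: (3, 'l) mpoly)" for x :: 'l by (rule \<kappa>_power)
  have const_diff: "const (x - y) = (const x - const y :: (3, 'l) mpoly)" for x y :: 'l by (rule single_diff)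
  have F: "f = \<xi> * Z^2 + const b * \<eta>^2 * Z + const k0 * \<xi>^3 + const k1 * \<xi>^2 * \<eta> + const k2 * \<xi> * \<eta>^2
      + const k3 * \<eta>^3"
    unfolding expansion \<zeta> c003 c102 c012 \<alpha>\<beta> k0_def k1_def k2_def k3_def b_def
    by (simp add: const_diff const2 single_add \<kappa>_mult algebra_simps power2_eq_square power3_eq_cube)
  have DZ: "directional e1 Z = const \<alpha>" "directional e2 Z = const \<beta>" "directional P Z = 1"
    by (simp_all add: Z_def dir)
  have FZ: "directional P f = 2 * \<xi> * Z + const b * \<eta>^2"
    unfolding F by (simp add: dir DZ algebra_simps)
  have FX: "directional e1 f - const \<alpha> * directional P f
      = Z^2 + 3 * const k0 * \<xi>^2 + 2 * const k1 * \<xi> * \<eta> + const k2 * \<eta>^2"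
    unfolding F by (simp add: dir DZ algebra_simps)
  have FY: "directional e2 f - const \<beta> * directional P f
      = 2 * const b * \<eta> * Z + const k1 * \<xi>^2 + 2 * const k2 * \<xi> * \<eta> + 3 * const k3 * \<eta>^2"
    unfolding F by (simp add: dir DZ algebra_simps)
  have nonsing: "x = 0 \<and> y = 0 \<and> z = 0"
    if z: "x * z^2 + b * y^2 * z + k0 * x^3 + k1 * x^2 * y + k2 * x * y^2 + k3 * y^3 = 0"
      "z^2 + 3 * k0 * x^2 + 2 * k1 * x * y + k2 * y^2 = 0"
      "2 * b * y * z + k1 * x^2 + 2 * k2 * x * y + 3 * k3 * y^2 = 0"
      "2 * x * z + b * y^2 = 0" for x y z
  proof -
    \<comment> \<open>The point with coordinates \<open>x, y, z\<close> with respect to \<open>\<xi>, \<eta>, Z\<close>.\<close>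
    define a where "a v = x * e1 v + y * e2 v + (z - \<alpha> * x - \<beta> * y) * P v" for v
    have pa: "pairing h a = x * pairing h e1 + y * pairing h e2 + (z - \<alpha> * x - \<beta> * y) * pairing h P" for h
      by (simp add: a_def pairing_def sum.distrib sum_distrib_left algebra_simps sum_subtractf)
    have eva: "eval \<xi> a = x" "eval \<eta> a = y" "eval \<zeta> a = z - \<alpha> * x - \<beta> * y"
      by (simp_all add: basis eval_linear_form pa pair gP)
    then have evZ: "eval Z a = z" by (simp add: Z_def ev)
    have "eval f a = 0" unfolding F using z(1) by (simp add: ev eva evZ)
    have P0: "eval (directional P f) a = 0" unfolding FZ using z(4) by (simp add: ev eva evZ)
    have "directional e1 f = (Z^2 + 3 * const k0 * \<xi>^2 + 2 * const k1 * \<xi> * \<eta> + const k2 * \<eta>^2)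
      + const \<alpha> * directional P f" by (simp flip: FX)
    then have e10: "eval (directional e1 f) a = 0" using z(2) by (simp add: ev eva evZ P0)
    have "directional e2 f = (2 * const b * \<eta> * Z + const k1 * \<xi>^2 + 2 * const k2 * \<xi> * \<eta>
      + 3 * const k3 * \<eta>^2) + const \<beta> * directional P f" by (simp flip: FY)
    then have e20: "eval (directional e2 f) a = 0" using z(3) by (simp add: ev eva evZ P0)
    have "eval (partial_deriv v f) a = 0" for v
    proof -
      have "eval (partial_deriv v f) a = (\<Sum>w\<in>UNIV. if w = v then eval (partial_deriv w f) a else 0)"
        by simp
      also have "\<dots> = (\<Sum>w\<in>UNIV. (e1 w * g v + e2 w * x2 v + P w * x3 v) * eval (partial_deriv w f) a)"
        unfolding complete by (intro sum.cong) auto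
      also have "\<dots> = g v * eval (directional e1 f) a + x2 v * eval (directional e2 f) a
          + x3 v * eval (directional P f) a"
        by (simp add: eval_directional sum_distrib_left distrib_left sum.distrib mult_ac)
      finally show ?thesis by (simp add: P0 e10 e20)
    qed
    then have a0: "a v = 0" for v using smooth[OF \<open>eval f a = 0\<close>] by blast
    have "pairing h a = 0" for h by (simp add: pairing_def a0)
    with eva show ?thesis by (simp add: basis eval_linear_form)
  qed
  have memF: "\<xi> * Z^2 + const b * \<eta>^2 * Z + const k0 * \<xi>^3 + const k1 * \<xi>^2 * \<eta> + const k2 * \<xi> * \<eta>^2
      + const k3 * \<eta>^3 \<in> J" using fJ by (simp flip: F)
  have memX: "Z^2 + 3 * const k0 * \<xi>^2 + 2 * const k1 * \<xi> * \<eta> + const k2 * \<eta>^2 \<in> J"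
    unfolding FX[symmetric] by (intro diff_mem mult_mem dirJ)
  have memY: "2 * const b * \<eta> * Z + const k1 * \<xi>^2 + 2 * const k2 * \<xi> * \<eta> + 3 * const k3 * \<eta>^2 \<in> J"
    unfolding FY[symmetric] by (intro diff_mem mult_mem dirJ)
  have memZ: "2 * \<xi> * Z + const b * \<eta>^2 \<in> J" unfolding FZ[symmetric] by (rule dirJ)
  have monomials: "\<xi>^i * \<eta>^j * Z^k \<in> J" if "i + j + k = 6" for i j k
  proof (cases "b = 0")
    case False
    show ?thesis
      by (rule monomials_mem_nondegenerate[OF two False memF memX memY memZ _ that]) (rule nonsing)
  next
    case True
    show ?thesis
    proof (rule monomials_mem_flex[OF two _ memX _ _ _ that])
      show "\<xi> * Z^2 + const k0 * \<xi>^3 + const k1 * \<xi>^2 * \<eta> + const k2 * \<xi> * \<eta>^2 + const k3 * \<eta>^3 \<in> J"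
        using memF by (simp add: True)
      show "const k1 * \<xi>^2 + 2 * const k2 * \<xi> * \<eta> + 3 * const k3 * \<eta>^2 \<in> J"
        using memY by (simp add: True)
      show "2 * \<xi> * Z \<in> J" using memZ by (simp add: True)
      show "x = 0 \<and> y = 0 \<and> z = 0"
        if "x * z^2 + k0 * x^3 + k1 * x^2 * y + k2 * x * y^2 + k3 * y^3 = 0"
          "z^2 + 3 * k0 * x^2 + 2 * k1 * x * y + k2 * y^2 = 0"
          "k1 * x^2 + 2 * k2 * x * y + 3 * k3 * y^2 = 0"
          "2 * x * z = 0" for x y z
        by (rule nonsing) (simp_all only: True that mult_zero_left mult_zero_right add_0_left add_0_right)
    qed
  qed
  have gen: "generated \<xi> \<eta> Z 1 (variable v)" for v
  proof -
    have "variable v = const (e1 v - P v * \<alpha>) * \<xi> + const (e2 v - P v * \<beta>) * \<eta> + const (P v) * Z"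
      unfolding variable_in_dual_basis[OF complete, of v] basis[symmetric]
      by (simp add: Z_def const_diff \<kappa>_mult algebra_simps)
    then show ?thesis by (simp only: generated_linear)
  qed
  have "generated \<xi> \<eta> Z (0 + lookup m 0 * 1 + lookup m 1 * 1 + lookup m 2 * 1) (single m 1)"
    by (subst single_eq_variables)
      (intro generated_mult generated_const generated_power gen)
  then have "generated \<xi> \<eta> Z 6 (single m 1)" using m by (simp add: total_degree_def sum_three)
  then have "single m 1 \<in> J" using monomials by (rule generated_mem)
  then show ?thesis unfolding J_def by blast
qed

section \<open>Laurent polynomials\<close>

lemma to_laurent_eq_extend:
  "to_laurent f = extend (\<lambda>m c. single (Poly_Mapping.map int m) c) f"
  by (simp add: to_laurent_def extend_def)

lemma map_int_add: "Poly_Mapping.map int (m + n) = Poly_Mapping.map int m + Poly_Mapping.map int n"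
  by (rule poly_mapping_eqI) (simp add: lookup_add Poly_Mapping.map.rep_eq when_def)

lemma lookup_map_int [simp]: "lookup (Poly_Mapping.map int m) v = int (lookup m v)"
  by (simp add: Poly_Mapping.map.rep_eq when_def)

lemma to_laurent_power: "to_laurent (f ^ n) = to_laurent f ^ n"
proof -
  have "Poly_Mapping.map int 0 = (0 :: 'a \<Rightarrow>\<^sub>0 int)" by (rule poly_mapping_eqI) simp
  then show ?thesis unfolding to_laurent_eq_extend
    by (intro extend_power) (auto simp: single_add mult_single map_int_add)
qed

lemma lookup_to_laurent:
  fixes f :: "('v, 'k::field) mpoly"
  shows "lookup (to_laurent f) (Poly_Mapping.map int m) = lookup f m"
proof -
  have inj: "n = m" if "Poly_Mapping.map int n = Poly_Mapping.map int m" for n :: "'v \<Rightarrow>\<^sub>0 nat"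
  proof (rule poly_mapping_eqI)
    fix v
    have "lookup (Poly_Mapping.map int n) v = lookup (Poly_Mapping.map int m) v" by (simp only: that)
    then show "lookup n v = lookup m v" by simp
  qed
  have "lookup (to_laurent f) (Poly_Mapping.map int m) = (\<Sum>n\<in>keys f. if n = m then lookup f m else 0)"
    unfolding to_laurent_def lookup_sum
    by (intro sum.cong) (auto simp: lookup_single when_def dest: inj)
  then show ?thesis by (simp add: in_keys_iff)
qed

lemma keys_to_laurent: "keys (to_laurent f) \<subseteq> Poly_Mapping.map int ` keys f"
  unfolding to_laurent_def by (rule order_trans[OF keys_sum]) auto

definition laurent_degree :: "int \<Rightarrow> ('v::finite, 'k::field) laurent set" where
  "laurent_degree d = {g. \<forall>m\<in>keys g. total_degree m = d}"

lemma degree_zero_eq: "degree_zero = laurent_degree 0"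
  by (simp add: degree_zero_def laurent_degree_def total_degree_def)

lemma laurent_degree_add: "g \<in> laurent_degree d \<Longrightarrow> h \<in> laurent_degree d \<Longrightarrow> g + h \<in> laurent_degree d"
  using keys_add[of g h] by (auto simp: laurent_degree_def)

lemma laurent_degree_uminus: "g \<in> laurent_degree d \<Longrightarrow> - g \<in> laurent_degree d"
  by (simp add: laurent_degree_def in_keys_iff)

lemma laurent_degree_mult:
  "g \<in> laurent_degree d \<Longrightarrow> h \<in> laurent_degree e \<Longrightarrow> g * h \<in> laurent_degree (d + e)"
  using keys_mult[of g h] by (fastforce simp: laurent_degree_def)

lemma laurent_degree_0 [simp]: "0 \<in> laurent_degree d"
  by (simp add: laurent_degree_def)

lemma laurent_degree_1: "1 \<in> laurent_degree 0"
  by (simp add: laurent_degree_def total_degree_def)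

lemma laurent_degree_power: "g \<in> laurent_degree d \<Longrightarrow> g ^ n \<in> laurent_degree (int n * d)"
proof (induction n)
  case (Suc n)
  then show ?case using laurent_degree_mult[of g d "g ^ n" "int n * d"] by (simp add: algebra_simps)
qed (simp add: laurent_degree_1)

lemma to_laurent_degree:
  assumes "homogeneous d f"
  shows "to_laurent f \<in> laurent_degree (int d)"
  unfolding laurent_degree_def
proof (intro CollectI ballI)
  fix m assume "m \<in> keys (to_laurent f)"
  then obtain n where "m = Poly_Mapping.map int n" "n \<in> keys f" using keys_to_laurent[of f] by blast
  then show "total_degree m = int d"
    using assms by (simp add: total_degree_def homogeneous_def flip: of_nat_sum)
qed

lemma localisation_mono: "I \<subseteq> J \<Longrightarrow> localisation I \<subseteq> localisation J"
  by (auto simp: localisation_def)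

lemma localisation_add: "g \<in> localisation I \<Longrightarrow> h \<in> localisation I \<Longrightarrow> g + h \<in> localisation I"
  using keys_add[of g h] by (auto simp: localisation_def)

lemma localisation_uminus: "g \<in> localisation I \<Longrightarrow> - g \<in> localisation I"
  by (simp add: localisation_def in_keys_iff)

lemma localisation_mult:
  assumes "g \<in> localisation I" "h \<in> localisation I"
  shows "g * h \<in> localisation I"
  unfolding localisation_def
proof (intro CollectI ballI allI impI)
  fix m v assume "m \<in> keys (g * h)" "v \<notin> I"
  then obtain a b where "m = a + b" "a \<in> keys g" "b \<in> keys h" using keys_mult[of g h] by blast
  then show "0 \<le> lookup m v" using assms \<open>v \<notin> I\<close> by (simp add: localisation_def lookup_add)
qed

lemma localisation_0 [simp]: "0 \<in> localisation I" by (simp add: localisation_def)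

lemma localisation_1: "1 \<in> localisation I" by (simp add: localisation_def)

lemma localisation_power: "g \<in> localisation I \<Longrightarrow> g ^ n \<in> localisation I"
  by (induction n) (auto intro: localisation_mult localisation_1)

lemma localisation_to_laurent: "to_laurent f \<in> localisation I"
  using keys_to_laurent[of f] by (fastforce simp: localisation_def)

definition part :: "'m set \<Rightarrow> ('m \<Rightarrow>\<^sub>0 'a::comm_ring_1) \<Rightarrow> ('m \<Rightarrow>\<^sub>0 'a)" where
  "part S g = (\<Sum>m\<in>keys g \<inter> S. single m (lookup g m))"

lemma lookup_part: "lookup (part S g) m = (if m \<in> S then lookup g m else 0)"
proof -
  have "lookup (part S g) m = (\<Sum>n\<in>keys g \<inter> S. if n = m then lookup g m else 0)"
    unfolding part_def lookup_sum by (intro sum.cong) (auto simp: lookup_single when_def)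
  then show ?thesis by (simp add: in_keys_iff)
qed

lemma keys_part: "keys (part S g) = keys g \<inter> S"
  by (auto simp: in_keys_iff lookup_part split: if_splits)

lemma part_laurent_degree: "g \<in> laurent_degree d \<Longrightarrow> part S g \<in> laurent_degree d"
  by (auto simp: laurent_degree_def keys_part)

lemma part_localisation: "g \<in> localisation I \<Longrightarrow> part S g \<in> localisation I"
  by (auto simp: localisation_def keys_part)

section \<open>Sections as residue classes\<close>

text \<open>
  The ring of the open set where the variables in \<open>I\<close> are invertible, in the plane and before passing to
  the curve.
\<close>

definition chart_ring :: "'v::finite set \<Rightarrow> ('v, 'k::field) laurent set" where
  "chart_ring I = localisation I \<inter> laurent_degree 0"

lemma affine_ring_simps [simp]:
  "carrier (affine_ring I) = chart_ring I" "monoid.mult (affine_ring I) = (*)"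
  "\<one>\<^bsub>affine_ring I\<^esub> = 1" "\<zero>\<^bsub>affine_ring I\<^esub> = 0" "add (affine_ring I) = (+)"
  by (simp_all add: affine_ring_def chart_ring_def degree_zero_eq)

lemma chart_ring_intros:
  "0 \<in> chart_ring I" "1 \<in> chart_ring I" "a \<in> chart_ring I \<Longrightarrow> b \<in> chart_ring I \<Longrightarrow> a + b \<in> chart_ring I"
  "a \<in> chart_ring I \<Longrightarrow> - a \<in> chart_ring I" "a \<in> chart_ring I \<Longrightarrow> b \<in> chart_ring I \<Longrightarrow> a * b \<in> chart_ring I"
  "a \<in> chart_ring I \<Longrightarrow> b \<in> chart_ring I \<Longrightarrow> a - b \<in> chart_ring I"
proof -
  show add: "a \<in> chart_ring I \<Longrightarrow> b \<in> chart_ring I \<Longrightarrow> a + b \<in> chart_ring I" for a b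
    by (simp add: chart_ring_def localisation_add laurent_degree_add)
  show um: "a \<in> chart_ring I \<Longrightarrow> - a \<in> chart_ring I" for a
    by (simp add: chart_ring_def localisation_uminus laurent_degree_uminus)
  show "a \<in> chart_ring I \<Longrightarrow> b \<in> chart_ring I \<Longrightarrow> a * b \<in> chart_ring I"
    using laurent_degree_mult[of a 0 b 0] by (simp add: chart_ring_def localisation_mult)
  show "a \<in> chart_ring I \<Longrightarrow> b \<in> chart_ring I \<Longrightarrow> a - b \<in> chart_ring I"
    using add[of a "- b"] um[of b] by simp
qed (simp_all add: chart_ring_def localisation_1 laurent_degree_1)

lemma chart_ring_power: "a \<in> chart_ring I \<Longrightarrow> a ^ n \<in> chart_ring I"
  by (induction n) (auto intro: chart_ring_intros)

lemma chart_ring_mono: "I \<subseteq> J \<Longrightarrow> chart_ring I \<subseteq> chart_ring J"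
  unfolding chart_ring_def using localisation_mono by blast

lemma cring_affine_ring: "cring (affine_ring I :: ('v::finite, 'k::field) laurent ring)"
proof (intro cringI abelian_groupI comm_monoidI)
  fix x :: "('v, 'k) laurent" assume "x \<in> carrier (affine_ring I)"
  then show "\<exists>y\<in>carrier (affine_ring I). y \<oplus>\<^bsub>affine_ring I\<^esub> x = \<zero>\<^bsub>affine_ring I\<^esub>"
    by (intro bexI[of _ "- x"]) (auto intro: chart_ring_intros)
qed (simp_all add: chart_ring_intros algebra_simps)

lemma affine_ideal_subset: "affine_ideal f I \<subseteq> chart_ring I"
  by (auto simp: affine_ideal_def chart_ring_def degree_zero_eq
      intro: localisation_mult localisation_to_laurent)

lemma affine_ideal_add:
  assumes "a \<in> affine_ideal f I" "b \<in> affine_ideal f I"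
  shows "a + b \<in> affine_ideal f I"
proof -
  obtain g h where g: "a = to_laurent f * g" "g \<in> localisation I" and h: "b = to_laurent f * h" "h \<in> localisation I"
    using assms by (auto simp: affine_ideal_def)
  then have "a + b = to_laurent f * (g + h)" by (simp add: distrib_left)
  then have "\<exists>k. a + b = to_laurent f * k \<and> k \<in> localisation I" using localisation_add[OF g(2) h(2)] by blast
  then show ?thesis using assms unfolding affine_ideal_def degree_zero_eq by (auto intro: laurent_degree_add)
qed

lemma affine_ideal_mult:
  assumes "a \<in> affine_ideal f I" "b \<in> chart_ring I"
  shows "b * a \<in> affine_ideal f I"
proof -
  obtain g where g: "a = to_laurent f * g" "g \<in> localisation I"
    using assms by (auto simp: affine_ideal_def)
  then have "b * a = to_laurent f * (b * g)" by simp
  moreover have "b * g \<in> localisation I" using assms(2) g(2) by (auto simp: chart_ring_def intro: localisation_mult)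
  ultimately have "\<exists>k. b * a = to_laurent f * k \<and> k \<in> localisation I" by blast
  moreover have "b * a \<in> chart_ring I" using assms affine_ideal_subset by (blast intro: chart_ring_intros)
  ultimately show ?thesis unfolding affine_ideal_def degree_zero_eq chart_ring_def by blast
qed

lemma affine_ideal_uminus: "a \<in> affine_ideal f I \<Longrightarrow> - a \<in> affine_ideal f I"
  using affine_ideal_mult[of a f I "- 1"] by (simp add: chart_ring_intros)

lemma affine_ideal_diff: "a \<in> affine_ideal f I \<Longrightarrow> b \<in> affine_ideal f I \<Longrightarrow> a - b \<in> affine_ideal f I"
  using affine_ideal_add[of a f I "- b"] affine_ideal_uminus[of b f I] by simp

lemma affine_ideal_0: "0 \<in> affine_ideal f I"
  by (auto simp: affine_ideal_def degree_zero_eq intro!: exI[of _ 0])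

lemma affine_ideal_power: "a \<in> affine_ideal f I \<Longrightarrow> n > 0 \<Longrightarrow> a ^ n \<in> affine_ideal f I"
  using affine_ideal_mult[of a f I "a ^ (n - 1)"] affine_ideal_subset[of f I]
  by (cases n) (auto simp: mult.commute intro: chart_ring_power)

lemma affine_ideal_mono: "I \<subseteq> J \<Longrightarrow> affine_ideal f I \<subseteq> affine_ideal f J"
  using localisation_mono[of I J] by (auto simp: affine_ideal_def)

text \<open>
  As \<open>f\<close> is homogeneous, the cofactor of an element of degree 0 can be replaced by its component of
  degree \<open>-d\<close>: the other components contribute only terms of nonzero degree, whose sum must vanish.
\<close>

lemma affine_ideal_iff:
  assumes f: "homogeneous d f"
  shows "x \<in> affine_ideal f I \<longleftrightarrow> (\<exists>g\<in>localisation I \<inter> laurent_degree (- int d). x = to_laurent f * g)"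
proof
  assume "x \<in> affine_ideal f I"
  then obtain g where g: "x = to_laurent f * g" "g \<in> localisation I" "x \<in> laurent_degree 0"
    by (auto simp: affine_ideal_def degree_zero_eq)
  define S where "S = {m :: 'a \<Rightarrow>\<^sub>0 int. total_degree m = - int d}"
  have F: "to_laurent f \<in> laurent_degree (int d)" by (rule to_laurent_degree[OF f])
  have S: "part S g \<in> laurent_degree (- int d)" by (simp add: laurent_degree_def keys_part S_def)
  have split: "g = part S g + part (- S) g"
    by (rule poly_mapping_eqI) (simp add: lookup_add lookup_part)
  have "to_laurent f * part S g \<in> laurent_degree 0" using laurent_degree_mult[OF F S] by simp
  moreover have "to_laurent f * part (- S) g = x + - (to_laurent f * part S g)"
    unfolding g(1) by (subst (2) split) (simp add: distrib_left)
  ultimately have deg: "to_laurent f * part (- S) g \<in> laurent_degree 0"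
    using g(3) by (simp only: laurent_degree_add laurent_degree_uminus)
  have "to_laurent f * part (- S) g = 0"
  proof (rule ccontr)
    assume "to_laurent f * part (- S) g \<noteq> 0"
    then obtain m where m: "m \<in> keys (to_laurent f * part (- S) g)"
      by (metis keys_eq_empty ex_in_conv)
    then obtain a b where "m = a + b" "a \<in> keys (to_laurent f)" "b \<in> keys (part (- S) g)"
      using keys_mult[of "to_laurent f" "part (- S) g"] by blast
    moreover have "total_degree m = 0" using deg m by (simp add: laurent_degree_def)
    ultimately show False using F by (auto simp: laurent_degree_def keys_part S_def)
  qed
  then have "x = to_laurent f * part S g" unfolding g(1) by (subst split) (simp add: distrib_left)
  then show "\<exists>g\<in>localisation I \<inter> laurent_degree (- int d). x = to_laurent f * g"
    using S part_localisation[OF g(2)] by blast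
next
  assume "\<exists>g\<in>localisation I \<inter> laurent_degree (- int d). x = to_laurent f * g"
  then show "x \<in> affine_ideal f I"
    using laurent_degree_mult[OF to_laurent_degree[OF f], of _ "- int d"]
    by (auto simp: affine_ideal_def degree_zero_eq)
qed

lemma ideal_affine_ideal: "ideal (affine_ideal f I) (affine_ring I)"
proof (rule idealI)
  interpret cring "affine_ring I" by (rule cring_affine_ring)
  show "ring (affine_ring I)" by (rule ring_axioms)
  have inv: "inv\<^bsub>add_monoid (affine_ring I)\<^esub> a \<in> affine_ideal f I" if "a \<in> affine_ideal f I" for a
  proof -
    have "a \<in> chart_ring I" using that affine_ideal_subset by blast
    then have "\<ominus>\<^bsub>affine_ring I\<^esub> a = - a"
      by (intro minus_equality) (simp_all add: chart_ring_intros)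
    then show ?thesis using affine_ideal_uminus[OF that] by (simp only: a_inv_def)
  qed
  show "subgroup (affine_ideal f I) (add_monoid (affine_ring I))"
  proof (rule subgroup.intro)
    show "affine_ideal f I \<subseteq> carrier (add_monoid (affine_ring I))"
      using affine_ideal_subset by simp
    show "inv\<^bsub>add_monoid (affine_ring I)\<^esub> a \<in> affine_ideal f I" if "a \<in> affine_ideal f I" for a
      by (rule inv[OF that])
  qed (simp_all add: affine_ideal_0 affine_ideal_add)
  show "x \<otimes>\<^bsub>affine_ring I\<^esub> a \<in> affine_ideal f I" "a \<otimes>\<^bsub>affine_ring I\<^esub> x \<in> affine_ideal f I"
    if "a \<in> affine_ideal f I" "x \<in> carrier (affine_ring I)" for a x
    using affine_ideal_mult[OF that(1), of x] that(2) by (simp_all add: mult.commute)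
qed

definition residue :: "('v::finite, 'k::field) mpoly \<Rightarrow> 'v set \<Rightarrow> ('v, 'k) laurent \<Rightarrow> ('v, 'k) laurent set" where
  "residue f I a = affine_ideal f I +>\<^bsub>affine_ring I\<^esub> a"

lemma residue_ring_hom: "ring_hom_ring (affine_ring I) (sections f I) (residue f I)"
proof -
  interpret ideal "affine_ideal f I" "affine_ring I" by (rule ideal_affine_ideal)
  have "residue f I = (+>\<^bsub>affine_ring I\<^esub>) (affine_ideal f I)" by (simp add: residue_def fun_eq_iff)
  then show ?thesis unfolding sections_def using rcos_ring_hom_ring by simp
qed

lemma affine_ring_minus: "a \<in> chart_ring I \<Longrightarrow> b \<in> chart_ring I \<Longrightarrow> a \<ominus>\<^bsub>affine_ring I\<^esub> b = a - b"
proof -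
  assume ab: "a \<in> chart_ring I" "b \<in> chart_ring I"
  interpret cring "affine_ring I" by (rule cring_affine_ring)
  have "\<ominus>\<^bsub>affine_ring I\<^esub> b = - b"
    by (intro minus_equality) (simp_all add: chart_ring_intros ab)
  then show ?thesis by (simp add: a_minus_def)
qed

lemma residue_eq_iff:
  assumes "a \<in> chart_ring I" "b \<in> chart_ring I"
  shows "residue f I a = residue f I b \<longleftrightarrow> a - b \<in> affine_ideal f I"
proof -
  interpret cring "affine_ring I" by (rule cring_affine_ring)
  show ?thesis
    using quotient_eq_iff_same_a_r_cos[OF ideal_affine_ideal, of a b f] assms
    by (simp add: residue_def affine_ring_minus)
qed

lemma carrier_sections: "carrier (sections f I) = residue f I ` chart_ring I"
  by (auto simp: sections_def FactRing_def A_RCOSETS_def' residue_def)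

lemma residue_add:
  assumes "a \<in> chart_ring I" "b \<in> chart_ring I"
  shows "residue f I a \<oplus>\<^bsub>sections f I\<^esub> residue f I b = residue f I (a + b)"
proof -
  interpret ring_hom_ring "affine_ring I" "sections f I" "residue f I" by (rule residue_ring_hom)
  show ?thesis using hom_add[of a b] assms by simp
qed

lemma residue_0: "\<zero>\<^bsub>sections f I\<^esub> = residue f I 0"
proof -
  interpret ring_hom_ring "affine_ring I" "sections f I" "residue f I" by (rule residue_ring_hom)
  show ?thesis using hom_zero by simp
qed

lemma residue_minus:
  assumes "a \<in> chart_ring I" "b \<in> chart_ring I"
  shows "residue f I a \<ominus>\<^bsub>sections f I\<^esub> residue f I b = residue f I (a - b)"
proof -
  interpret ring_hom_ring "affine_ring I" "sections f I" "residue f I" by (rule residue_ring_hom)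
  have b: "- b \<in> chart_ring I" using assms by (intro chart_ring_intros)
  have "residue f I (- b) = \<ominus>\<^bsub>sections f I\<^esub> residue f I b"
  proof (rule S.minus_equality[symmetric])
    show "residue f I (- b) \<oplus>\<^bsub>sections f I\<^esub> residue f I b = \<zero>\<^bsub>sections f I\<^esub>"
      using residue_add[OF b assms(2)] by (simp add: residue_0)
  qed (use assms b hom_closed in \<open>auto simp: carrier_sections\<close>)
  then show ?thesis using residue_add[OF assms(1) b, of f] by (simp add: a_minus_def)
qed

lemma residue_power:
  assumes "a \<in> chart_ring I"
  shows "residue f I a [^]\<^bsub>sections f I\<^esub> (n::nat) = residue f I (a ^ n)"
proof -
  interpret ring_hom_ring "affine_ring I" "sections f I" "residue f I" by (rule residue_ring_hom)
  have "a [^]\<^bsub>affine_ring I\<^esub> n = a ^ n"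
    by (induction n) (simp_all add: mult.commute)
  then show ?thesis using hom_nat_pow[of a n] assms by simp
qed

text \<open>
  All representatives of a class restrict to one class because the ideals grow with the set of inverted
  variables.
\<close>

lemma restr_residue:
  assumes "I \<subseteq> J" "a \<in> chart_ring I"
  shows "restr f J (residue f I a) = residue f J a"
proof -
  have "residue f J b = residue f J a" if "b \<in> residue f I a" for b
  proof -
    from that obtain i where i: "i \<in> affine_ideal f I" "b = i + a"
      by (auto simp: residue_def a_r_coset_def')
    have "i \<in> affine_ideal f J" "a \<in> chart_ring J" "i \<in> chart_ring J"
      using i(1) affine_ideal_mono[OF assms(1)] chart_ring_mono[OF assms(1)] assms(2) affine_ideal_subset by blast+
    then show ?thesis by (simp add: residue_eq_iff i(2) chart_ring_intros)
  qed
  moreover have "a \<in> residue f I a"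
    using affine_ideal_0[of f I] by (force simp: residue_def a_r_coset_def')
  ultimately show ?thesis unfolding restr_def residue_def[symmetric] by blast
qed

section \<open>Cochains and their representatives\<close>

definition cochain1 :: "('v::finite, 'k::field) mpoly \<Rightarrow> ('v \<Rightarrow> 'v \<Rightarrow> ('v, 'k) laurent)
    \<Rightarrow> ('v \<times> 'v \<Rightarrow> ('v, 'k) laurent set)" where
  "cochain1 f g = (\<lambda>(i, j). residue f {i, j} (g i j))"

text \<open>
  Cochains are handled through Laurent polynomials that represent their components, so that the cochain
  groups, differentials and Frobenius become componentwise operations on polynomials.
\<close>

definition representatives0 :: "('v::finite \<Rightarrow> ('v, 'k::field) laurent) set" where
  "representatives0 = {b. \<forall>i. b i \<in> chart_ring {i}}"

definition representatives1 :: "('v::finite \<Rightarrow> 'v \<Rightarrow> ('v, 'k::field) laurent) set" where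
  "representatives1 = {g. \<forall>i j. g i j \<in> chart_ring {i, j}}"

definition is_cocycle :: "('v::finite, 'k::field) mpoly \<Rightarrow> ('v \<Rightarrow> 'v \<Rightarrow> ('v, 'k) laurent) \<Rightarrow> bool" where
  "is_cocycle f g \<longleftrightarrow> (\<forall>i j k. g j k - g i k + g i j \<in> affine_ideal f {i, j, k})"

lemma cochain1_apply [simp]: "cochain1 f g (i, j) = residue f {i, j} (g i j)"
  by (simp add: cochain1_def)

lemma carrier_cech1: "carrier (cech1 f) = cochain1 f ` representatives1"
proof
  show "cochain1 f ` representatives1 \<subseteq> carrier (cech1 f)"
    by (auto simp: cech1_def representatives1_def PiE_def extensional_def carrier_sections)
  show "carrier (cech1 f) \<subseteq> cochain1 f ` representatives1"
  proof
    fix c assume c: "c \<in> carrier (cech1 f)"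
    have "\<exists>a. a \<in> chart_ring {i, j} \<and> c (i, j) = residue f {i, j} a" for i j
    proof -
      have "c (i, j) \<in> carrier (sections f {i, j})"
        using c by (force simp: cech1_def PiE_def Pi_def)
      then show ?thesis unfolding carrier_sections by blast
    qed
    then obtain g where g: "\<And>i j. g i j \<in> chart_ring {i, j} \<and> c (i, j) = residue f {i, j} (g i j)" by metis
    then have "c = cochain1 f g" by (auto simp: fun_eq_iff)
    then show "c \<in> cochain1 f ` representatives1" using g by (auto simp: representatives1_def)
  qed
qed

lemma cochain1_eq_iff:
  assumes "g \<in> representatives1" "h \<in> representatives1"
  shows "cochain1 f g = cochain1 f h \<longleftrightarrow> (\<forall>i j. g i j - h i j \<in> affine_ideal f {i, j})"
  using assms by (auto simp: fun_eq_iff representatives1_def residue_eq_iff)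

lemma carrier_cech0: "carrier (cech0 f) = (\<lambda>b i. residue f {i} (b i)) ` representatives0"
proof
  show "(\<lambda>b i. residue f {i} (b i)) ` representatives0 \<subseteq> carrier (cech0 f)"
    by (auto simp: cech0_def representatives0_def PiE_def extensional_def carrier_sections)
  show "carrier (cech0 f) \<subseteq> (\<lambda>b i. residue f {i} (b i)) ` representatives0"
  proof
    fix c assume c: "c \<in> carrier (cech0 f)"
    have "\<exists>a. a \<in> chart_ring {i} \<and> c i = residue f {i} a" for i
    proof -
      have "c i \<in> carrier (sections f {i})"
        using c by (force simp: cech0_def PiE_def Pi_def)
      then show ?thesis unfolding carrier_sections by blast
    qed
    then obtain b where b: "\<And>i. b i \<in> chart_ring {i} \<and> c i = residue f {i} (b i)" by metis
    then have "c = (\<lambda>i. residue f {i} (b i))" by (auto simp: fun_eq_iff)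
    then show "c \<in> (\<lambda>b i. residue f {i} (b i)) ` representatives0" using b by (auto simp: representatives0_def)
  qed
qed

lemma chart_ring_pair:
  assumes "b \<in> representatives0"
  shows "b i \<in> chart_ring {i, j}" "b j \<in> chart_ring {i, j}"
  using assms chart_ring_mono[of "{i}" "{i, j}"] chart_ring_mono[of "{j}" "{i, j}"]
  by (auto simp: representatives0_def)

lemma chart_ring_triple:
  assumes "g \<in> representatives1"
  shows "g j k \<in> chart_ring {i, j, k}" "g i k \<in> chart_ring {i, j, k}" "g i j \<in> chart_ring {i, j, k}"
  using assms chart_ring_mono[of "{j, k}" "{i, j, k}"] chart_ring_mono[of "{i, k}" "{i, j, k}"]
    chart_ring_mono[of "{i, j}" "{i, j, k}"]
  by (auto simp: representatives1_def)

lemma coboundary_representative: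
  "b \<in> representatives0 \<Longrightarrow> (\<lambda>i j. b j - b i) \<in> representatives1"
  by (simp add: representatives1_def chart_ring_intros chart_ring_pair)

lemma coboundaries1_eq: "coboundaries1 f = (\<lambda>b. cochain1 f (\<lambda>i j. b j - b i)) ` representatives0"
proof -
  have "cech_d0 f (\<lambda>i. residue f {i} (b i)) = cochain1 f (\<lambda>i j. b j - b i)"
    if b: "b \<in> representatives0" for b
  proof -
    have "b i \<in> chart_ring {i}" for i using b by (simp add: representatives0_def)
    then show ?thesis
      by (auto simp: fun_eq_iff cech_d0_def restr_residue residue_minus chart_ring_pair[OF b])
  qed
  then show ?thesis unfolding coboundaries1_def carrier_cech0 image_image by (rule image_cong[OF refl])
qed

lemma carrier_cocycles1:
  "carrier (cocycles1 f) = cochain1 f ` {g \<in> representatives1. is_cocycle f g}"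
proof -
  have *: "cech_d1 f (cochain1 f g) = \<one>\<^bsub>cech2 f\<^esub> \<longleftrightarrow> is_cocycle f g"
    if g: "g \<in> representatives1" for g
  proof -
    have gs: "g i j \<in> chart_ring {i, j}" for i j using g by (simp add: representatives1_def)
    have d: "cech_d1 f (cochain1 f g) (i, j, k) = residue f {i, j, k} (g j k - g i k + g i j)" for i j k
    proof -
      have "restr f {i, j, k} (residue f {j, k} (g j k)) = residue f {i, j, k} (g j k)"
        "restr f {i, j, k} (residue f {i, k} (g i k)) = residue f {i, j, k} (g i k)"
        "restr f {i, j, k} (residue f {i, j} (g i j)) = residue f {i, j, k} (g i j)"
        by (intro restr_residue gs; blast)+
      then show ?thesis
        by (simp add: cech_d1_def residue_minus residue_add chart_ring_triple[OF g] chart_ring_intros)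
    qed
    have one: "\<one>\<^bsub>cech2 f\<^esub> (i, j, k) = residue f {i, j, k} 0" for i j k
      by (simp add: cech2_def residue_0)
    have "cech_d1 f (cochain1 f g) = \<one>\<^bsub>cech2 f\<^esub> \<longleftrightarrow>
        (\<forall>i j k. residue f {i, j, k} (g j k - g i k + g i j) = residue f {i, j, k} 0)"
      by (simp add: fun_eq_iff d one)
    also have "\<dots> \<longleftrightarrow> is_cocycle f g"
      unfolding is_cocycle_def
      by (simp add: residue_eq_iff chart_ring_intros chart_ring_triple[OF g])
    finally show ?thesis .
  qed
  have "carrier (cocycles1 f) = {c \<in> cochain1 f ` representatives1. cech_d1 f c = \<one>\<^bsub>cech2 f\<^esub>}"
    by (simp add: cocycles1_def kernel_def carrier_cech1)
  also have "\<dots> = cochain1 f ` {g \<in> representatives1. is_cocycle f g}" using * by blast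
  finally show ?thesis .
qed

lemma cochain1_mult:
  assumes "g \<in> representatives1" "h \<in> representatives1"
  shows "cochain1 f g \<otimes>\<^bsub>cocycles1 f\<^esub> cochain1 f h = cochain1 f (\<lambda>i j. g i j + h i j)"
  using assms by (auto simp: fun_eq_iff cocycles1_def cech1_def representatives1_def residue_add)

lemma frob_cochain_cochain1:
  fixes f :: "('v::finite, 'k::field) mpoly"
  assumes "g \<in> representatives1"
  shows "frob_cochain f (cochain1 f g) = cochain1 f (\<lambda>i j. g i j ^ CHAR('k))"
  using assms by (auto simp: fun_eq_iff frob_cochain_def representatives1_def residue_power)

text \<open>
  Supersingularity without cosets: the \<open>p\<close>-th powers of every cocycle form a coboundary. The class of a
  cocycle contains it, and it consists of cocycles, so a condition on all members of all classes is a
  condition on all cocycles.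
\<close>

lemma supersingular_iff_representatives:
  fixes f :: "(3, 'k::field) mpoly"
  shows "supersingular f \<longleftrightarrow> (\<forall>g\<in>representatives1. is_cocycle f g \<longrightarrow>
    (\<exists>b\<in>representatives0. \<forall>i j. g i j ^ CHAR('k) - (b j - b i) \<in> affine_ideal f {i, j}))"
    (is "_ \<longleftrightarrow> ?R")
proof -
  let ?B = "coboundaries1 f" and ?Z = "cocycles1 f" and ?p = "CHAR('k)"
  have frob_rep: "(\<lambda>i j. g i j ^ ?p) \<in> representatives1" if "g \<in> representatives1" for g :: "3 \<Rightarrow> 3 \<Rightarrow> (3, 'k) laurent"
    using that by (simp add: representatives1_def chart_ring_power)
  have in_B: "frob_cochain f (cochain1 f g) \<in> ?B \<longleftrightarrow>
      (\<exists>b\<in>representatives0. \<forall>i j. g i j ^ ?p - (b j - b i) \<in> affine_ideal f {i, j})"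
    if g: "g \<in> representatives1" for g
  proof -
    have "frob_cochain f (cochain1 f g) \<in> ?B \<longleftrightarrow>
        (\<exists>b\<in>representatives0. cochain1 f (\<lambda>i j. g i j ^ ?p) = cochain1 f (\<lambda>i j. b j - b i))"
      unfolding frob_cochain_cochain1[OF g] coboundaries1_eq by blast
    also have "\<dots> \<longleftrightarrow> (\<exists>b\<in>representatives0. \<forall>i j. g i j ^ ?p - (b j - b i) \<in> affine_ideal f {i, j})"
      using cochain1_eq_iff[OF frob_rep[OF g] coboundary_representative] by (intro bex_cong) auto
    finally show ?thesis .
  qed
  have carrier_H1: "carrier (H1 f) = (\<lambda>c. ?B #>\<^bsub>?Z\<^esub> c) ` carrier ?Z"
    by (simp add: H1_def carrier_FactGroup)
  have zero0: "(\<lambda>_. 0) \<in> (representatives0 :: (3 \<Rightarrow> (3, 'k) laurent) set)"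
    by (simp add: representatives0_def chart_ring_intros)
  have self: "c \<in> ?B #>\<^bsub>?Z\<^esub> c" if c: "c \<in> carrier (cech1 f)" for c
  proof -
    obtain g where g: "g \<in> representatives1" "c = cochain1 f g" using c unfolding carrier_cech1 by blast
    have "(\<lambda>_ _. 0) \<in> (representatives1 :: (3 \<Rightarrow> 3 \<Rightarrow> (3, 'k) laurent) set)"
      by (simp add: representatives1_def chart_ring_intros)
    then have "c = cochain1 f (\<lambda>_ _. 0) \<otimes>\<^bsub>?Z\<^esub> c" by (simp add: cochain1_mult g)
    moreover have "cochain1 f (\<lambda>_ _. 0) \<in> ?B"
      unfolding coboundaries1_eq using zero0 by (intro image_eqI[of _ _ "\<lambda>_. 0"]) simp_all
    ultimately show ?thesis unfolding r_coset_def by blast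
  qed
  show ?thesis
  proof
    assume ss: "supersingular f"
    show ?R
    proof (intro ballI impI)
      fix g :: "3 \<Rightarrow> 3 \<Rightarrow> (3, 'k) laurent" assume g: "g \<in> representatives1" "is_cocycle f g"
      let ?c = "cochain1 f g"
      have c: "?c \<in> carrier ?Z" "?c \<in> carrier (cech1 f)" "frob_cochain f ?c \<in> carrier (cech1 f)"
        using g frob_rep[OF g(1)] unfolding carrier_cocycles1 carrier_cech1 frob_cochain_cochain1[OF g(1)] by blast+
      have "?B #>\<^bsub>?Z\<^esub> ?c \<in> carrier (H1 f)" unfolding carrier_H1 using c(1) by blast
      then have "frob_H1 f (?B #>\<^bsub>?Z\<^esub> ?c) = ?B" using ss unfolding supersingular_def by (simp add: H1_def)
      moreover have "frob_cochain f ?c \<in> frob_H1 f (?B #>\<^bsub>?Z\<^esub> ?c)"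
        unfolding frob_H1_def using self[OF c(2)] self[OF c(3)] by blast
      ultimately show "\<exists>b\<in>representatives0. \<forall>i j. g i j ^ ?p - (b j - b i) \<in> affine_ideal f {i, j}"
        using in_B[OF g(1)] by blast
    qed
  next
    assume R: ?R
    have absorb: "?B #>\<^bsub>?Z\<^esub> c = ?B" if c: "c \<in> ?B" for c
    proof -
      obtain b where b: "b \<in> representatives0" "c = cochain1 f (\<lambda>i j. b j - b i)"
        using c unfolding coboundaries1_eq by blast
      have mult: "cochain1 f (\<lambda>i j. a j - a i) \<otimes>\<^bsub>?Z\<^esub> c = cochain1 f (\<lambda>i j. (a j + b j) - (a i + b i))"
        if "a \<in> representatives0" for a
        using that b by (simp add: cochain1_mult coboundary_representative algebra_simps)
      show ?thesis
      proof
        show "?B #>\<^bsub>?Z\<^esub> c \<subseteq> ?B"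
        proof
          fix x assume "x \<in> ?B #>\<^bsub>?Z\<^esub> c"
          then obtain a where a: "a \<in> representatives0" "x = cochain1 f (\<lambda>i j. a j - a i) \<otimes>\<^bsub>?Z\<^esub> c"
            unfolding r_coset_def coboundaries1_eq by blast
          have "(\<lambda>i. a i + b i) \<in> representatives0"
            using a(1) b(1) by (simp add: representatives0_def chart_ring_intros)
          then show "x \<in> ?B" unfolding a(2) mult[OF a(1)] coboundaries1_eq
            by (rule rev_image_eqI) simp
        qed
        show "?B \<subseteq> ?B #>\<^bsub>?Z\<^esub> c"
        proof
          fix x assume "x \<in> ?B"
          then obtain a where a: "a \<in> representatives0" "x = cochain1 f (\<lambda>i j. a j - a i)"
            unfolding coboundaries1_eq by blast
          have ab: "(\<lambda>i. a i - b i) \<in> representatives0"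
            using a(1) b(1) by (simp add: representatives0_def chart_ring_intros)
          have "x = cochain1 f (\<lambda>i j. (a j - b j) - (a i - b i)) \<otimes>\<^bsub>?Z\<^esub> c"
            using mult[OF ab] by (simp add: a(2))
          then show "x \<in> ?B #>\<^bsub>?Z\<^esub> c" unfolding r_coset_def coboundaries1_eq using ab by blast
        qed
      qed
    qed
    show "supersingular f" unfolding supersingular_def
    proof
      fix \<xi> assume "\<xi> \<in> carrier (H1 f)"
      then obtain g where g: "g \<in> representatives1" "is_cocycle f g" "\<xi> = ?B #>\<^bsub>?Z\<^esub> cochain1 f g"
        unfolding carrier_H1 carrier_cocycles1 by blast
      have "frob_cochain f c \<in> ?B" if c: "c \<in> \<xi>" for c
      proof -
        obtain b where b: "b \<in> representatives0" "c = cochain1 f (\<lambda>i j. b j - b i) \<otimes>\<^bsub>?Z\<^esub> cochain1 f g"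
          using c unfolding g(3) r_coset_def coboundaries1_eq by blast
        define h where "h i j = (b j - b i) + g i j" for i j
        have "c = cochain1 f h" unfolding h_def
          by (simp add: b(2) cochain1_mult[OF coboundary_representative[OF b(1)] g(1)])
        moreover have h: "h \<in> representatives1"
          using coboundary_representative[OF b(1)] g(1) by (simp add: representatives1_def h_def chart_ring_intros)
        moreover have "is_cocycle f h" using g(2) by (simp add: is_cocycle_def h_def algebra_simps)
        ultimately show ?thesis using R in_B[OF h] by blast
      qed
      then have "frob_H1 f \<xi> = (\<Union>c\<in>\<xi>. ?B)" unfolding frob_H1_def using absorb by auto
      moreover have "cochain1 f g \<in> \<xi>"
        unfolding g(3) by (rule self) (use g(1) in \<open>auto simp: carrier_cech1\<close>)
      ultimately show "frob_H1 f \<xi> = \<one>\<^bsub>H1 f\<^esub>" by (auto simp: H1_def)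
    qed
  qed
qed

section \<open>Cech cocycles on the projective plane\<close>

lemma total_degree_three: "total_degree m = lookup m 0 + lookup m 1 + lookup m (2::3)"
  by (simp add: total_degree_def sum_three)

lemma localisation_three:
  "g \<in> localisation I \<longleftrightarrow> (\<forall>m\<in>keys g. (0 \<notin> I \<longrightarrow> 0 \<le> lookup m 0) \<and> (1 \<notin> I \<longrightarrow> 0 \<le> lookup m 1)
    \<and> (2 \<notin> I \<longrightarrow> 0 \<le> lookup m (2::3)))"
  by (simp add: localisation_def all_three)

text \<open>
  Every term has a variable with nonnegative exponent and is assigned to the chart where the other two
  variables are inverted. This computes the top cohomology: only exponents that are negative in all
  three variables obstruct the splitting.
\<close>

lemma split_three_charts:
  fixes x :: "(3, 'k::field) laurent"
  assumes x: "x \<in> laurent_degree d" and nonneg: "\<And>m. m \<in> keys x \<Longrightarrow> \<exists>v. 0 \<le> lookup m v"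
  obtains s01 s02 s12 where "x = s12 - s02 + s01"
    "s01 \<in> localisation {0, 1} \<inter> laurent_degree d"
    "s02 \<in> localisation {0, 2} \<inter> laurent_degree d"
    "s12 \<in> localisation {1, 2} \<inter> laurent_degree d"
proof -
  have cases: "0 \<le> lookup m 0 \<or> 0 \<le> lookup m 1 \<or> 0 \<le> lookup m 2" if "m \<in> keys x" for m
    using nonneg[OF that] all_three[of "\<lambda>v. \<not> 0 \<le> lookup m v"] by blast
  define S0 S1 S2 where "S0 = {m :: 3 \<Rightarrow>\<^sub>0 int. 0 \<le> lookup m 0}"
    and "S1 = {m :: 3 \<Rightarrow>\<^sub>0 int. \<not> 0 \<le> lookup m 0 \<and> 0 \<le> lookup m 1}"
    and "S2 = {m :: 3 \<Rightarrow>\<^sub>0 int. \<not> 0 \<le> lookup m 0 \<and> \<not> 0 \<le> lookup m 1}"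
  show thesis
  proof (rule that[of "part S0 x" "- part S1 x" "part S2 x"])
    show "x = part S0 x - - part S1 x + part S2 x"
      by (rule poly_mapping_eqI) (simp add: lookup_add lookup_part S0_def S1_def S2_def)
    have "part S0 x \<in> localisation {1, 2}" "part S1 x \<in> localisation {0, 2}" "part S2 x \<in> localisation {0, 1}"
      using cases by (auto simp: localisation_three keys_part S0_def S1_def S2_def)
    then show "part S2 x \<in> localisation {0, 1} \<inter> laurent_degree d"
      "- part S1 x \<in> localisation {0, 2} \<inter> laurent_degree d"
      "part S0 x \<in> localisation {1, 2} \<inter> laurent_degree d"
      using part_laurent_degree[OF x] by (auto intro: localisation_uminus laurent_degree_uminus)
  qed
qed

text \<open>
  The vanishing of \<open>H\<^sup>1\<close> of the structure sheaf of the plane. In the relation \<open>u12 - u02 + u01 = 0\<close>, a term of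
  \<open>u01\<close> with negative exponent in variable 0 can cancel only against \<open>u02\<close>, hence its other exponents are
  nonnegative and it belongs to chart 0; the remaining terms of \<open>u01\<close> belong to chart 1.
\<close>

lemma cocycle_is_coboundary_plane:
  fixes u01 u02 u12 :: "(3, 'k::field) laurent"
  assumes u: "u01 \<in> chart_ring {0, 1}" "u02 \<in> chart_ring {0, 2}" "u12 \<in> chart_ring {1, 2}" and eq: "u12 - u02 + u01 = 0"
  obtains b0 b1 b2 where "b0 \<in> chart_ring {0}" "b1 \<in> chart_ring {1}" "b2 \<in> chart_ring {2}"
    "u01 = b1 - b0" "u02 = b2 - b0" "u12 = b2 - b1"
proof -
  define S where "S = {m :: 3 \<Rightarrow>\<^sub>0 int. 0 \<le> lookup m 0}"
  have coeff: "lookup u12 m - lookup u02 m + lookup u01 m = 0" for m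
  proof -
    have "lookup (u12 - u02 + u01) m = lookup 0 m" by (simp only: eq)
    then show ?thesis by (simp add: lookup_add lookup_minus)
  qed
  have l01: "0 \<le> lookup m 2" if "lookup u01 m \<noteq> 0" for m
    using u(1) that by (auto simp: chart_ring_def localisation_three in_keys_iff)
  have l02: "0 \<le> lookup m 1" if "lookup u02 m \<noteq> 0" for m
    using u(2) that by (auto simp: chart_ring_def localisation_three in_keys_iff)
  have l12: "0 \<le> lookup m 0" if "lookup u12 m \<noteq> 0" for m
    using u(3) that by (auto simp: chart_ring_def localisation_three in_keys_iff)
  have deg: "u01 \<in> laurent_degree 0" "u02 \<in> laurent_degree 0"
    using u by (simp_all add: chart_ring_def)
  define b0 b1 b2 where "b0 = - part (- S) u01" and "b1 = part S u01" and "b2 = u02 + b0"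
  have split: "u01 = part S u01 + part (- S) u01"
    by (rule poly_mapping_eqI) (simp add: lookup_add lookup_part)
  show thesis
  proof (rule that)
    show e01: "u01 = b1 - b0" using split by (simp add: b0_def b1_def)
    show "u02 = b2 - b0" by (simp add: b2_def)
    then show "u12 = b2 - b1" using eq e01 by (simp add: algebra_simps)
    have "0 \<le> lookup m 1 \<and> 0 \<le> lookup m 2" if m: "lookup u01 m \<noteq> 0" "\<not> 0 \<le> lookup m 0" for m
    proof -
      have "lookup u12 m = 0" using l12 m(2) by blast
      then have "lookup u02 m \<noteq> 0" using coeff[of m] m(1) by auto
      then show ?thesis using l02 l01[OF m(1)] by blast
    qed
    then have "b0 \<in> localisation {0}"
      unfolding b0_def by (intro localisation_uminus) (auto simp: localisation_three keys_part S_def in_keys_iff)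
    then show "b0 \<in> chart_ring {0}"
      using deg by (auto simp: chart_ring_def b0_def intro: laurent_degree_uminus part_laurent_degree)
    have "b1 \<in> localisation {1}"
      unfolding b1_def using l01 by (auto simp: localisation_three keys_part S_def in_keys_iff)
    then show "b1 \<in> chart_ring {1}"
      using deg by (auto simp: chart_ring_def b1_def intro: part_laurent_degree)
    have "0 \<le> lookup m 0 \<and> 0 \<le> lookup m 1" if m: "lookup b2 m \<noteq> 0" for m
    proof (cases "m \<in> S")
      case True
      then have "lookup u02 m \<noteq> 0" using m by (simp add: b2_def b0_def lookup_add lookup_minus lookup_part)
      then show ?thesis using True l02 by (simp add: S_def)
    next
      case False
      then have "lookup u12 m = 0" using l12 by (auto simp: S_def)
      moreover have "lookup b2 m = lookup u02 m - lookup u01 m"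
        using False by (simp add: b2_def b0_def lookup_add lookup_minus lookup_part)
      ultimately show ?thesis using m coeff[of m] by (simp add: algebra_simps)
    qed
    then have "b2 \<in> localisation {2}" by (auto simp: localisation_three in_keys_iff)
    moreover have "b2 \<in> laurent_degree 0"
      unfolding b2_def b0_def using deg
      by (intro laurent_degree_add laurent_degree_uminus part_laurent_degree)
    ultimately show "b2 \<in> chart_ring {2}" by (simp add: chart_ring_def)
  qed
qed

section \<open>The Hasse coefficient\<close>

text \<open>
  Three negative integers with sum \<open>-3\<close> are all \<open>-1\<close>: this is why \<open>H\<^sup>2(\<O>(-3))\<close> has dimension one.
\<close>

lemma exponent_nonneg_or_socle:
  fixes m :: "3 \<Rightarrow>\<^sub>0 int"
  assumes "total_degree m = - 3" "m \<noteq> uniform_exponent (- 1)"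
  shows "\<exists>v. 0 \<le> lookup m v"
proof (rule ccontr)
  assume none: "\<not> (\<exists>v. 0 \<le> lookup m v)"
  have neg: "lookup m v \<le> - 1" for v
  proof -
    have "lookup m v < 0" using none not_le by blast
    then show ?thesis by linarith
  qed
  have "lookup m 0 = - 1" "lookup m 1 = - 1" "lookup m 2 = - 1"
    using neg[of 0] neg[of 1] neg[of 2] assms(1) unfolding total_degree_three by linarith+
  then have "\<forall>v. lookup m v = lookup (uniform_exponent (- 1)) v" unfolding all_three by simp
  then have "m = uniform_exponent (- 1)" by (intro poly_mapping_eqI) simp
  with assms(2) show False ..
qed

definition hasse_coefficient :: "(3, 'k::field) mpoly \<Rightarrow> 'k" where
  "hasse_coefficient f = lookup (f ^ (CHAR('k) - 1)) (uniform_exponent (CHAR('k) - 1))"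

lemma no_socle_term:
  fixes g :: "(3, 'k::field) laurent"
  assumes "g \<in> localisation I" "v \<notin> I"
  shows "lookup g (uniform_exponent (- 1)) = 0"
proof (rule ccontr)
  assume "lookup g (uniform_exponent (- 1)) \<noteq> 0"
  then have "uniform_exponent (- 1) \<in> keys g" by (simp add: in_keys_iff)
  then have "0 \<le> lookup (uniform_exponent (- 1) :: 3 \<Rightarrow>\<^sub>0 int) v"
    using assms unfolding localisation_def by blast
  then show False by simp
qed

lemma three_not_in: "(0::3) \<notin> {1, 2}" "(1::3) \<notin> {0, 2}" "(2::3) \<notin> {0, 1}"
  by simp_all

text \<open>
  The action of Frobenius on \<open>H\<^sup>2(\<O>(-3))\<close>, namely \<open>h \<mapsto> f ^ (p - 1) h ^ p\<close>, computed on the generator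
  \<open>1/(xyz)\<close>. The other terms of \<open>h\<close> have a nonnegative exponent, and keep it under taking \<open>p\<close>-th powers and
  multiplying by polynomials.
\<close>

lemma socle_term_frobenius:
  fixes f :: "(3, 'k::field) mpoly" and h :: "(3, 'k) laurent"
  assumes p: "Factorial_Ring.prime CHAR('k)" and h: "h \<in> laurent_degree (- 3)"
  shows "lookup (to_laurent f ^ (CHAR('k) - 1) * h ^ CHAR('k)) (uniform_exponent (- 1))
    = hasse_coefficient f * lookup h (uniform_exponent (- 1)) ^ CHAR('k)"
proof -
  let ?p = "CHAR('k)" and ?e = "uniform_exponent (- 1) :: 3 \<Rightarrow>\<^sub>0 int"
  let ?F = "to_laurent f ^ (?p - 1)"
  have p0: "?p > 0" using p by (simp add: prime_gt_0_nat)
  define l where "l = lookup h ?e"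
  define h' where "h' = h - single ?e l"
  have pe: "(\<Sum>i<?p. ?e) = uniform_exponent (- int ?p)" by (rule poly_mapping_eqI) (simp add: lookup_sum_const del: sum_constant)
  have hp: "h ^ ?p = single (uniform_exponent (- int ?p)) (l ^ ?p) + h' ^ ?p"
  proof -
    have "h ^ ?p = (single ?e l + h') ^ ?p" by (simp add: h'_def)
    also have "\<dots> = single ?e l ^ ?p + h' ^ ?p"
      by (rule freshmans_dream) (simp_all add: CHAR_poly_mapping p)
    finally show ?thesis by (simp only: single_power pe)
  qed
  have h': "\<exists>v. 0 \<le> lookup m v" if m: "m \<in> keys h'" for m
  proof (rule exponent_nonneg_or_socle)
    have "lookup h m - lookup (single ?e l) m \<noteq> 0" using m by (simp add: h'_def in_keys_iff lookup_minus)
    then show ne: "m \<noteq> ?e" by (auto simp: l_def)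
    with \<open>lookup h m - lookup (single ?e l) m \<noteq> 0\<close> have "m \<in> keys h"
      by (simp add: in_keys_iff lookup_single)
    then show "total_degree m = - 3" using h by (simp add: laurent_degree_def)
  qed
  have "lookup (?F * h' ^ ?p) ?e = 0"
  proof (rule ccontr)
    assume "lookup (?F * h' ^ ?p) ?e \<noteq> 0"
    then have "?e \<in> keys (?F * h' ^ ?p)" by (simp add: in_keys_iff)
    then obtain a n where an: "?e = a + n" "a \<in> keys ?F" "n \<in> keys (h' ^ ?p)"
      using keys_mult[of ?F "h' ^ ?p"] by blast
    obtain m where m: "n = (\<Sum>i<?p. m)" "m \<in> keys h'"
      using an(3) keys_frobenius_power[OF p inj_sum_const(1)[OF p0], of h'] by blast
    obtain v where v: "0 \<le> lookup m v" using h'[OF m(2)] by blast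
    have "?F \<in> localisation {}" by (intro localisation_power localisation_to_laurent)
    then have "0 \<le> lookup a v" using an(2) by (simp add: localisation_def)
    moreover have "0 \<le> lookup n v" using v by (simp add: m(1) lookup_sum_const del: sum_constant)
    moreover have "lookup ?e v = lookup a v + lookup n v" by (simp add: an(1) lookup_add)
    ultimately show False by simp
  qed
  moreover have "lookup (single (uniform_exponent (- int ?p)) (l ^ ?p) * ?F) ?e = l ^ ?p * hasse_coefficient f"
  proof -
    have e: "?e = uniform_exponent (- int ?p) + Poly_Mapping.map int (uniform_exponent (?p - 1))"
      using p0 by (intro poly_mapping_eqI) (simp add: lookup_add of_nat_diff)
    show ?thesis
      unfolding e lookup_single_mult
      by (simp add: hasse_coefficient_def lookup_to_laurent flip: to_laurent_power)
  qed
  ultimately show ?thesis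
    by (simp add: hp distrib_left lookup_add l_def mult.commute)
qed

text \<open>
  Let \<open>g\<close> be a cocycle with \<open>g\<^sub>1\<^sub>2 - g\<^sub>0\<^sub>2 + g\<^sub>0\<^sub>1 = f h\<close>. Its \<open>p\<close>-th power has defect \<open>f h'\<close> with
  \<open>h' = f ^ (p - 1) h ^ p\<close>, and \<open>h'\<close> has no term \<open>1/(xyz)\<close> by assumption. So \<open>h'\<close> splits over the
  charts, the \<open>p\<close>-th powers can be corrected by multiples of \<open>f\<close> to an exact cocycle on the plane, and that
  is a coboundary. The components with equal or decreasing indices follow from the cocycle condition for
  triples with repetitions.
\<close>

lemma hasse_zero_imp_supersingular:
  fixes f :: "(3, 'k::field) mpoly"
  assumes p: "Factorial_Ring.prime CHAR('k)" and f: "homogeneous 3 f" and hasse: "hasse_coefficient f = 0"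
  shows "supersingular f"
  unfolding supersingular_iff_representatives
proof (intro ballI impI)
  let ?p = "CHAR('k)" and ?F = "to_laurent f"
  fix g :: "3 \<Rightarrow> 3 \<Rightarrow> (3, 'k) laurent" assume g: "g \<in> representatives1" "is_cocycle f g"
  have p0: "?p > 0" using p by (simp add: prime_gt_0_nat)
  have frob_add: "(x + y) ^ ?p = x ^ ?p + y ^ ?p" for x y :: "(3, 'k) laurent"
    by (rule freshmans_dream) (simp_all add: CHAR_poly_mapping p)
  have gs: "g i j \<in> chart_ring {i, j}" for i j using g(1) by (simp add: representatives1_def)
  have cocycle: "g j k - g i k + g i j \<in> affine_ideal f {i, j, k}" for i j k
    using g(2) by (simp add: is_cocycle_def)
  obtain h where h: "g 1 2 - g 0 2 + g 0 1 = ?F * h" "h \<in> laurent_degree (- 3)"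
    using cocycle[of 1 2 0] unfolding affine_ideal_iff[OF f] by auto
  define h' where "h' = ?F ^ (?p - 1) * h ^ ?p"
  have Fh': "?F * h' = (?F * h) ^ ?p"
    using p0 by (simp add: h'_def power_mult_distrib flip: mult.assoc power_Suc)
  have "h' \<in> laurent_degree (int (?p - 1) * 3 + int ?p * (- 3))"
    unfolding h'_def using to_laurent_degree[OF f]
    by (intro laurent_degree_mult laurent_degree_power h(2)) simp
  moreover have "int (?p - 1) * 3 + int ?p * (- 3) = - 3" using p0 by (simp add: of_nat_diff)
  ultimately have degh': "h' \<in> laurent_degree (- 3)" by simp
  have "lookup h' (uniform_exponent (- 1)) = 0"
    unfolding h'_def socle_term_frobenius[OF p h(2)] by (simp add: hasse)
  have nonneg: "\<exists>v. 0 \<le> lookup m v" if m: "m \<in> keys h'" for m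
  proof (rule exponent_nonneg_or_socle)
    show "total_degree m = - 3" using degh' m by (simp add: laurent_degree_def)
    show "m \<noteq> uniform_exponent (- 1)" using m \<open>lookup h' _ = 0\<close> by (auto simp: in_keys_iff)
  qed
  obtain s01 s02 s12 where s: "h' = s12 - s02 + s01"
    "s01 \<in> localisation {0, 1} \<inter> laurent_degree (- 3)"
    "s02 \<in> localisation {0, 2} \<inter> laurent_degree (- 3)"
    "s12 \<in> localisation {1, 2} \<inter> laurent_degree (- 3)"
    by (rule split_three_charts[OF degh' nonneg])
  have Fs: "?F * s01 \<in> affine_ideal f {0, 1}" "?F * s02 \<in> affine_ideal f {0, 2}" "?F * s12 \<in> affine_ideal f {1, 2}"
    using s(2-4) f by (auto simp: affine_ideal_iff[where d = 3])
  have "g 1 2 + g 0 1 = g 0 2 + ?F * h" using h(1) by (simp add: algebra_simps)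
  then have "g 1 2 ^ ?p + g 0 1 ^ ?p = g 0 2 ^ ?p + ?F * h'"
    unfolding Fh' frob_add[symmetric] by (rule arg_cong)
  then have eq: "(g 1 2 ^ ?p - ?F * s12) - (g 0 2 ^ ?p - ?F * s02) + (g 0 1 ^ ?p - ?F * s01) = 0"
    unfolding s(1) by (simp add: algebra_simps)
  have u: "g 0 1 ^ ?p - ?F * s01 \<in> chart_ring {0, 1}" "g 0 2 ^ ?p - ?F * s02 \<in> chart_ring {0, 2}"
    "g 1 2 ^ ?p - ?F * s12 \<in> chart_ring {1, 2}"
    using Fs affine_ideal_subset by (blast intro: chart_ring_intros chart_ring_power gs)+
  obtain b0 b1 b2 where b: "b0 \<in> chart_ring {0}" "b1 \<in> chart_ring {1}" "b2 \<in> chart_ring {2}"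
    "g 0 1 ^ ?p - ?F * s01 = b1 - b0" "g 0 2 ^ ?p - ?F * s02 = b2 - b0" "g 1 2 ^ ?p - ?F * s12 = b2 - b1"
    by (rule cocycle_is_coboundary_plane[OF u eq])
  define b where "b i = (if i = 0 then b0 else if i = 1 then b1 else b2)" for i :: 3
  have b012: "b 0 = b0" "b 1 = b1" "b 2 = b2" by (simp_all add: b_def)
  have "\<forall>i. b i \<in> chart_ring {i}" unfolding all_three by (simp add: b012 b(1-3))
  then have brep: "b \<in> representatives0" by (simp add: representatives0_def)
  have forward: "g 0 1 ^ ?p - (b 1 - b 0) \<in> affine_ideal f {0, 1}"
    "g 0 2 ^ ?p - (b 2 - b 0) \<in> affine_ideal f {0, 2}" "g 1 2 ^ ?p - (b 2 - b 1) \<in> affine_ideal f {1, 2}"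
    using Fs unfolding b012 b(4-6)[symmetric] by simp_all
  have diagonal: "g i i ^ ?p - (b i - b i) \<in> affine_ideal f {i, i}" for i
    using affine_ideal_power[OF cocycle[of i i i] p0] by simp
  have backward: "g j i ^ ?p - (b i - b j) \<in> affine_ideal f {j, i}"
    if ij: "g i j ^ ?p - (b j - b i) \<in> affine_ideal f {i, j}" for i j
  proof -
    have gii: "g i i \<in> affine_ideal f {i, j}"
      using cocycle[of i i i] affine_ideal_mono[of "{i}" "{i, j}" f] by auto
    have "g j i - g i i + g i j \<in> affine_ideal f {i, j}"
      using cocycle[of j i i] by (simp add: insert_commute)
    then have "(g j i - g i i + g i j) + g i i \<in> affine_ideal f {i, j}"
      using gii by (rule affine_ideal_add)
    then have "(g j i + g i j) ^ ?p \<in> affine_ideal f {i, j}"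
      using p0 by (intro affine_ideal_power) (simp_all add: algebra_simps)
    then have "(g j i ^ ?p + g i j ^ ?p) - (g i j ^ ?p - (b j - b i)) \<in> affine_ideal f {i, j}"
      unfolding frob_add using ij by (rule affine_ideal_diff)
    then show ?thesis by (simp add: algebra_simps insert_commute)
  qed
  have "\<forall>i j. g i j ^ ?p - (b j - b i) \<in> affine_ideal f {i, j}"
    unfolding all_three using forward backward[OF forward(1)] backward[OF forward(2)] backward[OF forward(3)]
      diagonal by (intro conjI) blast+
  then show "\<exists>b\<in>representatives0. \<forall>i j. g i j ^ ?p - (b j - b i) \<in> affine_ideal f {i, j}"
    using brep by blast
qed

text \<open>
  The test cocycle is the generator of \<open>H\<^sup>1(E, \<O>\<^sub>E)\<close>: split \<open>f/(xyz)\<close>, which has degree 0, over the charts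
  and extend the three pieces to an alternating cochain. If its \<open>p\<close>-th power is a coboundary, then
  \<open>f ^ p/(xyz) ^ p\<close> is \<open>f\<close> times a sum of elements of the three charts; cancelling \<open>f\<close> and comparing
  coefficients of \<open>1/(xyz)\<close> gives the claim.
\<close>

lemma supersingular_imp_hasse_zero:
  fixes f :: "(3, 'k::field) mpoly"
  assumes p: "Factorial_Ring.prime CHAR('k)" and f: "homogeneous 3 f" and f0: "f \<noteq> 0"
    and ss: "supersingular f"
  shows "hasse_coefficient f = 0"
proof -
  let ?p = "CHAR('k)" and ?F = "to_laurent f" and ?e = "uniform_exponent (- 1) :: 3 \<Rightarrow>\<^sub>0 int"
  have p0: "?p > 0" using p by (simp add: prime_gt_0_nat)
  have frob_add: "(x + y) ^ ?p = x ^ ?p + y ^ ?p" for x y :: "(3, 'k) laurent"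
    by (rule freshmans_dream) (simp_all add: CHAR_poly_mapping p)
  have dege: "single ?e 1 \<in> laurent_degree (- 3)" by (simp add: laurent_degree_def total_degree_three)
  define x where "x = ?F * single ?e (1 :: 'k)"
  have degx: "x \<in> laurent_degree 0"
    unfolding x_def using laurent_degree_mult[OF to_laurent_degree[OF f] dege] by simp
  have "\<exists>v. 0 \<le> lookup m v" if "m \<in> keys x" for m
  proof (rule ccontr)
    assume neg: "\<not> (\<exists>v. 0 \<le> lookup m v)"
    have "lookup m 0 + lookup m 1 + lookup m 2 = 0"
      using degx that by (simp add: laurent_degree_def total_degree_three)
    moreover have "lookup m v < 0" for v using neg not_le by blast
    then have "lookup m 0 < 0" "lookup m 1 < 0" "lookup m 2 < 0" by blast+
    ultimately show False by linarith
  qed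
  then obtain s01 s02 s12 where s: "x = s12 - s02 + s01"
    "s01 \<in> localisation {0, 1} \<inter> laurent_degree 0"
    "s02 \<in> localisation {0, 2} \<inter> laurent_degree 0"
    "s12 \<in> localisation {1, 2} \<inter> laurent_degree 0"
    by (rule split_three_charts[OF degx])
  define g :: "3 \<Rightarrow> 3 \<Rightarrow> (3, 'k) laurent" where "g i j =
    (if i = j then 0 else if i = 0 then (if j = 1 then s01 else s02)
     else if i = 1 then (if j = 0 then - s01 else s12) else (if j = 0 then - s02 else - s12))" for i j
  have "\<forall>i j. g i j \<in> chart_ring {i, j}" unfolding all_three
    using s(2-4) by (simp add: g_def chart_ring_def localisation_uminus laurent_degree_uminus insert_commute)
  then have grep: "g \<in> representatives1" by (simp add: representatives1_def)
  have x_ideal: "x \<in> affine_ideal f UNIV" unfolding affine_ideal_iff[OF f] x_def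
    by (intro bexI[of _ "single ?e 1"]) (use dege in \<open>auto simp: localisation_def\<close>)
  have perms: "{0, 1, 2} = (UNIV :: 3 set)" "{0, 2, 1} = (UNIV :: 3 set)" "{1, 0, 2} = (UNIV :: 3 set)"
    "{1, 2, 0} = (UNIV :: 3 set)" "{2, 0, 1} = (UNIV :: 3 set)" "{2, 1, 0} = (UNIV :: 3 set)"
    unfolding UNIV_three by auto
  have xmem: "s12 - s02 + s01 \<in> affine_ideal f UNIV" "- (s12 - s02 + s01) \<in> affine_ideal f UNIV"
    using x_ideal affine_ideal_uminus[OF x_ideal] by (simp_all only: s(1))
  have "is_cocycle f g" unfolding is_cocycle_def all_three
    using xmem by (simp add: g_def perms affine_ideal_0 algebra_simps)
  then obtain b where b: "b \<in> representatives0"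
    "\<And>i j. g i j ^ ?p - (b j - b i) \<in> affine_ideal f {i, j}"
    using ss grep unfolding supersingular_iff_representatives by blast
  obtain t01 where t01: "s01 ^ ?p - (b 1 - b 0) = ?F * t01" "t01 \<in> localisation {0, 1}"
    using b(2)[of 0 1] unfolding affine_ideal_iff[OF f] by (auto simp: g_def)
  obtain t02 where t02: "s02 ^ ?p - (b 2 - b 0) = ?F * t02" "t02 \<in> localisation {0, 2}"
    using b(2)[of 0 2] unfolding affine_ideal_iff[OF f] by (auto simp: g_def)
  obtain t12 where t12: "s12 ^ ?p - (b 2 - b 1) = ?F * t12" "t12 \<in> localisation {1, 2}"
    using b(2)[of 1 2] unfolding affine_ideal_iff[OF f] by (auto simp: g_def)
  have "x + s02 = s12 + s01" by (simp add: s(1))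
  then have "x ^ ?p + s02 ^ ?p = s12 ^ ?p + s01 ^ ?p"
    unfolding frob_add[symmetric] by (rule arg_cong)
  then have "x ^ ?p = ?F * t12 - ?F * t02 + ?F * t01"
    unfolding t01(1)[symmetric] t02(1)[symmetric] t12(1)[symmetric] by (simp add: algebra_simps)
  moreover have "x ^ ?p = ?F * (?F ^ (?p - 1) * single ?e 1 ^ ?p)"
    using p0 by (simp add: x_def power_mult_distrib flip: mult.assoc power_Suc)
  ultimately have "?F * (?F ^ (?p - 1) * single ?e 1 ^ ?p) = ?F * (t12 - t02 + t01)"
    by (simp add: algebra_simps)
  moreover have "?F \<noteq> 0"
  proof
    assume "?F = 0"
    then have "lookup f m = 0" for m using lookup_to_laurent[of f m] by simp
    then show False using f0 by (auto intro: poly_mapping_eqI)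
  qed
  ultimately have "?F ^ (?p - 1) * single ?e 1 ^ ?p = t12 - t02 + t01" by simp
  then have "lookup (?F ^ (?p - 1) * single ?e 1 ^ ?p) ?e = lookup t12 ?e - lookup t02 ?e + lookup t01 ?e"
    by (simp add: lookup_add lookup_minus)
  also have "\<dots> = 0"
    using no_socle_term[OF t01(2) three_not_in(3)] no_socle_term[OF t02(2) three_not_in(2)]
      no_socle_term[OF t12(2) three_not_in(1)] by simp
  finally show ?thesis unfolding socle_term_frobenius[OF p dege] by simp
qed

section \<open>The threshold of a smooth plane cubic\<close>

text \<open>
  The descent for a cubic over a field that need not be algebraically closed: pass to the algebraic
  closure, where the Jacobian ideal contains all forms of degree \<open>6 = 2 * 3\<close>.
\<close>

lemma power_ideal_descent_smooth_cubic:
  fixes f :: "(3, 'k::field) mpoly"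
  assumes p: "Factorial_Ring.prime CHAR('k)" "CHAR('k) > 2" and f: "elliptic_cubic f"
    and N: "f ^ N \<in> power_ideal q" "\<not> CHAR('k) dvd N" "N + 2 \<le> q" "CHAR('k) dvd q"
  shows "f ^ (N - 1) \<in> power_ideal q"
proof -
  let ?f = "base_change f"
  have hom: "homogeneous 3 ?f" and smooth: "smooth_hypersurface f"
    using f by (simp_all add: elliptic_cubic_def)
  have "\<not> CHAR('k) dvd 2" using p(2) by (auto dest: dvd_imp_le)
  then have "(of_nat 2 :: 'k alg_closure) \<noteq> 0" by (simp only: of_nat_eq_0_iff_char_dvd CHAR_alg_closure) simp
  then have two: "(2 :: 'k alg_closure) \<noteq> 0" by simp
  have nonsing: "a v = 0" if "eval ?f a = 0" "\<And>v. eval (partial_deriv v ?f) a = 0" for a v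
    using smooth that unfolding smooth_hypersurface_def partial_deriv_base_change eval_base_change by blast
  have "?f ^ (N - 1) \<in> power_ideal q"
  proof (rule power_ideal_descent)
    show "\<exists>a b. single m 1 = a * ?f + (\<Sum>v\<in>UNIV. b v * partial_deriv v ?f)"
      if "total_degree m = 2 * CARD(3)" for m
      using that by (intro jacobian_ideal_contains_sextics[OF two hom]) (blast intro: nonsing, simp)
    show "?f ^ N \<in> power_ideal q" using N(1) by (simp flip: base_change_power)
  qed (use hom N in simp_all)
  then show ?thesis by (simp flip: base_change_power)
qed

theorem theorem1p1:
  fixes f :: "(3, 'k::field) mpoly" and p :: nat
  assumes "Factorial_Ring.prime p" and "p > 2" and "CHAR('k) = p"
    and "elliptic_cubic f"
  shows "(ordinary f \<longrightarrow> F_pure_threshold f = 1) \<and>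
         (supersingular f \<longrightarrow> F_pure_threshold f = 1 - 1 / real p)"
proof -
  have p: "Factorial_Ring.prime CHAR('k)" "CHAR('k) > 2" using assms(1-3) by simp_all
  have f: "homogeneous 3 f" using assms(4) by (simp add: elliptic_cubic_def)
  have f0: "f \<noteq> 0"
  proof
    assume "f = 0"
    then have "eval_ac f (\<lambda>_. 1) = 0" "eval_ac (partial_deriv v f) (\<lambda>_. 1) = 0" for v
      by (simp_all add: eval_ac_def)
    then show False using assms(4) unfolding elliptic_cubic_def smooth_hypersurface_def
      by (metis one_neq_zero)
  qed
  have "homogeneous (CARD(3) * (CHAR('k) - 1)) (f ^ (CHAR('k) - 1))"
    using homogeneous_power[OF f, of "CHAR('k) - 1"] by (simp add: mult.commute)
  then have hasse: "f ^ (CHAR('k) - 1) \<notin> power_ideal CHAR('k) \<longleftrightarrow> hasse_coefficient f \<noteq> 0"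
    unfolding hasse_coefficient_def using p(2) by (intro notin_power_ideal_homogeneous) auto
  show ?thesis
  proof (intro conjI impI)
    assume "ordinary f"
    then have "hasse_coefficient f \<noteq> 0"
      using hasse_zero_imp_supersingular[OF p(1) f] unfolding ordinary_def by blast
    then show "F_pure_threshold f = 1"
      using f hasse by (intro F_pure_threshold_ordinary[OF p(1)]) simp_all
  next
    assume "supersingular f"
    then have "f ^ (CHAR('k) - 1) \<in> power_ideal CHAR('k)"
      using supersingular_imp_hasse_zero[OF p(1) f f0] hasse by blast
    then have "F_pure_threshold f = 1 - 1 / real CHAR('k)"
      by (rule F_pure_threshold_supersingular[OF p _ power_ideal_descent_smooth_cubic[OF p assms(4)]])
    then show "F_pure_threshold f = 1 - 1 / real p" by (simp add: assms(3))
  qed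
qed

end
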